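(* Let $N\ge 2$ and $\beta>0$. There exists a universal constant $LS(\beta)>0$ (independent of $u$) such that for all nonzero $u$ with $\int_{\mathbb{H}^{N}}|\nabla_{\mathbb{H}}u|^{2}d\mu_{\mathbb{H}}+\int_{\mathbb{H}^{N}}|u|^{2}d\mu_{\mathbb{H}}<\infty$, $$\int_{\mathbb{H}^{N}}|u|^{2}\log\left(\frac{|u|^{2}}{\int_{\mathbb{H}^{N}}|u|^{2}d\mu_{\mathbb{H}}}\right)d\mu_{\mathbb{H}}\leq LS(\beta)\int_{\mathbb{H}^{N}}|\nabla_{\mathbb{H}}u|^{2}d\mu_{\mathbb{H}}.$$
   Context: $\mathbb{H}^{N}$ is the hyperbolic space in the Poincaré ball model: the Euclidean unit ball with Riemannian metric $\left(\frac{2}{1-|x|^{2}}\right)^{2}dx^{2}$, volume element $dV_{\mathbb{H}}=\left(\frac{2}{1-|x|^{2}}\right)^{N}dx$, Riemannian gradient $\nabla_{\mathbb{H}}=\left(\frac{1-|x|^{2}}{2}\right)^{2}\nabla$; $|\nabla_{\mathbb H}u|$ is the Riemannian norm. $\rho(x)=\log\frac{1+|x|}{1-|x|}$ is the hyperbolic distance from $x$ to $0$. $d\mu_{\mathbb{H}}=\frac{e^{-\beta\rho^{2}(x)}}{G}dV_{\mathbb{H}}$ with $G=\int_{\mathbb{H}^{N}}e^{-\beta\rho^{2}(x)}dV_{\mathbb{H}}$, a probability measure. Functions $u$ are real-valued and weakly differentiable; $0\log 0=0$. *)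

theory Defs
  imports "HOL-Analysis.Analysis"
begin

primrec C_k :: "nat \<Rightarrow> ('a::euclidean_space \<Rightarrow> real) \<Rightarrow> bool" where
  "C_k 0 f \<longleftrightarrow> continuous_on UNIV f"
| "C_k (Suc k) f \<longleftrightarrow> f differentiable_on UNIV \<and>
     (\<forall>i\<in>Basis. C_k k (\<lambda>x. frechet_derivative f (at x) i))"

definition test_function :: "'a::euclidean_space set \<Rightarrow> ('a \<Rightarrow> real) \<Rightarrow> bool" where
  "test_function S \<phi> \<longleftrightarrow>
     (\<forall>k. C_k k \<phi>) \<and> compact (closure {x. \<phi> x \<noteq> 0}) \<and> closure {x. \<phi> x \<noteq> 0} \<subseteq> S"

text \<open>
  The function \<open>u\<close> is weakly differentiable on the open set \<open>S\<close> with weak Euclidean gradient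
  \<open>g\<close>; such a \<open>g\<close> is unique up to null sets. Values outside \<open>S\<close> are irrelevant.
\<close>

definition has_weak_gradient ::
  "('a::euclidean_space \<Rightarrow> real) \<Rightarrow> ('a \<Rightarrow> 'a) \<Rightarrow> 'a set \<Rightarrow> bool" where
  "has_weak_gradient u g S \<longleftrightarrow>
     (\<forall>K. compact K \<and> K \<subseteq> S \<longrightarrow> u absolutely_integrable_on K \<and> g absolutely_integrable_on K) \<and>
     (\<forall>\<phi>. test_function S \<phi> \<longrightarrow>
        (\<forall>i\<in>Basis. (LINT x:S|lebesgue. u x * frechet_derivative \<phi> (at x) i)
                  = - (LINT x:S|lebesgue. (g x \<bullet> i) * \<phi> x)))"

definition hyp_volume :: "'a::euclidean_space measure" where
  "hyp_volume = density (lebesgue_on (ball 0 1))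
     (\<lambda>x. ennreal ((2 / (1 - (norm x)\<^sup>2)) ^ DIM('a)))"

definition hyp_dist0 :: "'a::euclidean_space \<Rightarrow> real" where
  "hyp_dist0 x = ln ((1 + norm x) / (1 - norm x))"

text \<open>Norm of a tangent vector \<open>v\<close> at \<open>x\<close> for the metric \<open>(2 / (1 - |x|\<^sup>2))\<^sup>2 dx\<^sup>2\<close>.\<close>

definition hyp_norm :: "'a::euclidean_space \<Rightarrow> 'a \<Rightarrow> real" where
  "hyp_norm x v = 2 / (1 - (norm x)\<^sup>2) * norm v"

text \<open>The hyperbolic gradient, as a vector field, of a function with Euclidean gradient \<open>g\<close>.\<close>

definition hyp_grad :: "('a::euclidean_space \<Rightarrow> 'a) \<Rightarrow> 'a \<Rightarrow> 'a" where
  "hyp_grad g x = ((1 - (norm x)\<^sup>2) / 2)\<^sup>2 *\<^sub>R g x"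

definition hyp_gauss_const :: "'a::euclidean_space itself \<Rightarrow> real \<Rightarrow> real" where
  "hyp_gauss_const _ \<beta> = (LINT x|(hyp_volume :: 'a measure). exp (- \<beta> * (hyp_dist0 x)\<^sup>2))"

definition hyp_gauss :: "real \<Rightarrow> 'a::euclidean_space measure" where
  "hyp_gauss \<beta> = density hyp_volume
     (\<lambda>x. ennreal (exp (- \<beta> * (hyp_dist0 x)\<^sup>2) / hyp_gauss_const TYPE('a) \<beta>))"

end

theory Submission
  imports Defs
begin

text \<open>
  Put \<open>\<sigma> = ln (4 / (1 - |x|\<^sup>2))\<close>, which differs from the distance \<open>\<rho>\<close> to the origin by so little that
  \<open>\<rho>\<^sup>2 \<le> \<sigma>\<^sup>2 \<le> \<rho>\<^sup>2 + 16\<close>; up to bounded factors the measure is \<open>F dx\<close> with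
  \<open>N = DIM('a)\<close> and \<open>F = exp (N \<sigma> - \<beta> \<sigma>\<^sup>2)\<close>. The Gaussian drift gives a bound of \<open>\<integral> \<sigma>\<^sup>2 u\<^sup>2 F\<close> by the energy and the mass, by
  integrating the divergence of a radial vector field over Euclidean balls of radius \<open>R < 1\<close>, where the
  boundary term has the favourable sign. Multiplication by \<open>\<surd>F\<close> over the conformal factor turns the energy into
  a Euclidean one, and Euclidean averaging over contracted copies of the ball then yields a defective
  logarithmic Sobolev inequality whose error terms are absorbed by the drift bound. Together with the
  Poincare inequality, which follows from the drift bound and the Poincare inequality on a fixed smaller
  ball, the inequality becomes tight. All constants are independent of \<open>R\<close>, so that one can mollify and let
  \<open>R\<close> tend to \<open>1\<close>.
\<close>

section \<open>Sobolev-type inequalities on convex sets\<close>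

text \<open>The obstacle is a weight that blows up at the sphere. For
  \<open>h = u * conf_weight\<close> the gradient terms carry no weight any more, but the mass
  becomes \<open>W * h\<^sup>2\<close>, where \<open>W\<close> is the square of the conformal
  factor. An estimate that loses a power of \<open>W\<close> would be useless.
  \<open>weighted_log_Sobolev\<close> loses only the factor \<open>1 + ln W\<close>, hence a
  quadratic polynomial in \<sigma>, and a second moment of \<sigma> is just what the Gaussian decay
  pays for. The entropy is never estimated directly. It is replaced by the integral of
  \<open>Phi k\<close>, whose integrand is nonnegative: as in the perturbation argument of Holley
  and Stroock this allows the true density to be exchanged for the smooth weight, and it allows
  Fatou's lemma in the limit. The choice of \<open>k\<close> as the maximum of
  \<open>c\<^sup>2\<close> and \<open>V\<close>, with \<open>c\<close> an average over a fixed ball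
  and \<open>V\<close> a bound for the energy, does the work of Rothaus' lemma. \<open>V\<close>
  remains a free positive number until the very end, because the energy may vanish.\<close>

lemma nn_integral_lborel_affine:
  fixes f :: "'a::euclidean_space \<Rightarrow> ennreal"
  assumes [measurable]: "f \<in> borel_measurable borel" and "c > 0"
  shows "(\<integral>\<^sup>+x. f (t + c *\<^sub>R x) \<partial>lborel) = ennreal ((1 / c) ^ DIM('a)) * (\<integral>\<^sup>+x. f x \<partial>lborel)"
proof -
  have "(\<integral>\<^sup>+x. f x \<partial>lborel)
      = (\<integral>\<^sup>+x. f x \<partial>density (distr lborel borel (\<lambda>x. t + c *\<^sub>R x)) (\<lambda>_. \<bar>c\<bar> ^ DIM('a)))"
    using lborel_affine[of c t] \<open>c > 0\<close> by simp
  also have "\<dots> = ennreal (c ^ DIM('a)) * (\<integral>\<^sup>+x. f (t + c *\<^sub>R x) \<partial>lborel)"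
    using \<open>c > 0\<close> by (simp add: nn_integral_density nn_integral_distr nn_integral_cmult)
  finally show ?thesis
    using \<open>c > 0\<close>
    by (simp add: mult.assoc[symmetric] ennreal_mult[symmetric] power_mult_distrib[symmetric])
qed

section \<open>Contractions and the Poincare inequality on convex sets\<close>

text \<open>Fundamental theorem of calculus along the segment from \<open>x\<close> towards
  \<open>z\<close>, followed by Cauchy-Schwarz. Stopping at \<open>t\<close> leaves one factor
  \<open>t\<close>; a second one appears later as the length of the range of
  \<open>s\<close>.\<close>

lemma square_increment_le:
  fixes h :: "'a::euclidean_space \<Rightarrow> real" and Dh :: "'a \<Rightarrow> 'a"
  assumes S: "convex S" "x \<in> S" "z \<in> S" and d: "norm (z - x) \<le> d" and t: "0 \<le> t" "t \<le> 1"
    and h: "\<And>x. x \<in> S \<Longrightarrow> (h has_derivative (\<lambda>v. Dh x \<bullet> v)) (at x)"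
    and Dh: "continuous_on S Dh"
  shows "ennreal ((h x - h (x + t *\<^sub>R (z - x)))\<^sup>2)
    \<le> ennreal (t * d\<^sup>2) * (\<integral>\<^sup>+s\<in>{0..t}. ennreal ((norm (Dh (x + s *\<^sub>R (z - x))))\<^sup>2) \<partial>lborel)"
proof -
  let ?p = "\<lambda>s. x + s *\<^sub>R (z - x)"
  have pS: "?p s \<in> S" if "s \<in> {0..t}" for s
  proof -
    have "(1 - s) *\<^sub>R x + s *\<^sub>R z \<in> S" using S t that by (intro convexD) auto
    then show ?thesis by (simp add: algebra_simps)
  qed
  have cp: "continuous_on {0..t} (\<lambda>s. Dh (?p s))"
    by (intro continuous_on_compose2[OF Dh]) (auto intro!: continuous_intros pS)
  have der: "((\<lambda>s. h (?p s)) has_vector_derivative (Dh (?p s) \<bullet> (z - x))) (at s within {0..t})"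
    if "0 \<le> s" "s \<le> t" for s
  proof -
    have "((\<lambda>s. h (?p s)) has_derivative (\<lambda>v. Dh (?p s) \<bullet> (v *\<^sub>R (z - x)))) (at s within {0..t})"
      using that by (intro has_derivative_compose[OF _ h]) (auto intro!: derivative_eq_intros pS)
    then show ?thesis by (simp add: has_vector_derivative_def)
  qed
  have cont: "continuous_on {0..t} (\<lambda>s. Dh (?p s) \<bullet> (z - x))"
    by (intro continuous_intros cp)
  have "h (?p t) - h (?p 0) = (LBINT s:{0..t}. Dh (?p s) \<bullet> (z - x))"
    using integral_FTC_Icc[OF t(1) der cont] by (simp add: set_lebesgue_integral_def)
  then have "\<bar>h x - h (?p t)\<bar> \<le> (LBINT s:{0..t}. d * norm (Dh (?p s)))"
  proof -
    have "\<bar>h x - h (?p t)\<bar> = norm (LBINT s:{0..t}. Dh (?p s) \<bullet> (z - x))"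
      using \<open>h (?p t) - h (?p 0) = _\<close> by simp
    also have "\<dots> \<le> (LBINT s:{0..t}. norm (Dh (?p s) \<bullet> (z - x)))"
      by (rule set_integral_norm_bound) (auto intro!: borel_integrable_atLeastAtMost' cont)
    also have "\<dots> \<le> (LBINT s:{0..t}. d * norm (Dh (?p s)))"
    proof (rule set_integral_mono)
      show "norm (Dh (?p s) \<bullet> (z - x)) \<le> d * norm (Dh (?p s))" for s
        using Cauchy_Schwarz_ineq2[of "Dh (?p s)" "z - x"] mult_right_mono[OF d, of "norm (Dh (?p s))"]
        by (simp add: mult.commute)
    qed (auto intro!: borel_integrable_atLeastAtMost' continuous_intros cp cont)
    finally show ?thesis .
  qed
  moreover have "ennreal (LBINT s:{0..t}. d * norm (Dh (?p s)))
      = (\<integral>\<^sup>+s. ennreal (indicator {0..t} s * (d * norm (Dh (?p s)))) \<partial>lborel)"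
    unfolding set_lebesgue_integral_def
    using borel_integrable_atLeastAtMost'[of 0 t "\<lambda>s. d * norm (Dh (?p s))", OF continuous_on_mult_left[OF continuous_on_norm[OF cp]]] d
    by (subst nn_integral_eq_integral) (auto intro!: order_trans[OF norm_ge_zero d]
        simp: set_integrable_def zero_le_mult_iff)
  ultimately have "ennreal (\<bar>h x - h (?p t)\<bar>)
      \<le> (\<integral>\<^sup>+s. ennreal (indicator {0..t} s * norm (Dh (?p s))) * ennreal (d * indicator {0..t} s) \<partial>lborel)"
    (is "_ \<le> ?J")
  proof -
    have "(\<integral>\<^sup>+s. ennreal (indicator {0..t} s * (d * norm (Dh (?p s)))) \<partial>lborel) = ?J"
      using order_trans[OF norm_ge_zero d]
      by (intro nn_integral_cong) (auto split: split_indicator simp: ennreal_mult[symmetric] mult.commute)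
    with \<open>ennreal _ = _\<close> ennreal_leI[OF \<open>\<bar>h x - h (?p t)\<bar> \<le> _\<close>] show ?thesis by simp
  qed
  then have "(ennreal (\<bar>h x - h (?p t)\<bar>))\<^sup>2 \<le> ?J\<^sup>2"
    by (rule power_mono) simp
  also have "\<dots> \<le> (\<integral>\<^sup>+s. (ennreal (indicator {0..t} s * norm (Dh (?p s))))\<^sup>2 \<partial>lborel)
      * (\<integral>\<^sup>+s. (ennreal (d * indicator {0..t} s))\<^sup>2 \<partial>lborel)"
  proof (rule Cauchy_Schwarz_nn_integral)
    have "(\<lambda>s. indicator {0..t} s *\<^sub>R norm (Dh (?p s))) \<in> borel_measurable borel"
      by (intro borel_measurable_continuous_on_indicator continuous_intros cp) auto
    then show "(\<lambda>s. ennreal (indicator {0..t} s * norm (Dh (?p s)))) \<in> borel_measurable lborel"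
      by simp
  qed simp
  also have "(\<integral>\<^sup>+s. (ennreal (d * indicator {0..t} s))\<^sup>2 \<partial>lborel)
      = (\<integral>\<^sup>+s. ennreal (d\<^sup>2) * indicator {0..t} s \<partial>lborel)"
    using order_trans[OF norm_ge_zero d]
    by (intro nn_integral_cong) (auto split: split_indicator simp: ennreal_power)
  also have "\<dots> = ennreal (t * d\<^sup>2)"
    using t by (subst nn_integral_cmult) (auto simp: ennreal_mult[symmetric] mult.commute)
  also have "(\<integral>\<^sup>+s. (ennreal (indicator {0..t} s * norm (Dh (?p s))))\<^sup>2 \<partial>lborel)
      = (\<integral>\<^sup>+s\<in>{0..t}. ennreal ((norm (Dh (?p s)))\<^sup>2) \<partial>lborel)"
    by (intro nn_integral_cong) (auto split: split_indicator simp: ennreal_power)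
  finally show ?thesis
    by (simp add: ennreal_power mult.commute)
qed

text \<open>After the integrals over \<open>x\<close> and \<open>s\<close> are exchanged, the map
  from \<open>x\<close> to \<open>x + s *\<^sub>R (z - x)\<close> shrinks \<open>S\<close> into
  itself with Jacobian \<open>(1 - s) ^ DIM('a)\<close>. The restriction of \<open>t\<close> to at
  most 1/2 keeps the inverse Jacobian below \<open>2 ^ DIM('a)\<close>, uniformly in
  \<open>z\<close>.\<close>

lemma nn_integral_contraction_le:
  fixes h :: "'a::euclidean_space \<Rightarrow> real" and Dh :: "'a \<Rightarrow> 'a"
  assumes S: "convex S" "S \<in> sets borel" "z \<in> S" and d: "\<And>x. x \<in> S \<Longrightarrow> norm (z - x) \<le> d"
    and t: "0 \<le> t" "t \<le> 1 / 2"
    and h: "\<And>x. x \<in> S \<Longrightarrow> (h has_derivative (\<lambda>v. Dh x \<bullet> v)) (at x)"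
    and Dh: "continuous_on S Dh" and [measurable]: "Dh \<in> borel_measurable borel"
  shows "(\<integral>\<^sup>+x\<in>S. ennreal ((h x - h (x + t *\<^sub>R (z - x)))\<^sup>2) \<partial>lborel)
    \<le> ennreal (t\<^sup>2 * d\<^sup>2 * 2 ^ DIM('a)) * (\<integral>\<^sup>+x\<in>S. ennreal ((norm (Dh x))\<^sup>2) \<partial>lborel)"
proof -
  note [measurable] = S(2)
  let ?p = "\<lambda>x s. x + s *\<^sub>R (z - x)"
  let ?K = "\<integral>\<^sup>+x\<in>S. ennreal ((norm (Dh x))\<^sup>2) \<partial>lborel"
  have pS: "?p x s \<in> S" if "s \<in> {0..t}" "x \<in> S" for s x
  proof -
    have "(1 - s) *\<^sub>R x + s *\<^sub>R z \<in> S" using S t that by (intro convexD) auto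
    then show ?thesis by (simp add: algebra_simps)
  qed
  have inner: "(\<integral>\<^sup>+x. ennreal ((norm (Dh (?p x s)))\<^sup>2) * indicator S x \<partial>lborel) \<le> ennreal (2 ^ DIM('a)) * ?K"
    if s: "s \<in> {0..t}" for s
  proof -
    have "(\<integral>\<^sup>+x. ennreal ((norm (Dh (?p x s)))\<^sup>2) * indicator S x \<partial>lborel)
        \<le> (\<integral>\<^sup>+x. ennreal ((norm (Dh (s *\<^sub>R z + (1 - s) *\<^sub>R x)))\<^sup>2) * indicator S (s *\<^sub>R z + (1 - s) *\<^sub>R x) \<partial>lborel)"
      using pS[OF s] by (intro nn_integral_mono) (auto split: split_indicator simp: algebra_simps)
    also have "\<dots> = ennreal ((1 / (1 - s)) ^ DIM('a)) * ?K"
      using s t by (subst nn_integral_lborel_affine[where f="\<lambda>y. ennreal ((norm (Dh y))\<^sup>2) * indicator S y"]) auto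
    also have "\<dots> \<le> ennreal (2 ^ DIM('a)) * ?K"
      using s t by (intro mult_right_mono ennreal_leI power_mono) (auto simp: field_simps)
    finally show ?thesis .
  qed
  have "(\<integral>\<^sup>+x\<in>S. ennreal ((h x - h (?p x t))\<^sup>2) \<partial>lborel)
      \<le> (\<integral>\<^sup>+x. ennreal (t * d\<^sup>2) * (\<integral>\<^sup>+s. ennreal ((norm (Dh (?p x s)))\<^sup>2) * indicator {0..t} s * indicator S x \<partial>lborel) \<partial>lborel)"
  proof (intro nn_integral_mono)
    fix x
    show "ennreal ((h x - h (?p x t))\<^sup>2) * indicator S x
      \<le> ennreal (t * d\<^sup>2) * (\<integral>\<^sup>+s. ennreal ((norm (Dh (?p x s)))\<^sup>2) * indicator {0..t} s * indicator S x \<partial>lborel)"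
      using square_increment_le[OF S(1) _ S(3) d t(1) _ h Dh, of x] t
      by (auto split: split_indicator)
  qed
  also have "\<dots> = ennreal (t * d\<^sup>2) * (\<integral>\<^sup>+x. (\<integral>\<^sup>+s. ennreal ((norm (Dh (?p x s)))\<^sup>2) * indicator {0..t} s * indicator S x \<partial>lborel) \<partial>lborel)"
    by (intro nn_integral_cmult) measurable
  also have "(\<integral>\<^sup>+x. (\<integral>\<^sup>+s. ennreal ((norm (Dh (?p x s)))\<^sup>2) * indicator {0..t} s * indicator S x \<partial>lborel) \<partial>lborel)
     = (\<integral>\<^sup>+s. (\<integral>\<^sup>+x. ennreal ((norm (Dh (?p x s)))\<^sup>2) * indicator {0..t} s * indicator S x \<partial>lborel) \<partial>lborel)"
    by (rule lborel_pair.Fubini') measurable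
  also have "\<dots> \<le> (\<integral>\<^sup>+s. ennreal (2 ^ DIM('a)) * ?K * indicator {0..t} s \<partial>lborel)"
    using inner by (intro nn_integral_mono) (auto split: split_indicator)
  also have "\<dots> = ennreal (2 ^ DIM('a)) * ?K * ennreal t"
    using t by (simp add: nn_integral_cmult)
  finally have "(\<integral>\<^sup>+x\<in>S. ennreal ((h x - h (?p x t))\<^sup>2) \<partial>lborel)
      \<le> ennreal (t * d\<^sup>2) * (ennreal (2 ^ DIM('a)) * ?K * ennreal t)"
    by (simp add: mult_left_mono)
  also have "\<dots> = ennreal (t * d\<^sup>2) * ennreal (2 ^ DIM('a)) * ennreal t * ?K"
    by (simp only: mult_ac)
  also have "ennreal (t * d\<^sup>2) * ennreal (2 ^ DIM('a)) * ennreal t = ennreal (t\<^sup>2 * d\<^sup>2 * 2 ^ DIM('a))"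
    using t by (simp add: ennreal_mult[symmetric]) (simp add: power2_eq_square mult_ac)
  finally show ?thesis .
qed

text \<open>Contracting \<open>S\<close> towards \<open>x\<close> by the factor \<open>t\<close>
  gives a small copy inside \<open>S\<close>, and \<open>h x\<close> is compared with the values of
  \<open>h\<close> on this copy. The mean of the square over the copy costs at most the inverse
  relative volume \<open>(1 / t) ^ DIM('a)\<close>. Thus the first term is the oscillation at scale
  \<open>t\<close>, while the second sees only the total mass.\<close>

lemma nn_integral_square_average_le:
  fixes h :: "'a::euclidean_space \<Rightarrow> real"
  assumes S: "convex S" "S \<in> sets borel" "x \<in> S" and t: "0 < t" "t \<le> 1"
    and [measurable]: "h \<in> borel_measurable borel"
  shows "ennreal ((h x)\<^sup>2) * emeasure lborel S
    \<le> 2 * (\<integral>\<^sup>+z\<in>S. ennreal ((h x - h (x + t *\<^sub>R (z - x)))\<^sup>2) \<partial>lborel)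
      + ennreal (2 * (1 / t) ^ DIM('a)) * (\<integral>\<^sup>+z\<in>S. ennreal ((h z)\<^sup>2) \<partial>lborel)"
proof -
  note [measurable] = S(2)
  let ?p = "\<lambda>z. x + t *\<^sub>R (z - x)"
  have pS: "?p z \<in> S" if "z \<in> S" for z
  proof -
    have "(1 - t) *\<^sub>R x + t *\<^sub>R z \<in> S" using S t that by (intro convexD) auto
    then show ?thesis by (simp add: algebra_simps)
  qed
  have "ennreal ((h x)\<^sup>2) * emeasure lborel S = (\<integral>\<^sup>+z\<in>S. ennreal ((h x)\<^sup>2) \<partial>lborel)"
    by (simp add: nn_integral_cmult)
  also have "\<dots> \<le> (\<integral>\<^sup>+z. 2 * (ennreal ((h x - h (?p z))\<^sup>2) * indicator S z)
      + 2 * (ennreal ((h (?p z))\<^sup>2) * indicator S (?p z)) \<partial>lborel)"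
  proof (intro nn_integral_mono)
    fix z
    have "(h x)\<^sup>2 \<le> 2 * (h x - h (?p z))\<^sup>2 + 2 * (h (?p z))\<^sup>2"
      using zero_le_power2[of "h x - 2 * h (?p z)"] by (simp add: power2_eq_square algebra_simps)
    then have "ennreal ((h x)\<^sup>2) \<le> 2 * ennreal ((h x - h (?p z))\<^sup>2) + 2 * ennreal ((h (?p z))\<^sup>2)"
      using ennreal_leI[of "(h x)\<^sup>2" "2 * (h x - h (?p z))\<^sup>2 + 2 * (h (?p z))\<^sup>2"]
      by (simp add: ennreal_plus ennreal_mult)
    then show "ennreal ((h x)\<^sup>2) * indicator S z
      \<le> 2 * (ennreal ((h x - h (?p z))\<^sup>2) * indicator S z) + 2 * (ennreal ((h (?p z))\<^sup>2) * indicator S (?p z))"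
      using pS[of z] by (auto split: split_indicator)
  qed
  also have "\<dots> = 2 * (\<integral>\<^sup>+z\<in>S. ennreal ((h x - h (?p z))\<^sup>2) \<partial>lborel)
      + 2 * (\<integral>\<^sup>+z. ennreal ((h ((1 - t) *\<^sub>R x + t *\<^sub>R z))\<^sup>2) * indicator S ((1 - t) *\<^sub>R x + t *\<^sub>R z) \<partial>lborel)"
  proof -
    have "?p z = (1 - t) *\<^sub>R x + t *\<^sub>R z" for z by (simp add: algebra_simps)
    then show ?thesis
      by (simp only:) (subst nn_integral_add, simp, simp, subst (1 2) nn_integral_cmult, simp_all)
  qed
  also have "(\<integral>\<^sup>+z. ennreal ((h ((1 - t) *\<^sub>R x + t *\<^sub>R z))\<^sup>2) * indicator S ((1 - t) *\<^sub>R x + t *\<^sub>R z) \<partial>lborel)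
      = ennreal ((1 / t) ^ DIM('a)) * (\<integral>\<^sup>+z\<in>S. ennreal ((h z)\<^sup>2) \<partial>lborel)"
    using t by (subst nn_integral_lborel_affine[where f="\<lambda>z. ennreal ((h z)\<^sup>2) * indicator S z"]) auto
  also have "2 * (ennreal ((1 / t) ^ DIM('a)) * (\<integral>\<^sup>+z\<in>S. ennreal ((h z)\<^sup>2) \<partial>lborel))
      = ennreal (2 * (1 / t) ^ DIM('a)) * (\<integral>\<^sup>+z\<in>S. ennreal ((h z)\<^sup>2) \<partial>lborel)"
    using t by (simp add: ennreal_mult mult.assoc)
  finally show ?thesis .
qed

lemma nn_integral_contraction_average_le:
  fixes h :: "'a::euclidean_space \<Rightarrow> real" and Dh :: "'a \<Rightarrow> 'a"
  assumes S: "convex S" "S \<in> sets borel" and d: "\<And>x z. x \<in> S \<Longrightarrow> z \<in> S \<Longrightarrow> norm (z - x) \<le> d"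
    and t: "0 \<le> t" "t \<le> 1 / 2"
    and h: "\<And>x. x \<in> S \<Longrightarrow> (h has_derivative (\<lambda>v. Dh x \<bullet> v)) (at x)"
    and Dh: "continuous_on S Dh"
    and [measurable]: "h \<in> borel_measurable borel" "Dh \<in> borel_measurable borel"
  shows "(\<integral>\<^sup>+x\<in>S. (\<integral>\<^sup>+z\<in>S. ennreal ((h x - h (x + t *\<^sub>R (z - x)))\<^sup>2) \<partial>lborel) \<partial>lborel)
    \<le> ennreal (t\<^sup>2 * d\<^sup>2 * 2 ^ DIM('a)) * (\<integral>\<^sup>+x\<in>S. ennreal ((norm (Dh x))\<^sup>2) \<partial>lborel) * emeasure lborel S"
proof -
  note [measurable] = S(2)
  have "(\<integral>\<^sup>+x\<in>S. (\<integral>\<^sup>+z\<in>S. ennreal ((h x - h (x + t *\<^sub>R (z - x)))\<^sup>2) \<partial>lborel) \<partial>lborel)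
      = (\<integral>\<^sup>+x. (\<integral>\<^sup>+z. ennreal ((h x - h (x + t *\<^sub>R (z - x)))\<^sup>2) * indicator S z * indicator S x \<partial>lborel) \<partial>lborel)"
    by (intro nn_integral_cong) (auto split: split_indicator)
  also have "\<dots> = (\<integral>\<^sup>+z. (\<integral>\<^sup>+x. ennreal ((h x - h (x + t *\<^sub>R (z - x)))\<^sup>2) * indicator S z * indicator S x \<partial>lborel) \<partial>lborel)"
    by (rule lborel_pair.Fubini') measurable
  also have "\<dots> \<le> (\<integral>\<^sup>+z. ennreal (t\<^sup>2 * d\<^sup>2 * 2 ^ DIM('a)) * (\<integral>\<^sup>+x\<in>S. ennreal ((norm (Dh x))\<^sup>2) \<partial>lborel)
       * indicator S z \<partial>lborel)"
    using nn_integral_contraction_le[OF S _ d t h Dh] by (intro nn_integral_mono) (auto split: split_indicator)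
  also have "\<dots> = ennreal (t\<^sup>2 * d\<^sup>2 * 2 ^ DIM('a)) * (\<integral>\<^sup>+x\<in>S. ennreal ((norm (Dh x))\<^sup>2) \<partial>lborel) * emeasure lborel S"
    by (simp add: nn_integral_cmult)
  finally show ?thesis .
qed

text \<open>The increment from \<open>x\<close> to \<open>z\<close> is split at the midpoint, so
  that both halves are contractions with \<open>t = 1/2\<close>, one towards \<open>z\<close> and
  one towards \<open>x\<close>. A single contraction all the way from \<open>x\<close> to
  \<open>z\<close> would have a degenerate Jacobian at its end.\<close>

lemma Poincare_convex:
  fixes h :: "'a::euclidean_space \<Rightarrow> real" and Dh :: "'a \<Rightarrow> 'a"
  assumes S: "convex S" "compact S" and d: "\<And>x z. x \<in> S \<Longrightarrow> z \<in> S \<Longrightarrow> norm (z - x) \<le> d"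
    and pos: "measure lborel S > 0"
    and h: "\<And>x. x \<in> S \<Longrightarrow> (h has_derivative (\<lambda>v. Dh x \<bullet> v)) (at x)"
    and Dh: "continuous_on S Dh"
    and [measurable]: "h \<in> borel_measurable borel" "Dh \<in> borel_measurable borel"
  defines "c \<equiv> (LINT x:S|lborel. h x) / measure lborel S"
  shows "(\<integral>\<^sup>+x\<in>S. ennreal ((h x - c)\<^sup>2) \<partial>lborel)
    \<le> ennreal (d\<^sup>2 * 2 ^ DIM('a)) * (\<integral>\<^sup>+x\<in>S. ennreal ((norm (Dh x))\<^sup>2) \<partial>lborel)"
proof -
  have Sb[measurable]: "S \<in> sets borel" using S by (simp add: borel_compact)
  define m where "m = measure lborel S"
  have m: "m > 0" using pos by (simp add: m_def)
  have em: "emeasure lborel S = ennreal m"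
    unfolding m_def using emeasure_compact_finite[OF S(2)] by (intro emeasure_eq_ennreal_measure) auto
  let ?K = "\<integral>\<^sup>+x\<in>S. ennreal ((norm (Dh x))\<^sup>2) \<partial>lborel"
  let ?G = "\<lambda>x z. ennreal ((h x - h (x + (1/2) *\<^sub>R (z - x)))\<^sup>2)"
  have ch: "continuous_on S h"
    using h by (intro continuous_at_imp_continuous_on ballI has_derivative_continuous) blast
  have hi: "set_integrable lborel S h"
    unfolding set_integrable_def using borel_integrable_compact[OF S(2) ch] .
  have jensen: "ennreal m * ennreal ((h x - c)\<^sup>2) \<le> (\<integral>\<^sup>+z\<in>S. ennreal ((h x - h z)\<^sup>2) \<partial>lborel)" (is "_ \<le> ?J x") for x
  proof -
    have hxi: "set_integrable lborel S (\<lambda>z. h x - h z)"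
      using hi em by (intro set_integral_diff) (auto simp: set_integrable_def)
    have "m * (h x - c) = (LINT z:S|lborel. h x - h z)"
      using hi m em by (subst set_integral_diff)
         (auto simp: set_integrable_def c_def m_def[symmetric] set_lebesgue_integral_def field_simps)
    then have "m * \<bar>h x - c\<bar> = norm (LINT z:S|lborel. h x - h z)"
      using m by (metis abs_mult abs_of_pos real_norm_def)
    also have "\<dots> \<le> (LINT z:S|lborel. norm (h x - h z))"
      by (rule set_integral_norm_bound[OF hxi])
    finally have "ennreal (m * \<bar>h x - c\<bar>) \<le> ennreal (LINT z:S|lborel. norm (h x - h z))"
      by (rule ennreal_leI)
    also have "\<dots> = (\<integral>\<^sup>+z. ennreal (indicator S z * \<bar>h x - h z\<bar>) \<partial>lborel)"
      using integrable_norm[OF hxi[unfolded set_integrable_def]] unfolding set_lebesgue_integral_def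
      by (subst nn_integral_eq_integral) (auto simp: abs_mult)
    also have "\<dots> = (\<integral>\<^sup>+z. (ennreal \<bar>h x - h z\<bar> * indicator S z) * indicator S z \<partial>lborel)"
      by (intro nn_integral_cong) (auto split: split_indicator)
    finally have "(ennreal (m * \<bar>h x - c\<bar>))\<^sup>2
        \<le> (\<integral>\<^sup>+z. (ennreal \<bar>h x - h z\<bar> * indicator S z) * indicator S z \<partial>lborel)\<^sup>2"
      by (rule power_mono) simp
    also have "\<dots> \<le> (\<integral>\<^sup>+z. (ennreal \<bar>h x - h z\<bar> * indicator S z)\<^sup>2 \<partial>lborel)
         * (\<integral>\<^sup>+z. (indicator S z)\<^sup>2 \<partial>lborel)"
      by (rule Cauchy_Schwarz_nn_integral) measurable
    also have "(\<integral>\<^sup>+z. (ennreal \<bar>h x - h z\<bar> * indicator S z)\<^sup>2 \<partial>lborel) = ?J x"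
      by (intro nn_integral_cong) (auto split: split_indicator simp: ennreal_power)
    also have "(\<integral>\<^sup>+z. (indicator S z)\<^sup>2 \<partial>lborel) = ennreal m"
    proof -
      have "(\<integral>\<^sup>+z. (indicator S z)\<^sup>2 \<partial>lborel) = (\<integral>\<^sup>+z. indicator S z \<partial>lborel)"
        by (intro nn_integral_cong) (auto split: split_indicator)
      then show ?thesis using em by simp
    qed
    finally have "ennreal m * (ennreal m * ennreal ((h x - c)\<^sup>2)) \<le> ennreal m * ?J x"
      using m by (simp add: ennreal_power power_mult_distrib ennreal_mult[symmetric] power2_eq_square mult_ac)
    then show ?thesis
      using m by (simp add: ennreal_mult_le_mult_iff)
  qed
  have "ennreal m * (\<integral>\<^sup>+x\<in>S. ennreal ((h x - c)\<^sup>2) \<partial>lborel)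
      = (\<integral>\<^sup>+x. ennreal m * (ennreal ((h x - c)\<^sup>2) * indicator S x) \<partial>lborel)"
    by (subst nn_integral_cmult) auto
  also have "\<dots> \<le> (\<integral>\<^sup>+x. (\<integral>\<^sup>+z. ennreal ((h x - h z)\<^sup>2) * indicator S z * indicator S x \<partial>lborel) \<partial>lborel)"
    using jensen by (intro nn_integral_mono) (auto split: split_indicator)
  also have "\<dots> \<le> (\<integral>\<^sup>+x. (\<integral>\<^sup>+z. 2 * (?G x z * indicator S z * indicator S x)
       + 2 * (?G z x * indicator S z * indicator S x) \<partial>lborel) \<partial>lborel)"
  proof (intro nn_integral_mono)
    fix x z :: 'a
    let ?y = "x + (1/2) *\<^sub>R (z - x)"
    have y: "z + (1/2) *\<^sub>R (x - z) = ?y"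
      by (rule euclidean_eqI) (simp add: inner_simps field_simps)
    have "(h x - h z)\<^sup>2 \<le> 2 * (h x - h ?y)\<^sup>2 + 2 * (h z - h ?y)\<^sup>2"
      using zero_le_power2[of "(h x - h ?y) + (h z - h ?y)"] by (simp add: power2_eq_square algebra_simps)
    then have "ennreal ((h x - h z)\<^sup>2) \<le> ennreal (2 * (h x - h ?y)\<^sup>2 + 2 * (h z - h ?y)\<^sup>2)"
      by (rule ennreal_leI)
    also have "\<dots> = 2 * ennreal ((h x - h ?y)\<^sup>2) + 2 * ennreal ((h z - h ?y)\<^sup>2)"
      by (simp add: ennreal_plus ennreal_mult)
    finally show "ennreal ((h x - h z)\<^sup>2) * indicator S z * indicator S x
      \<le> 2 * (?G x z * indicator S z * indicator S x) + 2 * (?G z x * indicator S z * indicator S x)"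
      unfolding y by (cases "x \<in> S"; cases "z \<in> S") simp_all
  qed
  also have "\<dots> = 2 * (\<integral>\<^sup>+x. (\<integral>\<^sup>+z. ?G x z * indicator S z * indicator S x \<partial>lborel) \<partial>lborel)
       + 2 * (\<integral>\<^sup>+x. (\<integral>\<^sup>+z. ?G z x * indicator S z * indicator S x \<partial>lborel) \<partial>lborel)"
    by (simp add: nn_integral_add nn_integral_cmult)
  also have "(\<integral>\<^sup>+x. (\<integral>\<^sup>+z. ?G z x * indicator S z * indicator S x \<partial>lborel) \<partial>lborel)
      = (\<integral>\<^sup>+z. (\<integral>\<^sup>+x. ?G z x * indicator S z * indicator S x \<partial>lborel) \<partial>lborel)"
    by (rule lborel_pair.Fubini') measurable
  also have "\<dots> = (\<integral>\<^sup>+x. (\<integral>\<^sup>+z. ?G x z * indicator S z * indicator S x \<partial>lborel) \<partial>lborel)"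
    by (simp add: mult_ac)
  also have "\<dots> = (\<integral>\<^sup>+x\<in>S. (\<integral>\<^sup>+z\<in>S. ?G x z \<partial>lborel) \<partial>lborel)"
    by (intro nn_integral_cong) (auto split: split_indicator)
  also have "2 * \<dots> + 2 * \<dots> = 4 * \<dots>"
    by (simp flip: distrib_right)
  also have "\<dots> \<le> 4 * (ennreal ((1/2)\<^sup>2 * d\<^sup>2 * 2 ^ DIM('a)) * ?K * ennreal m)"
    using nn_integral_contraction_average_le[OF S(1) Sb d _ _ h Dh, of "1/2"] em by (intro mult_left_mono) auto
  also have "\<dots> = ennreal m * ((4 * ennreal ((1/2)\<^sup>2 * d\<^sup>2 * 2 ^ DIM('a))) * ?K)"
    by (simp only: mult_ac)
  also have "4 * ennreal ((1/2)\<^sup>2 * d\<^sup>2 * 2 ^ DIM('a)) = ennreal (4 * ((1/2)\<^sup>2 * d\<^sup>2 * 2 ^ DIM('a)))"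
    by (subst ennreal_mult) auto
  also have "4 * ((1/2)\<^sup>2 * d\<^sup>2 * 2 ^ DIM('a)) = d\<^sup>2 * 2 ^ DIM('a)"
    by (simp add: power2_eq_square)
  finally show ?thesis
    using m by (simp add: ennreal_mult_le_mult_iff)
qed

section \<open>Dyadic scales and a logarithmic inequality with an unbounded weight\<close>

lemma Suc_square_le_power: "(real (Suc j))\<^sup>2 \<le> 4 * 2 ^ j"
proof (induction j)
  case (Suc j)
  show ?case
  proof (cases "j \<ge> 2")
    case True
    then have "2 * real (Suc j) + 1 \<le> (real (Suc j))\<^sup>2"
    proof -
      have "3 * real (Suc j) \<le> real (Suc j) * real (Suc j)" using True by (intro mult_right_mono) auto
      then show ?thesis using True by (simp add: power2_eq_square)
    qed
    moreover have "(real (Suc (Suc j)))\<^sup>2 = (real (Suc j))\<^sup>2 + 2 * real (Suc j) + 1"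
      by (simp add: power2_eq_square algebra_simps)
    ultimately show ?thesis using Suc by simp
  next
    case False
    then have "j = 0 \<or> j = 1" by auto
    then show ?thesis by auto
  qed
qed auto

text \<open>The dichotomy \<open>W\<^sup>2 \<le> 2\<^sup>j\<close> versus \<open>W\<^sup>2 > 2\<^sup>j\<close> trades the logarithm of \<open>a\<close> either for
  the geometric factor of the \<open>j\<close>-th scale or for the logarithm of the weight.\<close>
lemma dyadic_log_le:
  fixes a W \<omega> :: real and N :: nat
  assumes "\<omega> > 0" "W \<ge> 1" "N \<ge> 1" and a: "4 / \<omega> * 2 ^ N \<le> a"
  obtains j where "2 * 2 ^ (N * Suc j) / \<omega> \<le> a / 2"
    and "W * a * max 0 (ln a) \<le> (\<bar>ln (4 / \<omega>)\<bar> + 2 * N) * (2 * 2 ^ j * a + 4 * (1 + ln W) * W * a)"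
proof -
  define P where "P j \<longleftrightarrow> 2 * 2 ^ (N * Suc j) / \<omega> \<le> a / 2" for j
  have apos: "a > 0"
    using a \<open>\<omega> > 0\<close> by (smt (verit) divide_pos_pos mult_pos_pos zero_less_power)
  have "P 0" using a by (simp add: P_def)
  moreover have "\<exists>n. \<not> P n"
  proof -
    obtain n where n: "a * \<omega> / 4 < 2 ^ n"
      using real_arch_pow[of 2 "a * \<omega> / 4"] by auto
    also have "(2::real) ^ n \<le> 2 ^ (N * Suc n)"
      using mult_le_mono1[OF \<open>N \<ge> 1\<close>, of "Suc n"] by (intro power_increasing) auto
    finally have "\<not> P n"
      using \<open>\<omega> > 0\<close> by (simp add: P_def field_simps)
    then show ?thesis ..
  qed
  \<comment> \<open>\<open>P j\<close> says that the mass term of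
    \<open>nn_integral_square_average_le\<close> at scale \<open>j\<close> is at most half of
    \<open>a\<close>. Its failure at the next scale bounds \<open>ln a\<close> linearly in
    \<open>j\<close>.\<close>
  ultimately obtain j where j: "P j" "\<not> P (Suc j)"
    by (metis nat_induct)
  define c where "c = \<bar>ln (4 / \<omega>)\<bar> + 2 * N"
  have c: "c \<ge> 0" by (simp add: c_def)
  have "a < 4 / \<omega> * 2 ^ (N * Suc (Suc j))"
    using j(2) \<open>\<omega> > 0\<close> by (simp add: P_def field_simps)
  then have "ln a < ln (4 / \<omega> * 2 ^ (N * Suc (Suc j)))"
    using apos \<open>\<omega> > 0\<close> by (subst ln_less_cancel_iff) auto
  also have "\<dots> = ln (4 / \<omega>) + real (N * Suc (Suc j)) * ln 2"
    using \<open>\<omega> > 0\<close> by (subst ln_mult_pos) (simp_all add: ln_realpow)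
  also have "\<dots> \<le> \<bar>ln (4 / \<omega>)\<bar> * real (Suc j) + real (N * Suc (Suc j)) * 1"
    using ln_2_less_1 mult_left_mono[of 1 "real (Suc j)" "\<bar>ln (4 / \<omega>)\<bar>"] abs_ge_self[of "ln (4 / \<omega>)"]
    by (intro add_mono mult_left_mono) linarith+
  also have "\<dots> \<le> c * real (Suc j)"
    by (simp add: c_def algebra_simps)
  finally have lna: "max 0 (ln a) \<le> c * real (Suc j)"
    using c by (simp add: zero_le_mult_iff)
  have "W * a * max 0 (ln a) \<le> W * a * (c * real (Suc j))"
    using lna \<open>W \<ge> 1\<close> apos by (intro mult_left_mono) auto
  also have "\<dots> \<le> c * (2 * 2 ^ j * a + 4 * (1 + ln W) * W * a)"
  proof (cases "W\<^sup>2 \<le> 2 ^ j")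
    case True
    have "(real (Suc j) * W)\<^sup>2 \<le> (4 * 2 ^ j) * 2 ^ j"
      unfolding power_mult_distrib using True Suc_square_le_power[of j] by (intro mult_mono) auto
    also have "\<dots> = (2 * 2 ^ j)\<^sup>2" by (simp add: power2_eq_square)
    finally have "real (Suc j) * W \<le> 2 * 2 ^ j"
      by (rule power2_le_imp_le) auto
    then have "c * a * (real (Suc j) * W) \<le> c * a * (2 * 2 ^ j)"
      using c apos by (intro mult_left_mono) auto
    moreover have "0 \<le> c * (4 * (1 + ln W) * W * a)"
      using c apos \<open>W \<ge> 1\<close> by auto
    ultimately show ?thesis by (simp add: algebra_simps)
  next
    case False
    then have "ln (2 ^ j) \<le> ln (W\<^sup>2)" by (subst ln_le_cancel_iff) (use \<open>W \<ge> 1\<close> in auto)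
    then have "real j * ln 2 \<le> 2 * ln W" using \<open>W \<ge> 1\<close> by (simp add: ln_realpow)
    moreover have "real j * (1 / 2) \<le> real j * ln 2"
      using ln2_ge_two_thirds by (intro mult_left_mono) auto
    ultimately have "real (Suc j) \<le> 4 * (1 + ln W)" by simp
    then have "c * (W * a) * real (Suc j) \<le> c * (W * a) * (4 * (1 + ln W))"
      using c apos \<open>W \<ge> 1\<close> by (intro mult_left_mono) auto
    moreover have "0 \<le> c * (2 * 2 ^ j * a)" using c apos by auto
    ultimately show ?thesis by (simp add: algebra_simps)
  qed
  finally show ?thesis using that[of j] j(1) by (simp add: P_def c_def)
qed

text \<open>A large value of \<open>h\<close> cannot be explained by the mass of \<open>h\<close>:
  at the scale found in \<open>dyadic_log_le\<close> the mass term of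
  \<open>nn_integral_square_average_le\<close> is at most half of \<open>(h x)\<^sup>2\<close>, so
  the oscillation \<open>E j x\<close> must carry the rest. The sum over the scales converges
  because the oscillation has order \<open>(t j)\<^sup>2\<close>, whereas the logarithm only costs
  the weight \<open>2 ^ j\<close>. \<open>W\<close> stands in front of the logarithm but not in
  front of the gradient; its price is the factor \<open>1 + ln W\<close> in the mass term.\<close>

lemma weighted_log_Sobolev:
  fixes h W :: "'a::euclidean_space \<Rightarrow> real" and Dh :: "'a \<Rightarrow> 'a"
  assumes S: "convex S" "compact S" and d: "\<And>x z. x \<in> S \<Longrightarrow> z \<in> S \<Longrightarrow> norm (z - x) \<le> d"
    and \<omega>: "\<omega> > 0" "\<omega> \<le> measure lborel S"
    and h: "\<And>x. x \<in> S \<Longrightarrow> (h has_derivative (\<lambda>v. Dh x \<bullet> v)) (at x)"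
    and Dh: "continuous_on S Dh"
    and [measurable]: "h \<in> borel_measurable borel" "Dh \<in> borel_measurable borel" "W \<in> borel_measurable borel"
    and W: "\<And>x. x \<in> S \<Longrightarrow> W x \<ge> 1"
    and norm_h: "(\<integral>\<^sup>+x\<in>S. ennreal ((h x)\<^sup>2) \<partial>lborel) \<le> 1"
  defines "C \<equiv> 8 * (\<bar>ln (4 / \<omega>)\<bar> + 2 * DIM('a)) + max 0 (ln (4 / \<omega> * 2 ^ DIM('a)))"
  shows "(\<integral>\<^sup>+x\<in>S. ennreal (W x * (h x)\<^sup>2 * max 0 (ln ((h x)\<^sup>2))) \<partial>lborel)
    \<le> ennreal C * (\<integral>\<^sup>+x\<in>S. ennreal ((1 + ln (W x)) * W x * (h x)\<^sup>2) \<partial>lborel)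
      + ennreal (C * d\<^sup>2 * 2 ^ DIM('a)) * (\<integral>\<^sup>+x\<in>S. ennreal ((norm (Dh x))\<^sup>2) \<partial>lborel)"
proof -
  let ?N = "DIM('a)"
  have Sb[measurable]: "S \<in> sets borel" using S by (simp add: borel_compact)
  define m where "m = measure lborel S"
  have m: "m > 0" "\<omega> \<le> m" using \<omega> by (auto simp: m_def)
  have em: "emeasure lborel S = ennreal m"
    unfolding m_def using emeasure_compact_finite[OF S(2)] by (intro emeasure_eq_ennreal_measure) auto
  define c where "c = \<bar>ln (4 / \<omega>)\<bar> + 2 * ?N"
  define H where "H = 4 / \<omega> * 2 ^ ?N"
  have c0: "c \<ge> 0" by (simp add: c_def)
  have C: "C = 8 * c + max 0 (ln H)" by (simp add: C_def c_def H_def)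
  have C0: "C \<ge> 0" using c0 by (simp add: C)
  define t :: "nat \<Rightarrow> real" where "t j = (1 / 2) ^ Suc j" for j :: nat
  have t: "0 < t j" "t j \<le> 1 / 2" for j
    by (auto simp: t_def power_le_one)
  define E where "E j x = (\<integral>\<^sup>+z\<in>S. ennreal ((h x - h (x + t j *\<^sub>R (z - x)))\<^sup>2) \<partial>lborel)" for j x
  have [measurable]: "E j \<in> borel_measurable borel" for j
    unfolding E_def by measurable
  let ?K = "\<integral>\<^sup>+x\<in>S. ennreal ((norm (Dh x))\<^sup>2) \<partial>lborel"
  have pw: "ennreal (W x * (h x)\<^sup>2 * max 0 (ln ((h x)\<^sup>2)))
      \<le> ennreal C * ennreal ((1 + ln (W x)) * W x * (h x)\<^sup>2)
        + ennreal (8 * c / m) * (\<Sum>j. ennreal (2 ^ j) * E j x)" if x: "x \<in> S" for x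
  \<comment> \<open>Below the threshold \<open>H\<close> the logarithm is bounded by a constant;
    above it a suitable scale exists.\<close>
  proof (cases "H \<le> (h x)\<^sup>2")
    case False
    have "max 0 (ln ((h x)\<^sup>2)) \<le> max 0 (ln H)"
    proof (cases "h x = 0")
      case hx: False
      with False have "ln ((h x)\<^sup>2) \<le> ln H" by (subst ln_le_cancel_iff) (use \<omega> H_def in auto)
      then show ?thesis by auto
    qed auto
    also have "\<dots> \<le> C" using c0 by (simp add: C)
    also have "\<dots> \<le> C * (1 + ln (W x))" using C0 W[OF x] by (simp add: mult_le_cancel_left1)
    finally have "W x * (h x)\<^sup>2 * max 0 (ln ((h x)\<^sup>2)) \<le> W x * (h x)\<^sup>2 * (C * (1 + ln (W x)))"
      using W[OF x] by (intro mult_left_mono) auto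
    then have "W x * (h x)\<^sup>2 * max 0 (ln ((h x)\<^sup>2)) \<le> C * ((1 + ln (W x)) * W x * (h x)\<^sup>2)"
      by (simp add: mult_ac)
    then have "ennreal (W x * (h x)\<^sup>2 * max 0 (ln ((h x)\<^sup>2))) \<le> ennreal C * ennreal ((1 + ln (W x)) * W x * (h x)\<^sup>2)"
      using W[OF x] C0 by (subst ennreal_mult[symmetric]) (auto intro!: ennreal_leI)
    then show ?thesis by (rule order_trans) simp
  next
    case True
    obtain j where j: "2 * 2 ^ (?N * Suc j) / \<omega> \<le> (h x)\<^sup>2 / 2"
      "W x * (h x)\<^sup>2 * max 0 (ln ((h x)\<^sup>2)) \<le> c * (2 * 2 ^ j * (h x)\<^sup>2 + 4 * (1 + ln (W x)) * W x * (h x)\<^sup>2)"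
      using dyadic_log_le[OF \<omega>(1) W[OF x] _ True[unfolded H_def]] unfolding c_def
      by (metis DIM_ge_Suc0 One_nat_def)
    have "ennreal ((h x)\<^sup>2) * ennreal m \<le> 2 * E j x + ennreal (2 * (1 / t j) ^ ?N) * (\<integral>\<^sup>+z\<in>S. ennreal ((h z)\<^sup>2) \<partial>lborel)"
      using nn_integral_square_average_le[OF S(1) Sb x t(1), of j h] t(2)[of j] em by (simp add: E_def)
    also have "\<dots> \<le> 2 * E j x + ennreal (2 * (1 / t j) ^ ?N) * 1"
      using norm_h by (intro add_left_mono mult_left_mono) auto
    also have "2 * (1 / t j) ^ ?N = 2 * 2 ^ (?N * Suc j)"
    proof -
      have "1 / t j = 2 ^ Suc j" by (simp add: t_def power_one_over field_simps)
      then show ?thesis by (simp only: power_mult[symmetric] mult.commute[of _ ?N])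
    qed
    also have "ennreal (2 * 2 ^ (?N * Suc j)) * 1 \<le> ennreal ((h x)\<^sup>2 * m / 2)"
    proof -
      have "2 * 2 ^ (?N * Suc j) \<le> (h x)\<^sup>2 / 2 * \<omega>" using j(1) \<omega>(1) by (simp add: field_simps)
      also have "\<dots> \<le> (h x)\<^sup>2 / 2 * m" using m by (intro mult_left_mono) auto
      finally show ?thesis by (auto intro!: ennreal_leI)
    qed
    finally have le: "ennreal ((h x)\<^sup>2) * ennreal m \<le> 2 * E j x + ennreal ((h x)\<^sup>2 * m / 2)"
      by (simp add: add_left_mono)
    \<comment> \<open>The mass term is half of the left-hand side and is absorbed. Cancellation
      requires finiteness, so an infinite oscillation is a separate, trivial case.\<close>
    have hE: "ennreal ((h x)\<^sup>2) \<le> ennreal (4 / m) * E j x"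
    proof (cases "E j x")
      case (real e)
      have "ennreal ((h x)\<^sup>2 * m) \<le> ennreal (2 * e + (h x)\<^sup>2 * m / 2)"
        using le real m by (simp add: ennreal_mult ennreal_plus)
      then have "(h x)\<^sup>2 \<le> 4 / m * e"
        using real m by (subst (asm) ennreal_le_iff) (auto simp: field_simps)
      then show ?thesis
        using real m by (simp add: ennreal_mult[symmetric] ennreal_leI)
    next
      case top
      then show ?thesis using m by (simp add: ennreal_mult_top)
    qed
    have "ennreal (W x * (h x)\<^sup>2 * max 0 (ln ((h x)\<^sup>2)))
        \<le> ennreal (C * ((1 + ln (W x)) * W x * (h x)\<^sup>2) + 2 * c * 2 ^ j * (h x)\<^sup>2)"
    proof (intro ennreal_leI order_trans[OF j(2)])
      have "4 * c * ((1 + ln (W x)) * W x * (h x)\<^sup>2) \<le> C * ((1 + ln (W x)) * W x * (h x)\<^sup>2)"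
        using W[OF x] c0 by (intro mult_right_mono) (auto simp: C)
      then show "c * (2 * 2 ^ j * (h x)\<^sup>2 + 4 * (1 + ln (W x)) * W x * (h x)\<^sup>2)
        \<le> C * ((1 + ln (W x)) * W x * (h x)\<^sup>2) + 2 * c * 2 ^ j * (h x)\<^sup>2"
        by (simp add: algebra_simps)
    qed
    also have "\<dots> = ennreal C * ennreal ((1 + ln (W x)) * W x * (h x)\<^sup>2) + ennreal (2 * c * 2 ^ j) * ennreal ((h x)\<^sup>2)"
      using W[OF x] C0 c0 by (simp add: ennreal_mult ennreal_plus)
    also have "ennreal (2 * c * 2 ^ j) * ennreal ((h x)\<^sup>2) \<le> ennreal (2 * c * 2 ^ j) * (ennreal (4 / m) * E j x)"
      by (intro mult_left_mono hE) auto
    also have "\<dots> = ennreal (8 * c / m) * (ennreal (2 ^ j) * E j x)"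
    proof -
      have "ennreal (2 * c * 2 ^ j) * ennreal (4 / m) = ennreal (8 * c / m) * ennreal (2 ^ j)"
        using c0 m by (subst (1 2) ennreal_mult[symmetric]) auto
      then show ?thesis by (simp only: mult.assoc[symmetric])
    qed
    also have "\<dots> \<le> ennreal (8 * c / m) * (\<Sum>j. ennreal (2 ^ j) * E j x)"
      using sum_le_suminf[of "\<lambda>j. ennreal (2 ^ j) * E j x" "{j}"] by (intro mult_left_mono) auto
    finally show ?thesis by (simp add: add_left_mono)
  qed
  have EK: "(\<integral>\<^sup>+x\<in>S. E j x \<partial>lborel) \<le> ennreal ((t j)\<^sup>2 * d\<^sup>2 * 2 ^ ?N) * ?K * ennreal m" for j
    using nn_integral_contraction_average_le[OF S(1) Sb d _ _ h Dh, of "t j"] t[of j] em by (simp add: E_def)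
  have "(\<integral>\<^sup>+x\<in>S. (\<Sum>j. ennreal (2 ^ j) * E j x) \<partial>lborel) = (\<integral>\<^sup>+x. (\<Sum>j. ennreal (2 ^ j) * (E j x * indicator S x)) \<partial>lborel)"
    by (intro nn_integral_cong) (auto split: split_indicator)
  also have "\<dots> = (\<Sum>j. ennreal (2 ^ j) * (\<integral>\<^sup>+x\<in>S. E j x \<partial>lborel))"
    by (subst nn_integral_suminf) (auto simp: nn_integral_cmult)
  \<comment> \<open>\<open>2 ^ j * (t j)\<^sup>2\<close> is at most \<open>(1 / 2) ^ Suc j\<close>:
    the quadratic gain in the scale beats the weight, and the geometric series has sum 1.\<close>
  also have "\<dots> \<le> (\<Sum>j. ennreal ((1 / 2) ^ Suc j) * (ennreal (d\<^sup>2 * 2 ^ ?N) * ?K * ennreal m))"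
  proof (intro suminf_le)
    fix j
    have "ennreal (2 ^ j) * (\<integral>\<^sup>+x\<in>S. E j x \<partial>lborel) \<le> ennreal (2 ^ j) * (ennreal ((t j)\<^sup>2 * d\<^sup>2 * 2 ^ ?N) * ?K * ennreal m)"
      by (intro mult_left_mono EK) auto
    also have "\<dots> = (ennreal (2 ^ j) * ennreal ((t j)\<^sup>2 * (d\<^sup>2 * 2 ^ ?N))) * (?K * ennreal m)"
      by (simp only: mult_ac)
    also have "\<dots> \<le> ennreal ((1 / 2) ^ Suc j * (d\<^sup>2 * 2 ^ ?N)) * (?K * ennreal m)"
    proof (intro mult_right_mono)
      have "2 ^ j * (t j)\<^sup>2 = ((2 * (1/2)) ^ j) * ((1 / 2) ^ Suc j) * (1 / 2)"
        unfolding power_mult_distrib by (simp add: t_def power2_eq_square)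
      also have "\<dots> \<le> (1 / 2) ^ Suc j" by simp
      finally have "2 ^ j * (t j)\<^sup>2 * (d\<^sup>2 * 2 ^ ?N) \<le> (1 / 2) ^ Suc j * (d\<^sup>2 * 2 ^ ?N)"
        by (intro mult_right_mono) auto
      then show "ennreal (2 ^ j) * ennreal ((t j)\<^sup>2 * (d\<^sup>2 * 2 ^ ?N)) \<le> ennreal ((1 / 2) ^ Suc j * (d\<^sup>2 * 2 ^ ?N))"
        by (subst ennreal_mult[symmetric]) (auto simp: mult.assoc intro: ennreal_leI)
    qed auto
    also have "\<dots> = ennreal ((1 / 2) ^ Suc j) * (ennreal (d\<^sup>2 * 2 ^ ?N) * ?K * ennreal m)"
      by (subst ennreal_mult) (auto simp: mult.assoc)
    finally show "ennreal (2 ^ j) * (\<integral>\<^sup>+x\<in>S. E j x \<partial>lborel) \<le> ennreal ((1 / 2) ^ Suc j) * (ennreal (d\<^sup>2 * 2 ^ ?N) * ?K * ennreal m)" .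
  qed auto
  also have "\<dots> = (\<Sum>j. ennreal ((1 / 2) ^ Suc j)) * (ennreal (d\<^sup>2 * 2 ^ ?N) * ?K * ennreal m)"
    by (rule ennreal_suminf_multc)
  also have "(\<Sum>j. ennreal ((1 / 2) ^ Suc j)) = 1"
    using sums_unique[OF power_half_series] by (subst suminf_ennreal2) (auto intro: sums_summable[OF power_half_series])
  finally have sumE: "(\<integral>\<^sup>+x\<in>S. (\<Sum>j. ennreal (2 ^ j) * E j x) \<partial>lborel) \<le> ennreal (d\<^sup>2 * 2 ^ ?N) * ?K * ennreal m"
    by simp
  have "(\<integral>\<^sup>+x\<in>S. ennreal (W x * (h x)\<^sup>2 * max 0 (ln ((h x)\<^sup>2))) \<partial>lborel)
      \<le> (\<integral>\<^sup>+x. ennreal C * (ennreal ((1 + ln (W x)) * W x * (h x)\<^sup>2) * indicator S x)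
        + ennreal (8 * c / m) * ((\<Sum>j. ennreal (2 ^ j) * E j x) * indicator S x) \<partial>lborel)"
    using pw by (intro nn_integral_mono) (auto split: split_indicator)
  also have "\<dots> = ennreal C * (\<integral>\<^sup>+x\<in>S. ennreal ((1 + ln (W x)) * W x * (h x)\<^sup>2) \<partial>lborel)
        + ennreal (8 * c / m) * (\<integral>\<^sup>+x\<in>S. (\<Sum>j. ennreal (2 ^ j) * E j x) \<partial>lborel)"
    by (subst nn_integral_add, simp, simp, subst (1 2) nn_integral_cmult, simp_all)
  also have "ennreal (8 * c / m) * (\<integral>\<^sup>+x\<in>S. (\<Sum>j. ennreal (2 ^ j) * E j x) \<partial>lborel)
      \<le> ennreal (C * d\<^sup>2 * 2 ^ ?N) * ?K"
  proof -
    have "ennreal (8 * c / m) * (\<integral>\<^sup>+x\<in>S. (\<Sum>j. ennreal (2 ^ j) * E j x) \<partial>lborel)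
        \<le> ennreal (8 * c / m) * (ennreal (d\<^sup>2 * 2 ^ ?N) * ?K * ennreal m)"
      by (intro mult_left_mono sumE) auto
    also have "\<dots> = (ennreal (8 * c / m) * ennreal m * ennreal (d\<^sup>2 * 2 ^ ?N)) * ?K"
      by (simp only: mult_ac)
    also have "ennreal (8 * c / m) * ennreal m * ennreal (d\<^sup>2 * 2 ^ ?N) = ennreal (8 * c * (d\<^sup>2 * 2 ^ ?N))"
      using m c0 by (simp add: ennreal_mult[symmetric])
    also have "ennreal (8 * c * (d\<^sup>2 * 2 ^ ?N)) * ?K \<le> ennreal (C * (d\<^sup>2 * 2 ^ ?N)) * ?K"
      by (intro mult_right_mono ennreal_leI) (auto simp: C)
    finally show ?thesis by (simp only: mult.assoc)
  qed
  finally show ?thesis by (simp add: add_left_mono)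
qed

section \<open>The weighted inequality for smooth functions\<close>

text \<open>The derivative at points of \<open>S\<close> is taken in the whole space, so on a closed
  ball \<open>u\<close> is differentiable across the boundary too. Measurability is global in order
  that products with indicators are measurable at once.\<close>

definition C1_on :: "'a::euclidean_space set \<Rightarrow> ('a \<Rightarrow> real) \<Rightarrow> ('a \<Rightarrow> 'a) \<Rightarrow> bool" where
  "C1_on S u Du \<longleftrightarrow> (\<forall>x\<in>S. (u has_derivative (\<lambda>v. Du x \<bullet> v)) (at x)) \<and> continuous_on S Du \<and>
    u \<in> borel_measurable borel \<and> Du \<in> borel_measurable borel"

lemma C1_onD:
  assumes "C1_on S u Du"
  shows "x \<in> S \<Longrightarrow> (u has_derivative (\<lambda>v. Du x \<bullet> v)) (at x)" "continuous_on S Du" "continuous_on S u"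
    "u \<in> borel_measurable borel" "Du \<in> borel_measurable borel"
  using assms unfolding C1_on_def
  by (auto intro!: continuous_at_imp_continuous_on has_derivative_continuous)

lemma C1_on_subset: "C1_on S u Du \<Longrightarrow> T \<subseteq> S \<Longrightarrow> C1_on T u Du"
  unfolding C1_on_def by (auto intro: continuous_on_subset)

text \<open>The integrand is the divergence of \<open>f x\<close>, so the integral is a flux through the sphere. Differentiating
  the dilations \<open>f (t x)\<close> at \<open>t = 1\<close> avoids the divergence theorem.\<close>
lemma dilation_integral_nonneg:
  fixes f :: "'a::euclidean_space \<Rightarrow> real" and Df :: "'a \<Rightarrow> 'a"
  assumes f: "C1_on (cball 0 R) f Df" and nonneg: "\<And>x. x \<in> cball 0 R \<Longrightarrow> f x \<ge> 0"
  shows "0 \<le> (LINT x:cball 0 R|lborel. DIM('a) * f x + Df x \<bullet> x)"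
proof -
  let ?S = "cball (0::'a) R" and ?N = "DIM('a)"
  note [measurable] = C1_onD(4,5)[OF f]
  have [measurable]: "?S \<in> sets borel" by simp
  note df = C1_onD(1)[OF f] and cDf = C1_onD(2)[OF f] and cf = C1_onD(3)[OF f]
  define t :: "nat \<Rightarrow> real" where "t n = 1 - 1 / (real n + 2)" for n
  have t: "0 < t n" "t n < 1" for n by (auto simp: t_def field_simps)
  have tlim: "t \<longlonglongrightarrow> 1"
    unfolding t_def by real_asymp
  have tS: "s *\<^sub>R x \<in> ?S" if "x \<in> ?S" "0 \<le> s" "s \<le> 1" for s :: real and x
    using that mult_mono[of s 1 "norm x" R] by auto
  \<comment> \<open>\<open>k' x 1\<close> is the divergence of the field \<open>f x\<close> at the
    point \<open>x\<close>; the power of \<open>s\<close> is the Jacobian of the dilation.\<close>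
  define k where "k x s = s ^ ?N * f (s *\<^sub>R x)" for x and s :: real
  define k' where "k' x s = ?N * s ^ (?N - 1) * f (s *\<^sub>R x) + s ^ ?N * (Df (s *\<^sub>R x) \<bullet> x)" for x and s :: real
  have dk: "(k x has_real_derivative k' x s) (at s)" if "x \<in> ?S" "0 \<le> s" "s \<le> 1" for x and s :: real
  proof -
    have "((\<lambda>s. s *\<^sub>R x) has_derivative (\<lambda>v. v *\<^sub>R x)) (at s)"
      by (auto intro!: derivative_eq_intros)
    from has_derivative_compose[OF this df[OF tS[OF that]]]
    have "((\<lambda>s. f (s *\<^sub>R x)) has_derivative (\<lambda>v. Df (s *\<^sub>R x) \<bullet> (v *\<^sub>R x))) (at s)" .
    then have "((\<lambda>s. f (s *\<^sub>R x)) has_real_derivative (Df (s *\<^sub>R x) \<bullet> x)) (at s)"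
      by (simp add: has_field_derivative_def mult.commute[of _ "Df (s *\<^sub>R x) \<bullet> x"])
    then show ?thesis unfolding k_def k'_def
      by (auto intro!: derivative_eq_intros)
  qed
  obtain B where B: "\<And>x. x \<in> ?S \<Longrightarrow> norm (f x) \<le> B"
    using compact_imp_bounded[OF compact_continuous_image[OF cf compact_cball]] by (metis bounded_iff imageI)
  obtain B' where B': "\<And>x. x \<in> ?S \<Longrightarrow> norm (Df x) \<le> B'"
    using compact_imp_bounded[OF compact_continuous_image[OF cDf compact_cball]] by (metis bounded_iff imageI)
  have k'_le: "\<bar>k' x s\<bar> \<le> ?N * B + B' * R" if x: "x \<in> ?S" and s: "0 \<le> s" "s \<le> 1" for x and s :: real
  proof -
    have "\<bar>Df (s *\<^sub>R x) \<bullet> x\<bar> \<le> B' * R"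
    proof -
      have "norm (Df (s *\<^sub>R x)) * norm x \<le> B' * R"
        using x B'[OF tS[OF x s]] order_trans[OF norm_ge_zero B'[OF tS[OF x s]]] by (intro mult_mono) auto
      then show ?thesis using Cauchy_Schwarz_ineq2[of "Df (s *\<^sub>R x)" x] by linarith
    qed
    moreover have "s ^ n \<le> 1" for n using s by (simp add: power_le_one)
    ultimately have "s ^ ?N * \<bar>Df (s *\<^sub>R x) \<bullet> x\<bar> \<le> 1 * (B' * R)"
      using s by (intro mult_mono) auto
    moreover have "s ^ (?N - 1) * \<bar>f (s *\<^sub>R x)\<bar> \<le> 1 * B"
      using \<open>\<And>n. s ^ n \<le> 1\<close> s B[OF tS[OF x s]] by (intro mult_mono) auto
    then have "?N * (s ^ (?N - 1) * \<bar>f (s *\<^sub>R x)\<bar>) \<le> ?N * B" by (intro mult_left_mono) auto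
    ultimately show ?thesis
      unfolding k'_def using s by (intro order_trans[OF abs_triangle_ineq] add_mono) (auto simp: abs_mult mult.assoc)
  qed
  define q where "q n x = (k x 1 - k x (t n)) / (1 - t n)" for n x
  have q_le: "\<bar>q n x\<bar> \<le> ?N * B + B' * R" if x: "x \<in> ?S" for n x
  proof -
    obtain z where "t n < z" "z < 1" "k x 1 - k x (t n) = (1 - t n) * k' x z"
      using MVT2[of "t n" 1 "k x" "k' x"] dk[OF x] t[of n] by (metis less_eq_real_def order_trans)
    then show ?thesis
      using t[of n] k'_le[OF x, of z] by (simp add: q_def)
  qed
  have q_lim: "(\<lambda>n. q n x) \<longlonglongrightarrow> ?N * f x + Df x \<bullet> x" if x: "x \<in> ?S" for x
  proof -
    have "((\<lambda>y. (k x y - k x 1) / (y - 1)) \<longlongrightarrow> k' x 1) (at 1)"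
      using dk[OF x, of 1] by (simp add: has_field_derivative_iff)
    moreover have "filterlim t (at 1) sequentially"
      using tlim t by (auto simp: filterlim_at intro!: always_eventually less_imp_neq)
    ultimately have "(\<lambda>n. (k x (t n) - k x 1) / (t n - 1)) \<longlonglongrightarrow> k' x 1"
      by (rule filterlim_compose)
    moreover have "(k x (t n) - k x 1) / (t n - 1) = q n x" for n
      using t[of n] by (simp add: q_def divide_simps) (simp add: algebra_simps)
    ultimately show ?thesis by (simp add: k'_def)
  qed
  have fin: "emeasure lborel ?S < \<infinity>" by (intro emeasure_compact_finite) auto
  have [measurable]: "q n \<in> borel_measurable borel" for n
    unfolding q_def k_def by measurable
  have lim: "(\<lambda>n. LINT x|lborel. indicator ?S x *\<^sub>R q n x) \<longlonglongrightarrow> (LINT x|lborel. indicator ?S x *\<^sub>R (?N * f x + Df x \<bullet> x))"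
  proof (rule integral_dominated_convergence[where w="\<lambda>x. indicator ?S x *\<^sub>R (?N * B + B' * R)"])
    show "integrable lborel (\<lambda>x. indicator ?S x *\<^sub>R (?N * B + B' * R))"
      using fin by auto
    show "AE x in lborel. (\<lambda>n. indicator ?S x *\<^sub>R q n x) \<longlonglongrightarrow> indicator ?S x *\<^sub>R (?N * f x + Df x \<bullet> x)"
      using q_lim by (intro AE_I2) (auto split: split_indicator)
    show "AE x in lborel. norm (indicator ?S x *\<^sub>R q n x) \<le> indicator ?S x *\<^sub>R (?N * B + B' * R)" for n
      using q_le by (intro AE_I2) (auto split: split_indicator)
  qed measurable
  \<comment> \<open>The substitution of \<open>t n *\<^sub>R x\<close> turns the subtracted term
    into the integral of \<open>f\<close> over a smaller concentric ball, which cannot exceed the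
    integral over \<open>?S\<close> because \<open>f\<close> is nonnegative there.\<close>
  have "0 \<le> (LINT x|lborel. indicator ?S x *\<^sub>R q n x)" for n
  proof -
    have i1: "integrable lborel (\<lambda>x. indicator ?S x * f x)"
      using borel_integrable_compact[OF compact_cball cf] by simp
    have i2: "integrable lborel (\<lambda>x. indicator ?S x * f (t n *\<^sub>R x))"
    proof -
      have "continuous_on ?S (\<lambda>x. f (t n *\<^sub>R x))"
        using t[of n] tS by (intro continuous_on_compose2[OF cf] continuous_intros) auto
      from borel_integrable_compact[OF compact_cball this] show ?thesis by simp
    qed
    have "ennreal (LINT x|lborel. indicator ?S x * f (t n *\<^sub>R x)) = (\<integral>\<^sup>+x. ennreal (indicator ?S x * f (t n *\<^sub>R x)) \<partial>lborel)"
      using i2 nonneg tS t[of n] by (subst nn_integral_eq_integral) (auto split: split_indicator)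
    also have "\<dots> \<le> (\<integral>\<^sup>+x. ennreal (indicator ?S (0 + t n *\<^sub>R x) * f (0 + t n *\<^sub>R x)) \<partial>lborel)"
      using tS t[of n] by (intro nn_integral_mono) (auto split: split_indicator)
    also have "\<dots> = ennreal ((1 / t n) ^ ?N) * (\<integral>\<^sup>+x. ennreal (indicator ?S x * f x) \<partial>lborel)"
      using t[of n] by (subst nn_integral_lborel_affine[where f="\<lambda>x. ennreal (indicator ?S x * f x)"]) auto
    also have "(\<integral>\<^sup>+x. ennreal (indicator ?S x * f x) \<partial>lborel) = ennreal (LINT x|lborel. indicator ?S x * f x)"
      using i1 nonneg by (subst nn_integral_eq_integral) (auto split: split_indicator)
    also have "ennreal ((1 / t n) ^ ?N) * ennreal (LINT x|lborel. indicator ?S x * f x)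
        = ennreal ((1 / t n) ^ ?N * (LINT x|lborel. indicator ?S x * f x))"
      using t[of n] nonneg by (subst ennreal_mult) (auto intro!: integral_nonneg_AE split: split_indicator)
    finally have "(LINT x|lborel. indicator ?S x * f (t n *\<^sub>R x)) \<le> (1 / t n) ^ ?N * (LINT x|lborel. indicator ?S x * f x)"
      using t[of n] nonneg by (subst (asm) ennreal_le_iff) (auto intro!: mult_nonneg_nonneg integral_nonneg_AE split: split_indicator)
    then have "t n ^ ?N * (LINT x|lborel. indicator ?S x * f (t n *\<^sub>R x)) \<le> (LINT x|lborel. indicator ?S x * f x)"
      using t[of n] by (simp add: field_simps power_divide)
    moreover have "(LINT x|lborel. indicator ?S x *\<^sub>R q n x) = ((LINT x|lborel. indicator ?S x * f x) - t n ^ ?N * (LINT x|lborel. indicator ?S x * f (t n *\<^sub>R x))) / (1 - t n)"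
    proof -
      have "(\<lambda>x. indicator ?S x *\<^sub>R q n x) = (\<lambda>x. (indicator ?S x * f x - t n ^ ?N * (indicator ?S x * f (t n *\<^sub>R x))) / (1 - t n))"
        by (auto simp: q_def k_def fun_eq_iff split: split_indicator)
      then show ?thesis using i1 i2 by simp
    qed
    ultimately show ?thesis using t[of n] by simp
  qed
  then show ?thesis
    unfolding set_lebesgue_integral_def by (intro LIMSEQ_le_const[OF lim]) auto
qed

text \<open>Unlike \<open>hyp_dist0\<close>, this radial function is smooth at the origin, and its gradient is the conformal
  factor times \<open>x\<close>.\<close>
definition hyp_log :: "'a::euclidean_space \<Rightarrow> real" where
  "hyp_log x = ln (4 / (1 - (norm x)\<^sup>2))"

text \<open>\<open>exp (hyp_log x)\<close> is twice the conformal factor, so the first term in the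
  exponent gives the hyperbolic volume density up to the factor \<open>2 ^ DIM('a)\<close>.\<close>

definition gauss_weight :: "real \<Rightarrow> 'a::euclidean_space \<Rightarrow> real" where
  "gauss_weight \<beta> x = exp (DIM('a) * hyp_log x - \<beta> * (hyp_log x)\<^sup>2)"

section \<open>Calculus of \<open>hyp_log\<close> and \<open>gauss_weight\<close>\<close>

lemma hyp_log_measurable[measurable]: "hyp_log \<in> borel_measurable borel"
  unfolding hyp_log_def[abs_def] by measurable

lemma gauss_weight_measurable[measurable]: "gauss_weight \<beta> \<in> borel_measurable borel"
  unfolding gauss_weight_def[abs_def] by measurable

lemma gauss_weight_pos: "gauss_weight \<beta> x > 0"
  by (simp add: gauss_weight_def)

lemma norm_square_less_1: "norm x < 1 \<Longrightarrow> 1 - (norm x)\<^sup>2 > 0" for x :: "'a::real_normed_vector"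
  by (simp add: abs_square_less_1)

lemma one_minus_norm_square_has_derivative:
  "((\<lambda>x. 1 - (norm x)\<^sup>2) has_derivative (\<lambda>v. - 2 * (x \<bullet> v))) (at x)" for x :: "'a::euclidean_space"
  unfolding power2_norm_eq_inner by (auto intro!: derivative_eq_intros simp: inner_commute)

lemma hyp_log_has_derivative:
  assumes "norm x < 1"
  shows "(hyp_log has_derivative (\<lambda>v. 2 / (1 - (norm x)\<^sup>2) * (x \<bullet> v))) (at x)"
proof -
  note q = norm_square_less_1[OF assms]
  have "((\<lambda>q. ln (4 / q)) has_field_derivative - 1 / q) (at q)" if "q > 0" for q :: real
    using that by (auto intro!: derivative_eq_intros simp: field_simps power2_eq_square)
  note this = this[OF q]
  from has_derivative_compose[OF one_minus_norm_square_has_derivative this[unfolded has_field_derivative_def]]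
  show ?thesis unfolding hyp_log_def[abs_def] by (simp add: field_simps)
qed

lemma continuous_on_hyp_log: "continuous_on (ball 0 1) hyp_log"
  using has_derivative_continuous[OF hyp_log_has_derivative] by (auto intro!: continuous_at_imp_continuous_on)

lemma gauss_weight_has_derivative:
  fixes x :: "'a::euclidean_space"
  assumes "norm x < 1"
  shows "(gauss_weight \<beta> has_derivative
    (\<lambda>v. gauss_weight \<beta> x * (DIM('a) - 2 * \<beta> * hyp_log x) * (2 / (1 - (norm x)\<^sup>2)) * (x \<bullet> v))) (at x)"
proof -
  have "((\<lambda>s. exp (DIM('a) * s - \<beta> * s\<^sup>2)) has_field_derivative
      (gauss_weight \<beta> x * (DIM('a) - 2 * \<beta> * hyp_log x))) (at (hyp_log x))"
    by (auto intro!: derivative_eq_intros simp: gauss_weight_def power2_eq_square algebra_simps)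
  from has_derivative_compose[OF hyp_log_has_derivative[OF assms] this[unfolded has_field_derivative_def]]
  show ?thesis unfolding gauss_weight_def[abs_def] by (simp add: mult_ac)
qed

lemma continuous_on_gauss_weight: "continuous_on (ball 0 1) (gauss_weight \<beta>)"
  using has_derivative_continuous[OF gauss_weight_has_derivative] by (auto intro!: continuous_at_imp_continuous_on)

text \<open>Since \<open>1 - (norm x)\<^sup>2\<close> equals \<open>4 * exp (- hyp_log x)\<close>,
  it decays faster than powers of \<open>hyp_log x\<close> grow. The constants 4 and 8 come from the
  quadratic Taylor bound of \<open>exp\<close>.\<close>

lemma hyp_log_bounds:
  assumes "norm x < 1"
  shows "hyp_log x > 0" "hyp_log x \<ge> ln 4" "(1 - (norm x)\<^sup>2) * hyp_log x \<le> 4" "(1 - (norm x)\<^sup>2) * (hyp_log x)\<^sup>2 \<le> 8"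
proof -
  note q = norm_square_less_1[OF assms]
  have q1: "1 - (norm x)\<^sup>2 \<le> 1" by simp
  show l4: "hyp_log x \<ge> ln 4"
    unfolding hyp_log_def using q q1 by (subst ln_le_cancel_iff) (auto simp: field_simps)
  show pos: "hyp_log x > 0" using l4 ln_gt_zero[of 4] by (smt (verit))
  have qe: "1 - (norm x)\<^sup>2 = 4 * exp (- hyp_log x)"
    unfolding hyp_log_def exp_minus using q by (subst exp_ln) (auto simp: field_simps)
  have e: "1 + hyp_log x + (hyp_log x)\<^sup>2 / 2 \<le> exp (hyp_log x)"
    using pos by (intro exp_lower_Taylor_quadratic) auto
  then have "hyp_log x \<le> exp (hyp_log x)" "(hyp_log x)\<^sup>2 \<le> 2 * exp (hyp_log x)"
    using pos by (auto, smt (verit) divide_nonneg_nonneg zero_le_power2)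
  then show "(1 - (norm x)\<^sup>2) * hyp_log x \<le> 4" "(1 - (norm x)\<^sup>2) * (hyp_log x)\<^sup>2 \<le> 8"
    unfolding qe by (simp_all add: exp_minus field_simps)
qed

lemma set_nn_integral_compact_eq:
  fixes f :: "'a::euclidean_space \<Rightarrow> real"
  assumes "compact S" "continuous_on S f" "\<And>x. x \<in> S \<Longrightarrow> f x \<ge> 0"
  shows "(\<integral>\<^sup>+x\<in>S. ennreal (f x) \<partial>lborel) = ennreal (LINT x:S|lborel. f x)"
proof -
  have "(\<integral>\<^sup>+x\<in>S. ennreal (f x) \<partial>lborel) = (\<integral>\<^sup>+x. ennreal (indicator S x *\<^sub>R f x) \<partial>lborel)"
    by (intro nn_integral_cong) (auto split: split_indicator)
  also have "\<dots> = ennreal (LINT x:S|lborel. f x)"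
    unfolding set_lebesgue_integral_def using assms
    by (intro nn_integral_eq_integral borel_integrable_compact) (auto split: split_indicator)
  finally show ?thesis .
qed

lemma set_integrable_compact:
  fixes f :: "'a::euclidean_space \<Rightarrow> real"
  assumes "compact S" "continuous_on S f"
  shows "set_integrable lborel S f"
  unfolding set_integrable_def using assms by (rule borel_integrable_compact)

lemma set_integral_nonneg:
  fixes f :: "'a::euclidean_space \<Rightarrow> real"
  assumes "\<And>x. x \<in> S \<Longrightarrow> f x \<ge> 0"
  shows "0 \<le> (LINT x:S|lborel. f x)"
  unfolding set_lebesgue_integral_def using assms by (intro integral_nonneg_AE) (auto split: split_indicator)

lemma weighted_AM_GM:
  fixes a b \<beta> :: real
  assumes "\<beta> > 0"
  shows "2 * a * b \<le> \<beta> * a\<^sup>2 + 1 / \<beta> * b\<^sup>2"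
proof -
  have "0 \<le> (\<beta> * a - b)\<^sup>2 / \<beta>" using assms by simp
  also have "\<dots> = \<beta> * a\<^sup>2 - 2 * a * b + 1 / \<beta> * b\<^sup>2"
    using assms by (simp add: power2_eq_square field_simps)
  finally show ?thesis by simp
qed

section \<open>The drift bound\<close>

text \<open>The pointwise budget of \<open>drift_bound\<close>, with \<open>q\<close>,
  \<open>\<sigma>\<close>, \<open>r\<close>, \<open>p\<close>, \<open>d\<close> for
  \<open>1 - (norm x)\<^sup>2\<close>, \<open>hyp_log x\<close>, \<open>norm x\<close>,
  \<open>Du x \<bullet> x\<close>, \<open>norm (Du x)\<close>. The drift contributes
  \<open>2 * \<beta> * \<sigma>\<^sup>2 * r\<^sup>2\<close> with a minus sign. One half of it
  absorbs the cross term by AM-GM; the other half pays for the quadratic term on the left and for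
  the linear growth \<open>N * \<sigma>\<close>. Replacing \<open>r\<^sup>2\<close> by 1 costs only
  \<open>8 * \<beta>\<close>, because \<open>q * \<sigma>\<^sup>2\<close> is at most 8.\<close>

lemma drift_pointwise:
  fixes \<beta> q \<sigma> r u p d N :: real
  assumes \<beta>: "\<beta> > 0" and N: "N \<ge> 1" and q: "0 < q" and r: "r\<^sup>2 = 1 - q" "r \<ge> 0"
    and \<sigma>: "\<sigma> \<ge> 0" "q * \<sigma> \<le> 4" "q * \<sigma>\<^sup>2 \<le> 8" and p: "\<bar>p\<bar> \<le> r * d"
  shows "\<beta> / 2 * (\<sigma>\<^sup>2 * u\<^sup>2) + (N * (u\<^sup>2 * (\<sigma> * (q / 2))) + 2 * u * (\<sigma> * (q / 2)) * p
      + u\<^sup>2 * (1 - \<sigma> + N * \<sigma> - 2 * \<beta> * \<sigma>\<^sup>2) * r\<^sup>2)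
    \<le> 1 / \<beta> * ((q / 2)\<^sup>2 * d\<^sup>2) + (2 * N + 1 + N\<^sup>2 / (2 * \<beta>) + 8 * \<beta>) * u\<^sup>2"
proof -
  have "2 * u * (\<sigma> * (q / 2)) * p \<le> \<bar>2 * u * (\<sigma> * (q / 2)) * p\<bar>"
    by (rule abs_ge_self)
  also have "\<dots> = 2 * \<bar>u\<bar> * (\<sigma> * (q / 2)) * \<bar>p\<bar>"
    using q \<sigma>(1) by (simp add: abs_mult)
  also have "\<dots> \<le> 2 * \<bar>u\<bar> * (\<sigma> * (q / 2)) * (r * d)"
    using q \<sigma>(1) by (intro mult_left_mono[OF p]) auto
  also have "\<dots> = 2 * (\<bar>u\<bar> * \<sigma> * r) * ((q / 2) * d)"
    by (simp only: mult_ac)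
  also have "\<dots> \<le> \<beta> * (\<bar>u\<bar> * \<sigma> * r)\<^sup>2 + 1 / \<beta> * ((q / 2) * d)\<^sup>2"
    by (rule weighted_AM_GM[OF \<beta>])
  also have "\<dots> = \<beta> * \<sigma>\<^sup>2 * r\<^sup>2 * u\<^sup>2 + 1 / \<beta> * ((q / 2)\<^sup>2 * d\<^sup>2)"
    unfolding power_mult_distrib power2_abs by (simp only: mult_ac)
  finally have 1: "2 * u * (\<sigma> * (q / 2)) * p \<le> \<beta> * \<sigma>\<^sup>2 * r\<^sup>2 * u\<^sup>2 + 1 / \<beta> * ((q / 2)\<^sup>2 * d\<^sup>2)" .
  have r1: "r\<^sup>2 \<le> 1" using q r by simp
  have "N * (\<sigma> * (q / 2)) \<le> 2 * N"
    using mult_left_mono[OF \<sigma>(2), of N] N by (simp only: mult_ac) simp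
  moreover have "(1 - \<sigma> + N * \<sigma>) * r\<^sup>2 \<le> 1 - \<sigma> + N * \<sigma>"
    using mult_right_mono[OF N \<sigma>(1)] by (intro mult_left_le r1) simp
  moreover have "N * \<sigma> \<le> \<beta> * \<sigma>\<^sup>2 / 2 + N\<^sup>2 / (2 * \<beta>)"
  proof -
    have "2 * (N * \<sigma>) \<le> 2 * (\<beta> * \<sigma>\<^sup>2 / 2 + N\<^sup>2 / (2 * \<beta>))"
      using weighted_AM_GM[OF \<beta>, of \<sigma> N] \<beta> by (simp add: distrib_left mult.commute[of N])
    then show ?thesis by simp
  qed
  moreover have "\<beta> * \<sigma>\<^sup>2 * r\<^sup>2 = \<beta> * \<sigma>\<^sup>2 - \<beta> * (q * \<sigma>\<^sup>2)"
    unfolding r(1) by (simp add: algebra_simps)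
  moreover have "\<beta> * (q * \<sigma>\<^sup>2) \<le> 8 * \<beta>"
    using mult_left_mono[OF \<sigma>(3), of \<beta>] \<beta> by simp
  \<comment> \<open>With the products generalised to variables the remaining budget is linear;
    \<open>bs\<close> stands for \<open>\<beta> * \<sigma>\<^sup>2\<close> and \<open>bz\<close> for
    \<open>\<beta> * (q * \<sigma>\<^sup>2)\<close>.\<close>
  moreover have "bs / 2 + A + B - E \<le> 2 * N + 1 + Y + 8 * \<beta>"
    if "A \<le> 2 * N" "B \<le> 1 - \<sigma> + X" "X \<le> bs / 2 + Y" "E = bs - bz" "bz \<le> 8 * \<beta>"
    for A B E X Y bs bz
    using that \<sigma>(1) by linarith
  ultimately have "\<beta> * \<sigma>\<^sup>2 / 2 + N * (\<sigma> * (q / 2)) + (1 - \<sigma> + N * \<sigma>) * r\<^sup>2 - \<beta> * \<sigma>\<^sup>2 * r\<^sup>2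
      \<le> 2 * N + 1 + N\<^sup>2 / (2 * \<beta>) + 8 * \<beta>"
    by blast
  from mult_left_mono[OF this zero_le_power2[of u]]
  have 2: "u\<^sup>2 * (\<beta> * \<sigma>\<^sup>2 / 2 + N * (\<sigma> * (q / 2)) + (1 - \<sigma> + N * \<sigma>) * r\<^sup>2 - \<beta> * \<sigma>\<^sup>2 * r\<^sup>2)
      \<le> u\<^sup>2 * (2 * N + 1 + N\<^sup>2 / (2 * \<beta>) + 8 * \<beta>)" .
  have 3: "\<beta> / 2 * (s * U) + (N * (U * (\<sigma> * (q / 2))) + T + U * (1 - \<sigma> + N * \<sigma> - 2 * \<beta> * s) * t)
    = U * (\<beta> * s / 2 + N * (\<sigma> * (q / 2)) + (1 - \<sigma> + N * \<sigma>) * t - \<beta> * s * t) + (T - \<beta> * s * t * U)"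
    for s U T t
    by (simp add: algebra_simps)
  show ?thesis
    unfolding 3 using 1 2 by (simp only: mult.commute[of _ "u\<^sup>2"])
qed

text \<open>The radial field is \<open>(u x)\<^sup>2 * P x\<close> times \<open>x\<close>. In
  \<open>P\<close> the factor \<open>(1 - (norm x)\<^sup>2) / 2\<close> cancels the conformal factor
  in the gradients of \<open>hyp_log\<close> and \<open>gauss_weight\<close>, and the factor
  \<open>hyp_log x\<close> raises the linear drift to a square. As \<open>P\<close> is nonnegative,
  \<open>dilation_integral_nonneg\<close> disposes of the boundary without any condition on the
  values of \<open>u\<close> there.\<close>

lemma drift_bound:
  fixes u :: "'a::euclidean_space \<Rightarrow> real"
  assumes "\<beta> > 0" "R < 1" and u: "C1_on (cball 0 R) u Du"
  shows "(LINT x:cball 0 R|lborel. (hyp_log x)\<^sup>2 * (u x)\<^sup>2 * gauss_weight \<beta> x)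
    \<le> 2 / \<beta>\<^sup>2 * (LINT x:cball 0 R|lborel. ((1 - (norm x)\<^sup>2) / 2)\<^sup>2 * (norm (Du x))\<^sup>2 * gauss_weight \<beta> x)
      + 2 / \<beta> * (2 * real DIM('a) + 1 + (real DIM('a))\<^sup>2 / (2 * \<beta>) + 8 * \<beta>) * (LINT x:cball 0 R|lborel. (u x)\<^sup>2 * gauss_weight \<beta> x)"
proof -
  let ?S = "cball (0::'a) R" and ?N = "real DIM('a)"
  define q where "q x = 1 - (norm x)\<^sup>2" for x :: 'a
  define P where "P x = hyp_log x * (q x / 2) * gauss_weight \<beta> x" for x :: 'a
  define Q where "Q x = (u x)\<^sup>2 * gauss_weight \<beta> x * (1 - hyp_log x + ?N * hyp_log x - 2 * \<beta> * (hyp_log x)\<^sup>2)" for x :: 'a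
  define Df where "Df x = (2 * u x * P x) *\<^sub>R Du x + Q x *\<^sub>R x" for x
  have S1: "x \<in> ?S \<Longrightarrow> norm x < 1" for x using \<open>R < 1\<close> by simp
  have Ssub: "?S \<subseteq> ball 0 1" using \<open>R < 1\<close> by auto
  note du = C1_onD(1)[OF u]
  note [measurable] = C1_onD(4,5)[OF u]
  note [continuous_intros] = continuous_on_subset[OF continuous_on_hyp_log Ssub]
    continuous_on_subset[OF continuous_on_gauss_weight Ssub] C1_onD(2,3)[OF u]
  have "C1_on ?S (\<lambda>x. (u x)\<^sup>2 * P x) Df"
    unfolding C1_on_def
  proof (intro conjI ballI)
    fix x assume x: "x \<in> ?S"
    have q: "q x > 0" using norm_square_less_1[OF S1[OF x]] by (simp add: q_def)
    have P: "P = (\<lambda>x. hyp_log x * (q x * (1 / 2)) * gauss_weight \<beta> x)" by (simp add: P_def fun_eq_iff)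
    note d = has_derivative_mult[OF has_derivative_mult[OF hyp_log_has_derivative[OF S1[OF x], folded q_def]
      has_derivative_mult_left[OF one_minus_norm_square_has_derivative[of x, folded q_def], of "1 / 2"]]
      gauss_weight_has_derivative[OF S1[OF x], of \<beta>, folded q_def]]
    have "(P has_derivative (\<lambda>v. gauss_weight \<beta> x * (1 - hyp_log x + ?N * hyp_log x - 2 * \<beta> * (hyp_log x)\<^sup>2) * (x \<bullet> v))) (at x)"
      unfolding P using q
      by (intro has_derivative_eq_rhs[OF d]) (simp add: fun_eq_iff field_simps power2_eq_square)
    then show "((\<lambda>x. (u x)\<^sup>2 * P x) has_derivative (\<lambda>v. Df x \<bullet> v)) (at x)"
      using du[OF x]
      by (auto intro!: derivative_eq_intros simp: Df_def Q_def fun_eq_iff inner_simps power2_eq_square algebra_simps)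
  next
    show "continuous_on ?S Df"
      unfolding Df_def P_def q_def Q_def by (intro continuous_intros) auto
  next
    show "(\<lambda>x. (u x)\<^sup>2 * P x) \<in> borel_measurable borel" "Df \<in> borel_measurable borel"
      unfolding Df_def P_def q_def Q_def by measurable
  qed
  moreover have "0 \<le> (u x)\<^sup>2 * P x" if "x \<in> ?S" for x
    using hyp_log_bounds(1)[OF S1[OF that]] norm_square_less_1[OF S1[OF that]] gauss_weight_pos[of \<beta> x]
    by (simp add: P_def q_def)
  ultimately have 0: "0 \<le> (LINT x:?S|lborel. ?N * ((u x)\<^sup>2 * P x) + Df x \<bullet> x)"
    by (rule dilation_integral_nonneg)
  let ?K = "2 * ?N + 1 + ?N\<^sup>2 / (2 * \<beta>) + 8 * \<beta>"
  let ?d = "\<lambda>x. (q x / 2)\<^sup>2 * (norm (Du x))\<^sup>2 * gauss_weight \<beta> x"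
  have pw: "\<beta> / 2 * ((hyp_log x)\<^sup>2 * (u x)\<^sup>2 * gauss_weight \<beta> x) + (?N * ((u x)\<^sup>2 * P x) + Df x \<bullet> x)
      \<le> 1 / \<beta> * ?d x + ?K * ((u x)\<^sup>2 * gauss_weight \<beta> x)" if x: "x \<in> ?S" for x
  proof -
    have "\<bar>Du x \<bullet> x\<bar> \<le> norm x * norm (Du x)"
      using Cauchy_Schwarz_ineq2[of "Du x" x] by (simp add: mult.commute)
    then have "\<beta> / 2 * ((hyp_log x)\<^sup>2 * (u x)\<^sup>2) + (?N * ((u x)\<^sup>2 * (hyp_log x * (q x / 2))) + 2 * u x * (hyp_log x * (q x / 2)) * (Du x \<bullet> x)
        + (u x)\<^sup>2 * (1 - hyp_log x + ?N * hyp_log x - 2 * \<beta> * (hyp_log x)\<^sup>2) * (norm x)\<^sup>2)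
      \<le> 1 / \<beta> * ((q x / 2)\<^sup>2 * (norm (Du x))\<^sup>2) + ?K * (u x)\<^sup>2"
      using hyp_log_bounds[OF S1[OF x]] norm_square_less_1[OF S1[OF x]] \<open>\<beta> > 0\<close> DIM_positive[where 'a='a]
      by (intro drift_pointwise) (auto simp: q_def)
    from mult_right_mono[OF this, of "gauss_weight \<beta> x"] gauss_weight_pos[of \<beta> x] show ?thesis
      by (simp add: P_def Df_def Q_def inner_simps power2_norm_eq_inner algebra_simps)
  qed
  have i: "set_integrable lborel ?S (\<lambda>x. (hyp_log x)\<^sup>2 * (u x)\<^sup>2 * gauss_weight \<beta> x)"
    "set_integrable lborel ?S ?d" "set_integrable lborel ?S (\<lambda>x. (u x)\<^sup>2 * gauss_weight \<beta> x)"
    "set_integrable lborel ?S (\<lambda>x. ?N * ((u x)\<^sup>2 * P x) + Df x \<bullet> x)"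
    unfolding Df_def P_def q_def Q_def by (intro set_integrable_compact compact_cball continuous_intros; simp)+
  define g where "g x = ?N * ((u x)\<^sup>2 * P x) + Df x \<bullet> x" for x
  note pw = pw[folded g_def] and i = i[folded g_def] and 0 = 0[folded g_def]
  have "(LINT x:?S|lborel. \<beta> / 2 * ((hyp_log x)\<^sup>2 * (u x)\<^sup>2 * gauss_weight \<beta> x) + g x)
      \<le> (LINT x:?S|lborel. 1 / \<beta> * ?d x + ?K * ((u x)\<^sup>2 * gauss_weight \<beta> x))"
    using i by (intro set_integral_mono pw set_integral_add set_integrable_mult_right) auto
  then have "\<beta> / 2 * (LINT x:?S|lborel. (hyp_log x)\<^sup>2 * (u x)\<^sup>2 * gauss_weight \<beta> x) + (LINT x:?S|lborel. g x)
      \<le> 1 / \<beta> * (LINT x:?S|lborel. ?d x) + ?K * (LINT x:?S|lborel. (u x)\<^sup>2 * gauss_weight \<beta> x)"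
    using i by (subst (asm) (1 2) set_integral_add) auto
  moreover have "a \<le> 2 / \<beta>\<^sup>2 * b + 2 / \<beta> * K * c" if "\<beta> / 2 * a + G \<le> 1 / \<beta> * b + K * c" "0 \<le> G" for a b c G K :: real
  proof -
    have "\<beta> / 2 * a \<le> 1 / \<beta> * b + K * c" using that by linarith
    then have "2 / \<beta> * (\<beta> / 2 * a) \<le> 2 / \<beta> * (1 / \<beta> * b + K * c)"
      using \<open>\<beta> > 0\<close> by (intro mult_left_mono) simp_all
    then show ?thesis
      using \<open>\<beta> > 0\<close> by (simp only: distrib_left) (simp add: power2_eq_square)
  qed
  ultimately show ?thesis using 0 unfolding q_def by blast
qed

section \<open>The weighted Poincare inequality\<close>

definition wmass :: "real \<Rightarrow> real \<Rightarrow> ('a::euclidean_space \<Rightarrow> real) \<Rightarrow> real" where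
  "wmass \<beta> R u = (LINT x:cball 0 R|lborel. (u x)\<^sup>2 * gauss_weight \<beta> x)"

text \<open>The first two factors of the integrand are the squared Riemannian norm of the hyperbolic
  gradient, see \<open>hyp_norm_hyp_grad\<close>.\<close>

definition wenergy :: "real \<Rightarrow> real \<Rightarrow> ('a::euclidean_space \<Rightarrow> 'a) \<Rightarrow> real" where
  "wenergy \<beta> R Du = (LINT x:cball 0 R|lborel. ((1 - (norm x)\<^sup>2) / 2)\<^sup>2 * (norm (Du x))\<^sup>2 * gauss_weight \<beta> x)"

definition ball_average :: "real \<Rightarrow> ('a::euclidean_space \<Rightarrow> real) \<Rightarrow> real" where
  "ball_average R u = (LINT x:cball 0 R|lborel. u x) / measure lborel (cball (0::'a) R)"

text \<open>The coefficient of the mass in \<open>drift_bound\<close>.\<close>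

definition drift_const :: "real \<Rightarrow> 'a::euclidean_space itself \<Rightarrow> real" where
  "drift_const \<beta> _ = 2 / \<beta> * (2 * real DIM('a) + 1 + (real DIM('a))\<^sup>2 / (2 * \<beta>) + 8 * \<beta>)"

lemma wmass_nonneg: "0 \<le> wmass \<beta> R u" and wenergy_nonneg: "0 \<le> wenergy \<beta> R Du"
  unfolding wmass_def wenergy_def by (auto intro!: set_integral_nonneg mult_nonneg_nonneg simp: less_imp_le[OF gauss_weight_pos])

lemma gauss_weight_le:
  fixes x :: "'a::euclidean_space"
  assumes "\<beta> > 0" shows "gauss_weight \<beta> x \<le> exp ((real DIM('a))\<^sup>2 / (4 * \<beta>))"
proof -
  have "2 * (DIM('a) / 2) * hyp_log x \<le> 1 / \<beta> * (DIM('a) / 2)\<^sup>2 + 1 / (1 / \<beta>) * (hyp_log x)\<^sup>2"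
    using assms by (intro weighted_AM_GM) auto
  then show ?thesis unfolding gauss_weight_def by (simp add: power2_eq_square mult_ac)
qed

lemma wenergy_mono:
  fixes Du :: "'a::euclidean_space \<Rightarrow> 'a"
  assumes "continuous_on (cball 0 R) Du" "r \<le> R" "R < 1"
  shows "wenergy \<beta> r Du \<le> wenergy \<beta> R Du"
proof -
  let ?f = "\<lambda>x. ((1 - (norm x)\<^sup>2) / 2)\<^sup>2 * (norm (Du x))\<^sup>2 * gauss_weight \<beta> x"
  have Ssub: "cball 0 R \<subseteq> ball (0::'a) 1" using assms by auto
  have "continuous_on (cball 0 R) ?f"
    by (intro continuous_intros assms continuous_on_subset[OF continuous_on_gauss_weight Ssub]) auto
  then have "continuous_on (cball 0 R) ?f"
    and "continuous_on (cball 0 r) ?f"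
    using assms(2) by (auto elim: continuous_on_subset)
  then have "integrable lborel (\<lambda>x. indicator (cball 0 R) x *\<^sub>R ?f x)"
    "integrable lborel (\<lambda>x. indicator (cball 0 r) x *\<^sub>R ?f x)"
    using borel_integrable_compact[OF compact_cball] by blast+
  then show ?thesis
    unfolding wenergy_def set_lebesgue_integral_def using assms(2)
    by (intro integral_mono) (auto split: split_indicator intro!: mult_nonneg_nonneg simp: less_imp_le[OF gauss_weight_pos])
qed

lemma ball_average_diff_Poincare:
  fixes u :: "'a::euclidean_space \<Rightarrow> real"
  assumes "0 < R" "R < 1" and u: "C1_on (cball 0 R) u Du"
  shows "(LINT x:cball 0 R|lborel. (u x - ball_average R u)\<^sup>2)
    \<le> 4 * 2 ^ DIM('a) * (LINT x:cball 0 R|lborel. (norm (Du x))\<^sup>2)"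
proof -
  have "norm (z - x) \<le> 2" if "x \<in> cball 0 R" "z \<in> cball 0 R" for x z :: 'a
    using norm_triangle_ineq4[of z x] that assms by auto
  moreover have "measure lborel (cball (0::'a) R) > 0"
    using assms by (simp add: content_cball)
  ultimately have "(\<integral>\<^sup>+x\<in>cball 0 R. ennreal ((u x - ball_average R u)\<^sup>2) \<partial>lborel)
      \<le> ennreal (2\<^sup>2 * 2 ^ DIM('a)) * (\<integral>\<^sup>+x\<in>cball 0 R. ennreal ((norm (Du x))\<^sup>2) \<partial>lborel)"
    unfolding ball_average_def using C1_onD[OF u] by (intro Poincare_convex) auto
  then show ?thesis
    using C1_onD[OF u]
    by (subst (asm) (1 2) set_nn_integral_compact_eq)
       (auto intro!: continuous_intros simp: ennreal_mult[symmetric] set_integral_nonneg ennreal_le_iff)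
qed

text \<open>Far out, \<open>(hyp_log x)\<^sup>2\<close> exceeds twice the drift constant, so the
  mass there is at most half of the total mass plus a multiple of the energy, and that half is
  absorbed. On the remaining ball of radius \<open>R0\<close> the weights are bounded from above and
  below, and the Euclidean inequality applies once the average over this ball is subtracted.
  Centring at the average over a ball independent of \<open>R\<close> keeps the centre meaningful
  when \<open>R\<close> tends to 1.\<close>

lemma weighted_Poincare:
  assumes "\<beta> > 0"
  shows "\<exists>R0 C. 1 / 2 \<le> R0 \<and> R0 < 1 \<and> 1 \<le> C \<and> (\<forall>R (u :: 'a::euclidean_space \<Rightarrow> real) Du.
    R0 \<le> R \<and> R < 1 \<and> C1_on (cball 0 R) u Du \<longrightarrow> wmass \<beta> R (\<lambda>x. u x - ball_average R0 u) \<le> C * wenergy \<beta> R Du)"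
proof -
  define B where "B = drift_const \<beta> TYPE('a)"
  have B: "B > 0"
    unfolding B_def drift_const_def using assms by (intro mult_pos_pos add_pos_pos) auto
  \<comment> \<open>Where \<open>1 - (norm x)\<^sup>2\<close> is at most
    \<open>4 * exp (- (2 * B + 1))\<close>, \<open>hyp_log x\<close> is at least
    \<open>2 * B + 1\<close> and its square at least \<open>2 * B\<close>. The cap 3/4 ensures that
    \<open>R0\<close> is at least 1/2, as \<open>defective_log_Sobolev\<close> demands of its
    radii.\<close>
  define q0 where "q0 = min (3 / 4) (4 * exp (- (2 * B + 1)))"
  have q0: "0 < q0" "q0 \<le> 3 / 4" by (auto simp: q0_def)
  define R0 where "R0 = sqrt (1 - q0)"
  have R0: "1 / 2 \<le> R0" "R0 < 1" "R0\<^sup>2 = 1 - q0"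
    using q0 real_le_rsqrt[of "1 / 2" "1 - q0"] by (auto simp: R0_def power2_eq_square)
  \<comment> \<open>A lower bound for the weight of \<open>wenergy\<close> on the ball of radius
    \<open>R0\<close>; the factor \<open>exp (DIM('a) * hyp_log x)\<close> is estimated by
    1.\<close>
  define m0 where "m0 = (q0 / 2)\<^sup>2 * exp (- \<beta> * (ln (4 / q0))\<^sup>2)"
  have m0: "m0 > 0" using q0 by (simp add: m0_def)
  define Fm where "Fm = exp ((real DIM('a))\<^sup>2 / (4 * \<beta>))"
  have Fm: "gauss_weight \<beta> x \<le> Fm" for x :: 'a unfolding Fm_def by (rule gauss_weight_le[OF assms])
  have Fm0: "Fm > 0" by (simp add: Fm_def)
  define C where "C = 2 / \<beta>\<^sup>2 / B + 2 * Fm * (4 * 2 ^ DIM('a) / m0) + 1"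
  have "wmass \<beta> R (\<lambda>x. u x - ball_average R0 u) \<le> C * wenergy \<beta> R Du"
    if R: "R0 \<le> R" "R < 1" and u: "C1_on (cball 0 R) u Du" for R and u :: "'a \<Rightarrow> real" and Du
  proof -
    let ?S = "cball (0::'a) R" and ?T = "cball (0::'a) R0"
    define v where "v x = u x - ball_average R0 u" for x
    have v: "C1_on ?S v Du"
      using u unfolding C1_on_def v_def by (auto intro!: derivative_eq_intros)
    have u0: "C1_on ?T u Du" using R by (intro C1_on_subset[OF u]) auto
    have Ssub: "?S \<subseteq> ball 0 1" using R by auto
    note [continuous_intros] = continuous_on_subset[OF continuous_on_hyp_log Ssub]
      continuous_on_subset[OF continuous_on_gauss_weight Ssub] C1_onD(2,3)[OF v]
    note gpos = less_imp_le[OF gauss_weight_pos]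
    define Y where "Y = (LINT x:?S|lborel. (hyp_log x)\<^sup>2 * (v x)\<^sup>2 * gauss_weight \<beta> x)"
    define Z where "Z = (LINT x:?T|lborel. (v x)\<^sup>2)"
    define X where "X = wmass \<beta> R v"
    define E where "E = wenergy \<beta> R Du"
    have E0: "E \<ge> 0" by (simp add: E_def wenergy_nonneg)
    have Y: "Y \<le> 2 / \<beta>\<^sup>2 * E + B * X"
      using drift_bound[OF assms R(2) v] by (simp add: Y_def X_def E_def B_def wmass_def wenergy_def drift_const_def)
    have pw: "(v x)\<^sup>2 * gauss_weight \<beta> x \<le> 1 / (2 * B) * ((hyp_log x)\<^sup>2 * (v x)\<^sup>2 * gauss_weight \<beta> x) + indicator ?T x * (Fm * (v x)\<^sup>2)"
      if x: "x \<in> ?S" for x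
    proof (cases "x \<in> ?T")
      case True
      have "(v x)\<^sup>2 * gauss_weight \<beta> x \<le> (v x)\<^sup>2 * Fm" by (intro mult_left_mono Fm) auto
      moreover have "0 \<le> 1 / (2 * B) * ((hyp_log x)\<^sup>2 * (v x)\<^sup>2 * gauss_weight \<beta> x)"
        using B gpos by (intro mult_nonneg_nonneg) auto
      ultimately show ?thesis using True by (simp add: mult.commute)
    next
      case False
      have nx: "norm x < 1" using x R by auto
      have "R0\<^sup>2 \<le> (norm x)\<^sup>2" using False R0 by (intro power_mono) auto
      then have "1 - (norm x)\<^sup>2 \<le> 4 * exp (- (2 * B + 1))" using R0(3) by (simp add: q0_def)
      then have "exp (2 * B + 1) * (1 - (norm x)\<^sup>2) \<le> exp (2 * B + 1) * (4 * exp (- (2 * B + 1)))"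
        by (intro mult_left_mono) auto
      also have "\<dots> = 4" unfolding exp_minus by simp
      finally have "exp (2 * B + 1) \<le> 4 / (1 - (norm x)\<^sup>2)"
        using norm_square_less_1[OF nx] by (simp only: pos_le_divide_eq)
      then have "2 * B + 1 \<le> hyp_log x"
        unfolding hyp_log_def using norm_square_less_1[OF nx] by (subst ln_ge_iff) auto
      then have "(2 * B + 1)\<^sup>2 \<le> (hyp_log x)\<^sup>2" using B by (intro power_mono) auto
      moreover have "2 * B \<le> (2 * B + 1)\<^sup>2" using B by (simp add: power2_eq_square algebra_simps)
      ultimately have "1 \<le> 1 / (2 * B) * (hyp_log x)\<^sup>2" using B by (simp add: field_simps)
      from mult_right_mono[OF this, of "(v x)\<^sup>2 * gauss_weight \<beta> x"] gpos[of \<beta> x] show ?thesis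
        using False by (simp add: mult.assoc)
    qed
    have i1: "set_integrable lborel ?S (\<lambda>x. (v x)\<^sup>2 * gauss_weight \<beta> x)" "set_integrable lborel ?S (\<lambda>x. (hyp_log x)\<^sup>2 * (v x)\<^sup>2 * gauss_weight \<beta> x)"
      by (intro set_integrable_compact compact_cball continuous_intros; simp)+
    have ind: "(\<lambda>x. indicator ?S x *\<^sub>R (indicator ?T x * (Fm * (v x)\<^sup>2))) = (\<lambda>x. indicator ?T x *\<^sub>R (Fm * (v x)\<^sup>2))"
      using R by (auto simp: fun_eq_iff split: split_indicator)
    have "continuous_on ?T v" using C1_onD(3)[OF v] R by (elim continuous_on_subset) auto
    then have i3: "set_integrable lborel ?T (\<lambda>x. Fm * (v x)\<^sup>2)"
      by (intro set_integrable_compact compact_cball continuous_intros)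
    then have i2: "set_integrable lborel ?S (\<lambda>x. indicator ?T x * (Fm * (v x)\<^sup>2))"
      unfolding set_integrable_def ind .
    have "X \<le> (LINT x:?S|lborel. 1 / (2 * B) * ((hyp_log x)\<^sup>2 * (v x)\<^sup>2 * gauss_weight \<beta> x) + indicator ?T x * (Fm * (v x)\<^sup>2))"
      unfolding X_def wmass_def using i1 i2
      by (intro set_integral_mono pw set_integral_add set_integrable_mult_right) auto
    also have "\<dots> = 1 / (2 * B) * Y + (LINT x:?S|lborel. indicator ?T x * (Fm * (v x)\<^sup>2))"
      using i1 i2 unfolding Y_def by (subst set_integral_add) auto
    also have "(LINT x:?S|lborel. indicator ?T x * (Fm * (v x)\<^sup>2)) = Fm * Z"
    proof -
      have "(LINT x:?S|lborel. indicator ?T x * (Fm * (v x)\<^sup>2)) = (LINT x:?T|lborel. Fm * (v x)\<^sup>2)"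
        unfolding set_lebesgue_integral_def ind ..
      then show ?thesis by (simp add: Z_def)
    qed
    finally have X1: "X \<le> 1 / (2 * B) * Y + Fm * Z" .
    have "Z \<le> 4 * 2 ^ DIM('a) * (LINT x:?T|lborel. (norm (Du x))\<^sup>2)"
      unfolding Z_def v_def using ball_average_diff_Poincare[OF _ R0(2) u0] R0 by simp
    also have "(LINT x:?T|lborel. (norm (Du x))\<^sup>2) \<le> (LINT x:?T|lborel. 1 / m0 * (((1 - (norm x)\<^sup>2) / 2)\<^sup>2 * (norm (Du x))\<^sup>2 * gauss_weight \<beta> x))"
    proof (intro set_integral_mono set_integrable_compact compact_cball)
      have "?T \<subseteq> ball 0 1" using R0 by auto
      then show "continuous_on ?T (\<lambda>x. 1 / m0 * (((1 - (norm x)\<^sup>2) / 2)\<^sup>2 * (norm (Du x))\<^sup>2 * gauss_weight \<beta> x))"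
        "continuous_on ?T (\<lambda>x. (norm (Du x))\<^sup>2)"
        using m0 continuous_on_subset[OF continuous_on_gauss_weight, of ?T] C1_onD(2)[OF u0]
        by (auto intro!: continuous_intros)
      fix x assume x: "x \<in> ?T"
      then have nx: "norm x < 1" using R0 by auto
      have "(norm x)\<^sup>2 \<le> R0\<^sup>2" using x by (intro power_mono) auto
      then have q: "q0 \<le> 1 - (norm x)\<^sup>2" using R0(3) by simp
      have "hyp_log x \<le> ln (4 / q0)"
        unfolding hyp_log_def using q q0 by (subst ln_le_cancel_iff) (auto intro!: divide_left_mono)
      then have "(hyp_log x)\<^sup>2 \<le> (ln (4 / q0))\<^sup>2" using hyp_log_bounds(1)[OF nx] by (intro power_mono) auto
      then have "\<beta> * (hyp_log x)\<^sup>2 \<le> \<beta> * (ln (4 / q0))\<^sup>2" using assms by (intro mult_left_mono) auto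
      moreover have "0 \<le> DIM('a) * hyp_log x" using hyp_log_bounds(1)[OF nx] by simp
      ultimately have "- \<beta> * (ln (4 / q0))\<^sup>2 \<le> DIM('a) * hyp_log x - \<beta> * (hyp_log x)\<^sup>2"
        by (simp only: mult_minus_left)
      then have "m0 \<le> ((1 - (norm x)\<^sup>2) / 2)\<^sup>2 * gauss_weight \<beta> x"
        unfolding m0_def gauss_weight_def using q q0 by (intro mult_mono power_mono) auto
      from mult_right_mono[OF this, of "(norm (Du x))\<^sup>2"]
      show "(norm (Du x))\<^sup>2 \<le> 1 / m0 * (((1 - (norm x)\<^sup>2) / 2)\<^sup>2 * (norm (Du x))\<^sup>2 * gauss_weight \<beta> x)"
        using m0 by (simp add: pos_le_divide_eq mult_ac)
    qed
    also have "\<dots> = 1 / m0 * wenergy \<beta> R0 Du" by (simp add: wenergy_def)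
    also have "\<dots> \<le> 1 / m0 * E"
      unfolding E_def using m0 wenergy_mono[OF C1_onD(2)[OF u] R] by (intro mult_left_mono) auto
    finally have Z: "Z \<le> 4 * 2 ^ DIM('a) / m0 * E" by (simp add: mult_left_mono)
    have "1 / (2 * B) * Y \<le> 1 / (2 * B) * (2 / \<beta>\<^sup>2 * E + B * X)"
      using B by (intro mult_left_mono Y) auto
    also have "\<dots> = (2 / \<beta>\<^sup>2 / B * E) / 2 + X / 2" using B by (simp add: field_simps)
    finally have "1 / (2 * B) * Y \<le> (2 / \<beta>\<^sup>2 / B * E) / 2 + X / 2" .
    \<comment> \<open>The half of \<open>X\<close> on the right-hand side moves to the left.\<close>
    moreover have "X \<le> a + 2 * z" if "p \<le> a / 2 + X / 2" "X \<le> p + z" for a p z using that by linarith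
    ultimately have "X \<le> 2 / \<beta>\<^sup>2 / B * E + 2 * (Fm * Z)" using X1 by blast
    also have "\<dots> \<le> 2 / \<beta>\<^sup>2 / B * E + 2 * (Fm * (4 * 2 ^ DIM('a) / m0 * E))"
      using Fm0 Z by (intro add_left_mono mult_left_mono) auto
    also have "\<dots> \<le> C * E" using E0 by (simp add: C_def algebra_simps)
    finally show ?thesis by (simp add: X_def E_def v_def[abs_def])
  qed
  moreover have "1 \<le> C" using B Fm0 m0 by (simp add: C_def)
  ultimately show ?thesis using R0 by blast
qed

section \<open>Conformal change of the function and the defective inequality\<close>

lemma C1_on_mult:
  assumes u: "C1_on S u Du" and s: "C1_on S s Ds"
  shows "C1_on S (\<lambda>x. u x * s x) (\<lambda>x. s x *\<^sub>R Du x + u x *\<^sub>R Ds x)"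
proof -
  note C1_onD(4,5)[OF u, measurable] C1_onD(4,5)[OF s, measurable]
  have "((\<lambda>x. u x * s x) has_derivative (\<lambda>v. (s x *\<^sub>R Du x + u x *\<^sub>R Ds x) \<bullet> v)) (at x)" if "x \<in> S" for x
    using has_derivative_mult[OF C1_onD(1)[OF u that] C1_onD(1)[OF s that]]
    by (rule has_derivative_eq_rhs) (simp add: fun_eq_iff inner_simps mult_ac)
  then show ?thesis
    unfolding C1_on_def using C1_onD[OF u] C1_onD[OF s] by (auto intro!: continuous_intros)
qed

text \<open>\<open>conf_weight\<close> is \<open>\<lambda>\<^sup>-\<^sup>1 \<surd>gauss_weight\<close>, where \<open>\<lambda> = 2 / (1 - |x|\<^sup>2) = exp (hyp_log x) / 2\<close> is the
  conformal factor. Multiplication by it turns the weighted hyperbolic energy into the Euclidean one up to lower order terms.\<close>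
definition conf_weight :: "real \<Rightarrow> 'a::euclidean_space \<Rightarrow> real" where
  "conf_weight \<beta> x = 2 * exp (- hyp_log x + (DIM('a) * hyp_log x - \<beta> * (hyp_log x)\<^sup>2) / 2)"

definition conf_weight_grad :: "real \<Rightarrow> 'a::euclidean_space \<Rightarrow> 'a" where
  "conf_weight_grad \<beta> x = (conf_weight \<beta> x * (DIM('a) / 2 - 1 - \<beta> * hyp_log x) * (2 / (1 - (norm x)\<^sup>2))) *\<^sub>R x"

lemma C1_on_conf_weight:
  assumes "R < 1" shows "C1_on (cball (0::'a::euclidean_space) R) (conf_weight \<beta>) (conf_weight_grad \<beta>)"
proof -
  have Ssub: "cball 0 R \<subseteq> ball (0::'a) 1" using assms by auto
  note [continuous_intros] = continuous_on_subset[OF continuous_on_hyp_log Ssub]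
  have [measurable]: "conf_weight \<beta> \<in> borel_measurable borel" for \<beta>
    unfolding conf_weight_def[abs_def] by measurable
  have "(conf_weight \<beta> has_derivative (\<lambda>v. conf_weight_grad \<beta> x \<bullet> v)) (at x)" if "norm x < 1" for x :: 'a
  proof -
    have "((\<lambda>s. - s + (DIM('a) * s - \<beta> * s\<^sup>2) / 2) has_field_derivative (DIM('a) / 2 - 1 - \<beta> * hyp_log x)) (at (hyp_log x))"
      by (auto intro!: derivative_eq_intros simp: field_simps)
    from DERIV_cmult[OF DERIV_fun_exp[OF this], of 2]
    have "((\<lambda>s. 2 * exp (- s + (DIM('a) * s - \<beta> * s\<^sup>2) / 2)) has_field_derivative
        (conf_weight \<beta> x * (DIM('a) / 2 - 1 - \<beta> * hyp_log x))) (at (hyp_log x))"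
      by (simp add: conf_weight_def mult.assoc)
    from has_derivative_compose[OF hyp_log_has_derivative[OF that] this[unfolded has_field_derivative_def]]
    show ?thesis
      unfolding conf_weight_def[abs_def]
      by (rule has_derivative_eq_rhs) (simp add: fun_eq_iff conf_weight_grad_def conf_weight_def mult_ac)
  qed
  moreover have "continuous_on (cball 0 R) (conf_weight_grad \<beta> :: 'a \<Rightarrow> 'a)"
  proof -
    have "1 - (norm x)\<^sup>2 \<noteq> 0" if "x \<in> cball 0 R" for x :: 'a
      using norm_square_less_1[of x] that assms by auto
    then show ?thesis
      unfolding conf_weight_grad_def[abs_def] conf_weight_def by (intro continuous_intros) auto
  qed
  moreover have "(conf_weight_grad \<beta> :: 'a \<Rightarrow> 'a) \<in> borel_measurable borel"
    unfolding conf_weight_grad_def[abs_def] by measurable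
  ultimately show ?thesis
    unfolding C1_on_def using assms by auto
qed

lemma conf_weight_square:
  fixes x :: "'a::euclidean_space"
  assumes "norm x < 1"
  shows "(conf_weight \<beta> x)\<^sup>2 = ((1 - (norm x)\<^sup>2) / 2)\<^sup>2 * gauss_weight \<beta> x"
    and "(2 / (1 - (norm x)\<^sup>2))\<^sup>2 * (conf_weight \<beta> x)\<^sup>2 = gauss_weight \<beta> x"
proof -
  note q = norm_square_less_1[OF assms]
  have qe: "(1 - (norm x)\<^sup>2) / 2 = 2 * exp (- hyp_log x)"
    unfolding hyp_log_def exp_minus using q by (subst exp_ln) (auto simp: field_simps)
  have "conf_weight \<beta> x = (1 - (norm x)\<^sup>2) / 2 * exp ((DIM('a) * hyp_log x - \<beta> * (hyp_log x)\<^sup>2) / 2)"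
    unfolding qe conf_weight_def exp_add by simp
  moreover have "(exp ((DIM('a) * hyp_log x - \<beta> * (hyp_log x)\<^sup>2) / 2))\<^sup>2 = gauss_weight \<beta> x"
    unfolding gauss_weight_def power2_eq_square exp_add[symmetric] by simp
  ultimately show 1: "(conf_weight \<beta> x)\<^sup>2 = ((1 - (norm x)\<^sup>2) / 2)\<^sup>2 * gauss_weight \<beta> x"
    by (simp only: power_mult_distrib)
  have "(2 / (1 - (norm x)\<^sup>2))\<^sup>2 * ((1 - (norm x)\<^sup>2) / 2)\<^sup>2 = 1"
  proof -
    have "(2 / y)\<^sup>2 * (y / 2)\<^sup>2 = 1" if "y > 0" for y :: real
      using that by (simp add: power_divide)
    then show ?thesis using q .
  qed
  then show "(2 / (1 - (norm x)\<^sup>2))\<^sup>2 * (conf_weight \<beta> x)\<^sup>2 = gauss_weight \<beta> x"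
    unfolding 1 by (simp add: mult.assoc[symmetric])
qed

text \<open>The conformal factor that differentiation produces cancels against the one in the
  denominator of \<open>conf_weight\<close>. What remains is the weight times a quadratic polynomial
  in \<open>hyp_log x\<close>, the quantity that \<open>drift_bound\<close> controls.\<close>

lemma norm_conf_weight_grad_square_le:
  fixes x :: "'a::euclidean_space"
  assumes "norm x < 1"
  shows "(norm (conf_weight_grad \<beta> x))\<^sup>2 \<le> 2 * ((real DIM('a))\<^sup>2 + \<beta>\<^sup>2 * (hyp_log x)\<^sup>2) * gauss_weight \<beta> x"
proof -
  let ?N = "real DIM('a)"
  have N: "?N \<ge> 1" using DIM_positive[where 'a='a] by simp
  have "(?N / 2 - 1 - \<beta> * hyp_log x)\<^sup>2 \<le> 2 * (?N / 2 - 1)\<^sup>2 + 2 * (\<beta> * hyp_log x)\<^sup>2"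
    using zero_le_power2[of "(?N / 2 - 1) + \<beta> * hyp_log x"] by (simp add: power2_eq_square algebra_simps)
  also have "(?N / 2 - 1)\<^sup>2 \<le> ?N\<^sup>2"
  proof -
    have "\<bar>?N / 2 - 1\<bar> \<le> \<bar>?N\<bar>" using N by linarith
    then show ?thesis by (simp only: abs_le_square_iff)
  qed
  finally have a: "(?N / 2 - 1 - \<beta> * hyp_log x)\<^sup>2 \<le> 2 * (?N\<^sup>2 + \<beta>\<^sup>2 * (hyp_log x)\<^sup>2)"
    by (simp add: power_mult_distrib)
  have "(norm (conf_weight_grad \<beta> x))\<^sup>2 = (?N / 2 - 1 - \<beta> * hyp_log x)\<^sup>2 * ((2 / (1 - (norm x)\<^sup>2))\<^sup>2 * (conf_weight \<beta> x)\<^sup>2) * (norm x)\<^sup>2"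
    unfolding conf_weight_grad_def norm_scaleR power_mult_distrib real_norm_def abs_mult power2_abs by (simp only: mult_ac)
  also have "\<dots> = (?N / 2 - 1 - \<beta> * hyp_log x)\<^sup>2 * gauss_weight \<beta> x * (norm x)\<^sup>2"
    by (simp only: conf_weight_square(2)[OF assms])
  also have "\<dots> \<le> (2 * (?N\<^sup>2 + \<beta>\<^sup>2 * (hyp_log x)\<^sup>2)) * gauss_weight \<beta> x * 1"
    using a norm_square_less_1[OF assms] by (intro mult_mono) (auto simp: less_imp_le[OF gauss_weight_pos])
  finally show ?thesis by simp
qed

text \<open>\<open>ln (w\<^sup>2)\<close> exceeds the logarithm for
  \<open>w * conf_weight \<beta> x\<close> by \<open>- ln ((conf_weight \<beta> x)\<^sup>2)\<close>,
  whose positive contributions are \<open>2 * hyp_log x\<close> and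
  \<open>\<beta> * (hyp_log x)\<^sup>2\<close> only; the volume growth helps. The squared conformal
  factor in front turns the square of \<open>w * conf_weight \<beta> x\<close> back into the mass
  density.\<close>

lemma log_weight_le:
  fixes x :: "'a::euclidean_space"
  assumes "norm x < 1" "\<beta> > 0"
  shows "w\<^sup>2 * max 0 (ln (w\<^sup>2)) * gauss_weight \<beta> x
    \<le> (2 / (1 - (norm x)\<^sup>2))\<^sup>2 * (w * conf_weight \<beta> x)\<^sup>2 * max 0 (ln ((w * conf_weight \<beta> x)\<^sup>2)) + (2 * hyp_log x + \<beta> * (hyp_log x)\<^sup>2) * (w\<^sup>2 * gauss_weight \<beta> x)"
proof (cases "w = 0")
  case False
  have conf_weight: "conf_weight \<beta> x > 0" by (simp add: conf_weight_def)
  have ln_conf_weight: "ln ((conf_weight \<beta> x)\<^sup>2) = 2 * ln 2 - 2 * hyp_log x + DIM('a) * hyp_log x - \<beta> * (hyp_log x)\<^sup>2"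
  proof -
    have "ln (conf_weight \<beta> x) = ln 2 + (- hyp_log x + (DIM('a) * hyp_log x - \<beta> * (hyp_log x)\<^sup>2) / 2)"
      unfolding conf_weight_def by (subst ln_mult_pos) auto
    moreover have "ln ((conf_weight \<beta> x)\<^sup>2) = 2 * ln (conf_weight \<beta> x)"
      using conf_weight by (simp add: ln_realpow)
    ultimately show ?thesis by (simp add: field_simps)
  qed
  have "ln ((w * conf_weight \<beta> x)\<^sup>2) = ln (w\<^sup>2) + ln ((conf_weight \<beta> x)\<^sup>2)"
    unfolding power_mult_distrib using False conf_weight by (intro ln_mult_pos) auto
  moreover have "ln (2::real) > 0" by simp
  moreover have "0 \<le> DIM('a) * hyp_log x" and *: "0 \<le> 2 * hyp_log x + \<beta> * (hyp_log x)\<^sup>2"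
    using hyp_log_bounds(1)[OF assms(1)] assms(2) by auto
  ultimately have "ln (w\<^sup>2) \<le> ln ((w * conf_weight \<beta> x)\<^sup>2) + (2 * hyp_log x + \<beta> * (hyp_log x)\<^sup>2)"
    using ln_conf_weight by linarith
  with * have "max 0 (ln (w\<^sup>2)) \<le> max 0 (ln ((w * conf_weight \<beta> x)\<^sup>2)) + (2 * hyp_log x + \<beta> * (hyp_log x)\<^sup>2)"
    by linarith
  then have le: "w\<^sup>2 * gauss_weight \<beta> x * max 0 (ln (w\<^sup>2)) \<le> w\<^sup>2 * gauss_weight \<beta> x * (max 0 (ln ((w * conf_weight \<beta> x)\<^sup>2)) + (2 * hyp_log x + \<beta> * (hyp_log x)\<^sup>2))"
    by (intro mult_left_mono) (auto simp: less_imp_le[OF gauss_weight_pos])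
  have eq: "(2 / (1 - (norm x)\<^sup>2))\<^sup>2 * (w * conf_weight \<beta> x)\<^sup>2 = w\<^sup>2 * gauss_weight \<beta> x"
    unfolding power_mult_distrib conf_weight_square(2)[OF assms(1), symmetric] by (simp only: mult_ac)
  have "w\<^sup>2 * max 0 (ln (w\<^sup>2)) * gauss_weight \<beta> x = w\<^sup>2 * gauss_weight \<beta> x * max 0 (ln (w\<^sup>2))"
    by (simp only: mult_ac)
  also note le
  finally show ?thesis
    unfolding eq by (simp only: distrib_left mult.commute[of _ "w\<^sup>2 * gauss_weight \<beta> x"])
qed auto

lemma log_conformal_le:
  fixes x :: "'a::euclidean_space"
  assumes "norm x < 1"
  shows "(2 / (1 - (norm x)\<^sup>2))\<^sup>2 \<ge> 1" "1 + ln ((2 / (1 - (norm x)\<^sup>2))\<^sup>2) \<le> 2 + (hyp_log x)\<^sup>2"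
    "0 \<le> 1 + ln ((2 / (1 - (norm x)\<^sup>2))\<^sup>2)"
proof -
  note q = norm_square_less_1[OF assms]
  have "1 - (norm x)\<^sup>2 \<le> 2" by (smt (verit) zero_le_power2)
  then have 1: "1 \<le> 2 / (1 - (norm x)\<^sup>2)" using q by simp
  then show "(2 / (1 - (norm x)\<^sup>2))\<^sup>2 \<ge> 1" by (simp add: one_le_power)
  then show "0 \<le> 1 + ln ((2 / (1 - (norm x)\<^sup>2))\<^sup>2)" by (smt (verit) ln_ge_zero)
  have "ln ((2 / (1 - (norm x)\<^sup>2))\<^sup>2) = 2 * ln (2 / (1 - (norm x)\<^sup>2))"
    using 1 by (simp add: ln_realpow)
  also have "\<dots> \<le> 2 * hyp_log x"
    unfolding hyp_log_def using q by (auto intro!: divide_right_mono)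
  also have "\<dots> \<le> 1 + (hyp_log x)\<^sup>2" using sum_squares_bound[of 1 "hyp_log x"] by simp
  finally show "1 + ln ((2 / (1 - (norm x)\<^sup>2))\<^sup>2) \<le> 2 + (hyp_log x)\<^sup>2" by simp
qed

lemma ennreal_lincomb3:
  assumes "0 \<le> a" "0 \<le> b" "0 \<le> c" "0 \<le> x" "0 \<le> y" "0 \<le> z"
  shows "ennreal (a * x + b * y + c * z) = ennreal a * ennreal x + ennreal b * ennreal y + ennreal c * ennreal z"
  using assms by (simp add: ennreal_plus ennreal_mult)

text \<open>\<open>weighted_log_Sobolev\<close> is applied to \<open>h = w * conf_weight\<close>,
  with the square of the conformal factor as \<open>W\<close>. Then \<open>W * h\<^sup>2\<close> is
  the mass density of \<open>w\<close>, and \<open>1 \<le> W\<close> passes the normalisation of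
  \<open>w\<close> on to \<open>h\<close>. Every term that arises is a combination of three
  integrals: the mass, the mass weighted by \<open>(hyp_log x)\<^sup>2\<close>, and the energy. The
  defect is that the right-hand side need not vanish with the energy.\<close>

lemma defective_log_Sobolev:
  assumes "\<beta> > 0"
  shows "\<exists>C\<ge>0. \<forall>R (w :: 'a::euclidean_space \<Rightarrow> real) Dw.
    1 / 2 \<le> R \<and> R < 1 \<and> C1_on (cball 0 R) w Dw \<and> wmass \<beta> R w \<le> 1 \<longrightarrow>
      (\<integral>\<^sup>+x\<in>cball 0 R. ennreal ((w x)\<^sup>2 * max 0 (ln ((w x)\<^sup>2)) * gauss_weight \<beta> x) \<partial>lborel)
        \<le> ennreal (C * (wenergy \<beta> R Dw + 1))"
proof -
  let ?N = "DIM('a)"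
  \<comment> \<open>All radii are at least 1/2, so this volume is a lower bound for every ball and
    the constants do not depend on \<open>R\<close>.\<close>
  define \<omega> where "\<omega> = measure lborel (cball (0::'a) (1 / 2))"
  have \<omega>: "\<omega> > 0" unfolding \<omega>_def by simp
  define K where "K = 8 * (\<bar>ln (4 / \<omega>)\<bar> + 2 * ?N) + max 0 (ln (4 / \<omega> * 2 ^ ?N))"
  have K: "K \<ge> 0" by (simp add: K_def)
  define M where "M = K * 2\<^sup>2 * 2 ^ ?N"
  have M: "M \<ge> 0" using K by (simp add: M_def)
  define B where "B = drift_const \<beta> TYPE('a)"
  have B: "B > 0"
    unfolding B_def drift_const_def using assms by (intro mult_pos_pos add_pos_pos) auto
  define a where "a = 2 * K + 4 * M * (real ?N)\<^sup>2 + 1"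
  define b where "b = K + 4 * M * \<beta>\<^sup>2 + 1 + \<beta>"
  have ab: "a \<ge> 0" "b \<ge> 0" using K M assms by (auto simp: a_def b_def)
  define C where "C = a + 2 * M + b * (2 / \<beta>\<^sup>2 + B)"
  have C: "C \<ge> 0" using ab M B assms by (simp add: C_def)
  have "(\<integral>\<^sup>+x\<in>cball 0 R. ennreal ((w x)\<^sup>2 * max 0 (ln ((w x)\<^sup>2)) * gauss_weight \<beta> x) \<partial>lborel)
        \<le> ennreal (C * (wenergy \<beta> R Dw + 1))"
    if R: "1 / 2 \<le> R" "R < 1" and w: "C1_on (cball 0 R) w Dw" and mass: "wmass \<beta> R w \<le> 1"
    for R and w :: "'a \<Rightarrow> real" and Dw
  proof -
    let ?S = "cball (0::'a) R"
    have Ssub: "?S \<subseteq> ball 0 1" using R by auto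
    have nx: "x \<in> ?S \<Longrightarrow> norm x < 1" for x using R by auto
    note [continuous_intros] = continuous_on_subset[OF continuous_on_hyp_log Ssub]
      continuous_on_subset[OF continuous_on_gauss_weight Ssub] C1_onD(2,3)[OF w]
    note gpos = less_imp_le[OF gauss_weight_pos]
    note [measurable] = C1_onD(4,5)[OF w]
    have Sb[measurable]: "?S \<in> sets borel" by simp
    define W where "W x = (2 / (1 - (norm x)\<^sup>2))\<^sup>2" for x :: 'a
    have [measurable]: "W \<in> borel_measurable borel" unfolding W_def[abs_def] by measurable
    define h where "h x = w x * conf_weight \<beta> x" for x
    define Dh where "Dh x = conf_weight \<beta> x *\<^sub>R Dw x + w x *\<^sub>R conf_weight_grad \<beta> x" for x
    have h: "C1_on ?S h Dh"
      unfolding h_def[abs_def] Dh_def[abs_def] by (rule C1_on_mult[OF w C1_on_conf_weight[OF R(2)]])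
    note [measurable] = C1_onD(4,5)[OF h]
    have Wh: "W x * (h x)\<^sup>2 = (w x)\<^sup>2 * gauss_weight \<beta> x" if "x \<in> ?S" for x
      unfolding W_def h_def power_mult_distrib conf_weight_square(2)[OF nx[OF that], symmetric] by (simp only: mult_ac)
    define X where "X = wmass \<beta> R w"
    define Y where "Y = (LINT x:?S|lborel. (hyp_log x)\<^sup>2 * (w x)\<^sup>2 * gauss_weight \<beta> x)"
    define E where "E = wenergy \<beta> R Dw"
    have X: "0 \<le> X" "X \<le> 1" and E: "0 \<le> E"
      using mass by (auto simp: X_def E_def wmass_nonneg wenergy_nonneg)
    have "Y \<le> 2 / \<beta>\<^sup>2 * E + B * X"
      using drift_bound[OF assms R(2) w] by (simp add: Y_def X_def E_def B_def wmass_def wenergy_def drift_const_def)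
    also have "\<dots> \<le> 2 / \<beta>\<^sup>2 * (E + 1) + B * (E + 1)"
      using X E B assms by (intro add_mono mult_left_mono) auto
    finally have Y: "Y \<le> (2 / \<beta>\<^sup>2 + B) * (E + 1)" by (simp add: distrib_right)
    have Y0: "0 \<le> Y" unfolding Y_def using gpos by (intro set_integral_nonneg mult_nonneg_nonneg) auto
    have iX: "(\<integral>\<^sup>+x\<in>?S. ennreal ((w x)\<^sup>2 * gauss_weight \<beta> x) \<partial>lborel) = ennreal X"
      unfolding X_def wmass_def by (intro set_nn_integral_compact_eq continuous_intros) (auto simp: gpos)
    have iY: "(\<integral>\<^sup>+x\<in>?S. ennreal ((hyp_log x)\<^sup>2 * (w x)\<^sup>2 * gauss_weight \<beta> x) \<partial>lborel) = ennreal Y"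
      unfolding Y_def by (intro set_nn_integral_compact_eq continuous_intros) (auto simp: gpos)
    have iE: "(\<integral>\<^sup>+x\<in>?S. ennreal (((1 - (norm x)\<^sup>2) / 2)\<^sup>2 * (norm (Dw x))\<^sup>2 * gauss_weight \<beta> x) \<partial>lborel) = ennreal E"
      unfolding E_def wenergy_def by (intro set_nn_integral_compact_eq continuous_intros) (auto simp: gpos)
    have comb: "(\<integral>\<^sup>+x\<in>?S. ennreal (f x) \<partial>lborel) \<le> ennreal (c1 * X + c2 * Y + c3 * E)"
      if le: "\<And>x. x \<in> ?S \<Longrightarrow> f x \<le> c1 * ((w x)\<^sup>2 * gauss_weight \<beta> x) + c2 * ((hyp_log x)\<^sup>2 * (w x)\<^sup>2 * gauss_weight \<beta> x)
          + c3 * (((1 - (norm x)\<^sup>2) / 2)\<^sup>2 * (norm (Dw x))\<^sup>2 * gauss_weight \<beta> x)"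
        and c: "0 \<le> c1" "0 \<le> c2" "0 \<le> c3" for f c1 c2 c3
    proof -
      let ?e = "\<lambda>x. ((1 - (norm x)\<^sup>2) / 2)\<^sup>2 * (norm (Dw x))\<^sup>2 * gauss_weight \<beta> x"
      have "(\<integral>\<^sup>+x\<in>?S. ennreal (f x) \<partial>lborel) \<le> (\<integral>\<^sup>+x. ennreal c1 * (ennreal ((w x)\<^sup>2 * gauss_weight \<beta> x) * indicator ?S x)
          + ennreal c2 * (ennreal ((hyp_log x)\<^sup>2 * (w x)\<^sup>2 * gauss_weight \<beta> x) * indicator ?S x)
          + ennreal c3 * (ennreal (?e x) * indicator ?S x) \<partial>lborel)"
      proof (intro nn_integral_mono)
        fix x
        show "ennreal (f x) * indicator ?S x \<le> ennreal c1 * (ennreal ((w x)\<^sup>2 * gauss_weight \<beta> x) * indicator ?S x)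
          + ennreal c2 * (ennreal ((hyp_log x)\<^sup>2 * (w x)\<^sup>2 * gauss_weight \<beta> x) * indicator ?S x)
          + ennreal c3 * (ennreal (?e x) * indicator ?S x)"
        proof (cases "x \<in> ?S")
          case True
          have "ennreal (c1 * ((w x)\<^sup>2 * gauss_weight \<beta> x) + c2 * ((hyp_log x)\<^sup>2 * (w x)\<^sup>2 * gauss_weight \<beta> x) + c3 * ?e x)
            = ennreal c1 * ennreal ((w x)\<^sup>2 * gauss_weight \<beta> x) + ennreal c2 * ennreal ((hyp_log x)\<^sup>2 * (w x)\<^sup>2 * gauss_weight \<beta> x) + ennreal c3 * ennreal (?e x)"
            using c by (intro ennreal_lincomb3) (auto simp: gpos)
          with ennreal_leI[OF le[OF True]] True show ?thesis by simp
        qed simp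
      qed
      also have "\<dots> = ennreal c1 * ennreal X + ennreal c2 * ennreal Y + ennreal c3 * ennreal E"
        unfolding iX[symmetric] iY[symmetric] iE[symmetric]
        by (simp add: nn_integral_add nn_integral_cmult)
      also have "\<dots> = ennreal (c1 * X + c2 * Y + c3 * E)"
        using c X(1) Y0 E by (simp add: ennreal_plus ennreal_mult)
      finally show ?thesis .
    qed
    have norm_h: "(\<integral>\<^sup>+x\<in>?S. ennreal ((h x)\<^sup>2) \<partial>lborel) \<le> 1"
    proof -
      have "(h x)\<^sup>2 \<le> (w x)\<^sup>2 * gauss_weight \<beta> x" if "x \<in> ?S" for x
        using log_conformal_le(1)[OF nx[OF that]] mult_right_mono[of 1 "W x" "(h x)\<^sup>2"] Wh[OF that] by (simp add: W_def)
      then have "(\<integral>\<^sup>+x\<in>?S. ennreal ((h x)\<^sup>2) \<partial>lborel) \<le> ennreal X"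
        using comb[of "\<lambda>x. (h x)\<^sup>2" 1 0 0] by simp
      also have "\<dots> \<le> 1" using X by simp
      finally show ?thesis .
    qed
    have Dh_le: "(norm (Dh x))\<^sup>2 \<le> 4 * (real ?N)\<^sup>2 * ((w x)\<^sup>2 * gauss_weight \<beta> x) + 4 * \<beta>\<^sup>2 * ((hyp_log x)\<^sup>2 * (w x)\<^sup>2 * gauss_weight \<beta> x)
        + 2 * (((1 - (norm x)\<^sup>2) / 2)\<^sup>2 * (norm (Dw x))\<^sup>2 * gauss_weight \<beta> x)" if x: "x \<in> ?S" for x
    proof -
      have "(norm (Dh x))\<^sup>2 \<le> (norm (conf_weight \<beta> x *\<^sub>R Dw x) + norm (w x *\<^sub>R conf_weight_grad \<beta> x))\<^sup>2"
        unfolding Dh_def by (intro power_mono norm_triangle_ineq) auto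
      also have "\<dots> \<le> 2 * (norm (conf_weight \<beta> x *\<^sub>R Dw x))\<^sup>2 + 2 * (norm (w x *\<^sub>R conf_weight_grad \<beta> x))\<^sup>2"
        using sum_squares_bound[of "norm (conf_weight \<beta> x *\<^sub>R Dw x)" "norm (w x *\<^sub>R conf_weight_grad \<beta> x)"]
        by (simp only: power2_sum)
      also have "\<dots> = 2 * ((conf_weight \<beta> x)\<^sup>2 * (norm (Dw x))\<^sup>2) + 2 * ((w x)\<^sup>2 * (norm (conf_weight_grad \<beta> x))\<^sup>2)"
        by (simp add: power_mult_distrib)
      also have "\<dots> \<le> 2 * ((conf_weight \<beta> x)\<^sup>2 * (norm (Dw x))\<^sup>2) + 2 * ((w x)\<^sup>2 * (2 * ((real ?N)\<^sup>2 + \<beta>\<^sup>2 * (hyp_log x)\<^sup>2) * gauss_weight \<beta> x))"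
        using norm_conf_weight_grad_square_le[OF nx[OF x], of \<beta>] by (intro add_left_mono mult_left_mono) auto
      finally show ?thesis
        unfolding conf_weight_square(1)[OF nx[OF x]] by (simp add: algebra_simps)
    qed
    have "(\<integral>\<^sup>+x\<in>?S. ennreal (W x * (h x)\<^sup>2 * max 0 (ln ((h x)\<^sup>2))) \<partial>lborel)
      \<le> ennreal K * (\<integral>\<^sup>+x\<in>S. ennreal ((1 + ln (W x)) * W x * (h x)\<^sup>2) \<partial>lborel)
        + ennreal M * (\<integral>\<^sup>+x\<in>S. ennreal ((norm (Dh x))\<^sup>2) \<partial>lborel)" if "S = ?S" for S
      unfolding K_def M_def that
    proof (rule weighted_log_Sobolev)
      show "norm (z - x) \<le> 2" if "x \<in> ?S" "z \<in> ?S" for x z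
        using norm_triangle_ineq4[of z x] that R by auto
      show "\<omega> \<le> measure lborel ?S"
        unfolding \<omega>_def using R by (simp add: content_cball mult_left_mono power_mono)
      show "1 \<le> W x" if "x \<in> ?S" for x unfolding W_def by (rule log_conformal_le(1)[OF nx[OF that]])
    qed (use \<omega> norm_h C1_onD[OF h] in auto)
    note wls = this[OF refl]
    have "(\<integral>\<^sup>+x\<in>?S. ennreal ((1 + ln (W x)) * W x * (h x)\<^sup>2) \<partial>lborel) \<le> ennreal (2 * X + 1 * Y + 0 * E)"
    proof (rule comb)
      fix x assume x: "x \<in> ?S"
      have "(1 + ln (W x)) * (W x * (h x)\<^sup>2) \<le> (2 + (hyp_log x)\<^sup>2) * (W x * (h x)\<^sup>2)"
        using log_conformal_le(2)[OF nx[OF x]] by (intro mult_right_mono) (auto simp: W_def)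
      then show "(1 + ln (W x)) * W x * (h x)\<^sup>2 \<le> 2 * ((w x)\<^sup>2 * gauss_weight \<beta> x) + 1 * ((hyp_log x)\<^sup>2 * (w x)\<^sup>2 * gauss_weight \<beta> x)
          + 0 * (((1 - (norm x)\<^sup>2) / 2)\<^sup>2 * (norm (Dw x))\<^sup>2 * gauss_weight \<beta> x)"
        by (simp add: Wh[OF x] mult.assoc distrib_right)
    qed auto
    moreover have "(\<integral>\<^sup>+x\<in>?S. ennreal ((norm (Dh x))\<^sup>2) \<partial>lborel) \<le> ennreal (4 * (real ?N)\<^sup>2 * X + 4 * \<beta>\<^sup>2 * Y + 2 * E)"
      by (rule comb[OF Dh_le]) auto
    ultimately have "(\<integral>\<^sup>+x\<in>?S. ennreal (W x * (h x)\<^sup>2 * max 0 (ln ((h x)\<^sup>2))) \<partial>lborel)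
        \<le> ennreal K * ennreal (2 * X + 1 * Y + 0 * E) + ennreal M * ennreal (4 * (real ?N)\<^sup>2 * X + 4 * \<beta>\<^sup>2 * Y + 2 * E)"
      by (intro order_trans[OF wls] add_mono mult_left_mono) auto
    also have "\<dots> = ennreal (K * (2 * X + 1 * Y + 0 * E) + M * (4 * (real ?N)\<^sup>2 * X + 4 * \<beta>\<^sup>2 * Y + 2 * E))"
      using K M X(1) Y0 E by (subst (1 2) ennreal_mult[symmetric]) (auto simp: ennreal_plus)
    finally have 1: "(\<integral>\<^sup>+x\<in>?S. ennreal (W x * (h x)\<^sup>2 * max 0 (ln ((h x)\<^sup>2))) \<partial>lborel)
      \<le> ennreal (K * (2 * X + 1 * Y + 0 * E) + M * (4 * (real ?N)\<^sup>2 * X + 4 * \<beta>\<^sup>2 * Y + 2 * E))" .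
    have 2: "(\<integral>\<^sup>+x\<in>?S. ennreal ((2 * hyp_log x + \<beta> * (hyp_log x)\<^sup>2) * ((w x)\<^sup>2 * gauss_weight \<beta> x)) \<partial>lborel) \<le> ennreal (1 * X + (1 + \<beta>) * Y + 0 * E)"
    proof (rule comb)
      fix x assume x: "x \<in> ?S"
      have "2 * hyp_log x + \<beta> * (hyp_log x)\<^sup>2 \<le> 1 + (1 + \<beta>) * (hyp_log x)\<^sup>2"
        using sum_squares_bound[of 1 "hyp_log x"] by (simp add: algebra_simps)
      then have "(2 * hyp_log x + \<beta> * (hyp_log x)\<^sup>2) * ((w x)\<^sup>2 * gauss_weight \<beta> x) \<le> (1 + (1 + \<beta>) * (hyp_log x)\<^sup>2) * ((w x)\<^sup>2 * gauss_weight \<beta> x)"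
        by (intro mult_right_mono) (auto simp: gpos)
      then show "(2 * hyp_log x + \<beta> * (hyp_log x)\<^sup>2) * ((w x)\<^sup>2 * gauss_weight \<beta> x)
          \<le> 1 * ((w x)\<^sup>2 * gauss_weight \<beta> x) + (1 + \<beta>) * ((hyp_log x)\<^sup>2 * (w x)\<^sup>2 * gauss_weight \<beta> x)
          + 0 * (((1 - (norm x)\<^sup>2) / 2)\<^sup>2 * (norm (Dw x))\<^sup>2 * gauss_weight \<beta> x)"
        by (simp add: mult.assoc distrib_right)
    qed (use assms in auto)
    have "(\<integral>\<^sup>+x\<in>?S. ennreal ((w x)\<^sup>2 * max 0 (ln ((w x)\<^sup>2)) * gauss_weight \<beta> x) \<partial>lborel)
      \<le> (\<integral>\<^sup>+x. ennreal (W x * (h x)\<^sup>2 * max 0 (ln ((h x)\<^sup>2))) * indicator ?S x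
        + ennreal ((2 * hyp_log x + \<beta> * (hyp_log x)\<^sup>2) * ((w x)\<^sup>2 * gauss_weight \<beta> x)) * indicator ?S x \<partial>lborel)"
    proof (intro nn_integral_mono)
      fix x
      show "ennreal ((w x)\<^sup>2 * max 0 (ln ((w x)\<^sup>2)) * gauss_weight \<beta> x) * indicator ?S x
        \<le> ennreal (W x * (h x)\<^sup>2 * max 0 (ln ((h x)\<^sup>2))) * indicator ?S x
          + ennreal ((2 * hyp_log x + \<beta> * (hyp_log x)\<^sup>2) * ((w x)\<^sup>2 * gauss_weight \<beta> x)) * indicator ?S x"
      proof (cases "x \<in> ?S")
        case True
        have "ennreal ((w x)\<^sup>2 * max 0 (ln ((w x)\<^sup>2)) * gauss_weight \<beta> x)
          \<le> ennreal (W x * (h x)\<^sup>2 * max 0 (ln ((h x)\<^sup>2)) + (2 * hyp_log x + \<beta> * (hyp_log x)\<^sup>2) * ((w x)\<^sup>2 * gauss_weight \<beta> x))"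
          unfolding W_def h_def by (intro ennreal_leI log_weight_le nx True assms)
        also have "\<dots> = ennreal (W x * (h x)\<^sup>2 * max 0 (ln ((h x)\<^sup>2))) + ennreal ((2 * hyp_log x + \<beta> * (hyp_log x)\<^sup>2) * ((w x)\<^sup>2 * gauss_weight \<beta> x))"
          using hyp_log_bounds(1)[OF nx[OF True]] assms gpos[of \<beta> x] by (intro ennreal_plus) (auto simp: W_def)
        finally show ?thesis using True by simp
      qed simp
    qed
    also have "\<dots> = (\<integral>\<^sup>+x\<in>?S. ennreal (W x * (h x)\<^sup>2 * max 0 (ln ((h x)\<^sup>2))) \<partial>lborel)
        + (\<integral>\<^sup>+x\<in>?S. ennreal ((2 * hyp_log x + \<beta> * (hyp_log x)\<^sup>2) * ((w x)\<^sup>2 * gauss_weight \<beta> x)) \<partial>lborel)"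
      by (rule nn_integral_add) measurable
    also have "\<dots> \<le> ennreal (K * (2 * X + 1 * Y + 0 * E) + M * (4 * (real ?N)\<^sup>2 * X + 4 * \<beta>\<^sup>2 * Y + 2 * E))
        + ennreal (1 * X + (1 + \<beta>) * Y + 0 * E)"
      by (intro add_mono 1 2)
    also have "\<dots> = ennreal (a * X + b * Y + 2 * M * E)"
      using K M X(1) Y0 E assms by (subst ennreal_plus[symmetric]) (auto simp: a_def b_def algebra_simps)
    also have "a * X + b * Y + 2 * M * E \<le> C * (E + 1)"
    proof -
      have "a * X \<le> a * (E + 1)" "b * Y \<le> b * ((2 / \<beta>\<^sup>2 + B) * (E + 1))" "2 * M * E \<le> 2 * M * (E + 1)"
        using ab X E M Y by (auto intro!: mult_left_mono)
      then show ?thesis unfolding C_def by (simp only: distrib_right mult.assoc)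
    qed
    finally show ?thesis by (simp add: E_def ennreal_leI)
  qed
  then show ?thesis using C by blast
qed

text \<open>\<open>Phi k y\<close> is the Bregman divergence of \<open>t ln t\<close> between \<open>y\<^sup>2\<close> and \<open>k\<close>; its integral dominates the
  entropy for every \<open>k\<close> and, being nonnegative, it is insensitive to bounded changes of density.\<close>
definition Phi :: "real \<Rightarrow> real \<Rightarrow> real" where
  "Phi k y = y\<^sup>2 * ln (y\<^sup>2 / k) - y\<^sup>2 + k"

section \<open>Removal of the defect\<close>

lemma Phi_nonneg:
  assumes "k > 0" shows "Phi k y \<ge> 0"
proof (cases "y = 0")
  case False
  have "ln (k / y\<^sup>2) \<le> k / y\<^sup>2 - 1" using assms False by (intro ln_le_minus_one) auto
  moreover have "ln (k / y\<^sup>2) = - ln (y\<^sup>2 / k)" using assms False by (simp add: ln_div)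
  ultimately have "y\<^sup>2 * (1 - k / y\<^sup>2) \<le> y\<^sup>2 * ln (y\<^sup>2 / k)" by (intro mult_left_mono) auto
  moreover have "y\<^sup>2 * (1 - k / y\<^sup>2) = y\<^sup>2 - k" using False by (simp add: field_simps)
  ultimately show ?thesis by (simp add: Phi_def)
qed (use assms in \<open>simp add: Phi_def\<close>)

lemma Phi_measurable[measurable]:
  assumes [measurable]: "u \<in> borel_measurable M" shows "(\<lambda>x. Phi k (u x)) \<in> borel_measurable M"
  unfolding Phi_def by measurable

text \<open>A pointwise form of Rothaus' lemma, normalised to \<open>k = 1\<close>. For small
  \<open>v\<close> the divergence is quadratic in \<open>v\<close> if \<open>c\<^sup>2 = 1\<close>;
  in the other case \<open>V = 1\<close>, and a constant is affordable. For large \<open>v\<close>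
  the sum \<open>c + v\<close> is at most \<open>2 * v\<close> in absolute value, so the logarithmic
  term of \<open>v\<close> alone dominates, and \<open>V \<le> 1\<close> allows
  \<open>ln (v\<^sup>2)\<close> to be replaced by \<open>ln (v\<^sup>2 / V)\<close>.\<close>

lemma Phi_1_le:
  fixes c v V :: real
  assumes c: "c\<^sup>2 \<le> 1" and V: "0 < V" "V \<le> 1" and cV: "c\<^sup>2 = 1 \<or> V = 1"
  shows "Phi 1 (c + v) \<le> 9 * (v\<^sup>2 + v\<^sup>2 * max 0 (ln (v\<^sup>2 / V)) + V)"
proof -
  define y where "y = (c + v)\<^sup>2"
  have Phi: "Phi 1 (c + v) = y * ln y - y + 1" by (simp add: Phi_def y_def)
  have ac: "\<bar>c\<bar> \<le> 1" using c by (simp add: abs_le_square_iff[of c 1, simplified])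
  have m0: "0 \<le> v\<^sup>2 * max 0 (ln (v\<^sup>2 / V))" by auto
  show ?thesis
  proof (cases "\<bar>v\<bar> \<le> 1")
    case True
    have "\<bar>2 * c + v\<bar> \<le> \<bar>3\<bar>" using ac True by linarith
    then have 3: "(2 * c + v)\<^sup>2 \<le> 3\<^sup>2" by (simp only: abs_le_square_iff)
    have "y * ln y \<le> y * (y - 1)"
    proof (cases "y = 0")
      case False
      then have "y > 0" by (simp add: y_def)
      then show ?thesis by (intro mult_left_mono ln_le_minus_one) auto
    qed simp
    then have le: "Phi 1 (c + v) \<le> (y - 1)\<^sup>2" unfolding Phi by (simp add: power2_eq_square algebra_simps)
    have "(y - 1)\<^sup>2 \<le> 9 * (v\<^sup>2 + V)"
    proof (cases "c\<^sup>2 = 1")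
      case True
      then have "y - 1 = v * (2 * c + v)"
        by (simp add: y_def power2_sum) (simp add: power2_eq_square algebra_simps)
      then have "(y - 1)\<^sup>2 = v\<^sup>2 * (2 * c + v)\<^sup>2"
        by (simp only: power_mult_distrib)
      also have "\<dots> \<le> v\<^sup>2 * 3\<^sup>2" using 3 by (intro mult_left_mono) auto
      finally show ?thesis using V by simp
    next
      case False
      have "\<bar>c + v\<bar> \<le> \<bar>2\<bar>" using ac True by linarith
      then have "(c + v)\<^sup>2 \<le> 2\<^sup>2" by (simp only: abs_le_square_iff)
      then have "(c + v)\<^sup>2 \<le> 4" by simp
      then have "\<bar>y - 1\<bar> \<le> \<bar>3\<bar>" unfolding y_def using zero_le_power2[of "c + v"] by linarith
      then have "(y - 1)\<^sup>2 \<le> 3\<^sup>2" by (simp only: abs_le_square_iff)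
      moreover have "V = 1" using False cV by simp
      ultimately show ?thesis using zero_le_power2[of v] by (simp add: add.commute add_increasing2)
    qed
    moreover have "9 * (v\<^sup>2 + V) \<le> 9 * (v\<^sup>2 + v\<^sup>2 * max 0 (ln (v\<^sup>2 / V)) + V)"
      using m0 by (intro mult_left_mono) auto
    ultimately show ?thesis using le by (meson order_trans)
  next
    case False
    then have v1: "1 \<le> v\<^sup>2" using abs_le_square_iff[of 1 v] by simp
    have "\<bar>c + v\<bar> \<le> \<bar>2 * v\<bar>" using ac False by linarith
    then have "(c + v)\<^sup>2 \<le> (2 * v)\<^sup>2" by (simp only: abs_le_square_iff)
    then have y: "0 \<le> y" "y \<le> 4 * v\<^sup>2" by (auto simp: y_def power_mult_distrib)
    have l4: "ln (4::real) \<le> 2"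
      using ln_realpow[of 2 2] ln_2_less_1 by simp
    have "ln (v\<^sup>2) \<le> ln (v\<^sup>2 / V)"
    proof (subst ln_le_cancel_iff)
      show "0 < v\<^sup>2" using v1 by linarith
      then show "0 < v\<^sup>2 / V" using V(1) by (rule divide_pos_pos)
      show "v\<^sup>2 \<le> v\<^sup>2 / V"
        using V v1 mult_right_mono[of V 1 "v\<^sup>2"] by (simp add: pos_le_divide_eq mult.commute)
    qed
    moreover have "0 \<le> ln (v\<^sup>2)" using v1 by simp
    ultimately have L: "ln (4 * v\<^sup>2) \<le> 2 + max 0 (ln (v\<^sup>2 / V))" "0 \<le> ln (4 * v\<^sup>2)"
    proof -
      have "ln (4 * v\<^sup>2) = ln 4 + ln (v\<^sup>2)" using v1 by (intro ln_mult_pos) auto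
      with \<open>ln (v\<^sup>2) \<le> _\<close> \<open>0 \<le> ln (v\<^sup>2)\<close> l4 show "ln (4 * v\<^sup>2) \<le> 2 + max 0 (ln (v\<^sup>2 / V))" "0 \<le> ln (4 * v\<^sup>2)"
        by auto
    qed
    have "y * ln y \<le> 4 * v\<^sup>2 * ln (4 * v\<^sup>2)"
    proof (cases "y \<le> 1")
      case True
      then have "y * ln y \<le> 0" using y by (cases "y = 0") (auto simp: mult_nonneg_nonpos)
      also have "\<dots> \<le> 4 * v\<^sup>2 * ln (4 * v\<^sup>2)" using L by simp
      finally show ?thesis .
    next
      case False
      then have "ln y \<le> ln (4 * v\<^sup>2)" using y by (subst ln_le_cancel_iff) linarith+
      then show ?thesis using False y by (intro mult_mono) auto
    qed
    also have "\<dots> \<le> 4 * v\<^sup>2 * (2 + max 0 (ln (v\<^sup>2 / V)))" using L by (intro mult_left_mono) auto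
    also have "\<dots> = 8 * v\<^sup>2 + 4 * (v\<^sup>2 * max 0 (ln (v\<^sup>2 / V)))" by (simp add: algebra_simps)
    finally have "y * ln y \<le> 8 * v\<^sup>2 + 4 * (v\<^sup>2 * max 0 (ln (v\<^sup>2 / V)))" .
    \<comment> \<open>The additive 1 is absorbed by \<open>v\<^sup>2\<close>, which is at least 1 in
      this case; this turns the coefficient 8 into 9.\<close>
    moreover have "A - y + 1 \<le> 9 * (s + L + V)" if "A \<le> 8 * s + 4 * L" "1 \<le> s" "0 \<le> L" for A s L
      using that y V by (simp add: distrib_left)
    ultimately show ?thesis unfolding Phi using v1 m0 by blast
  qed
qed

lemma Phi_scale:
  assumes "s > 0" shows "Phi (s\<^sup>2) (s * y) = s\<^sup>2 * Phi 1 y"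
  using assms by (simp add: Phi_def power_mult_distrib algebra_simps)

text \<open>Division by the square root of \<open>max (c\<^sup>2) V\<close> makes one argument of
  the maximum equal to 1, which is the alternative required by \<open>Phi_1_le\<close>.\<close>

lemma Phi_le:
  fixes c v V :: real
  assumes "V > 0"
  shows "Phi (max (c\<^sup>2) V) (c + v) \<le> 9 * (v\<^sup>2 + v\<^sup>2 * max 0 (ln (v\<^sup>2 / V)) + V)"
proof -
  define s where "s = sqrt (max (c\<^sup>2) V)"
  have s2: "s\<^sup>2 = max (c\<^sup>2) V" using assms by (simp add: s_def)
  have s: "s > 0" using assms by (simp add: s_def less_max_iff_disj)
  have "Phi (s\<^sup>2) (c + v) = s\<^sup>2 * Phi 1 (c / s + v / s)"
    using Phi_scale[OF s, of "c / s + v / s"] s by (simp add: distrib_left)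
  also have "\<dots> \<le> s\<^sup>2 * (9 * ((v / s)\<^sup>2 + (v / s)\<^sup>2 * max 0 (ln ((v / s)\<^sup>2 / (V / s\<^sup>2))) + V / s\<^sup>2))"
  proof (intro mult_left_mono Phi_1_le)
    show "0 < V / s\<^sup>2" using assms s by simp
    show "(c / s)\<^sup>2 \<le> 1" "V / s\<^sup>2 \<le> 1" "(c / s)\<^sup>2 = 1 \<or> V / s\<^sup>2 = 1"
      unfolding power_divide s2 using assms by (auto simp: max_def divide_le_eq)
  qed auto
  also have "(v / s)\<^sup>2 / (V / s\<^sup>2) = v\<^sup>2 / V" using s by (simp add: power_divide)
  also have "s\<^sup>2 * (9 * ((v / s)\<^sup>2 + (v / s)\<^sup>2 * max 0 (ln (v\<^sup>2 / V)) + V / s\<^sup>2)) = 9 * (v\<^sup>2 + v\<^sup>2 * max 0 (ln (v\<^sup>2 / V)) + V)"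
    using s by (simp add: power_divide distrib_left)
  finally show ?thesis by (simp add: s2)
qed

text \<open>Dividing \<open>u - c\<close> by the square root of \<open>V\<close> gives a function
  with mass and energy at most 1, for which the defective inequality yields a constant; scaling back
  multiplies this constant by \<open>V\<close>, and the defect is gone. Taking for \<open>V\<close>
  any positive bound avoids division by an energy that may be 0.\<close>

lemma smooth_log_Sobolev:
  assumes "\<beta> > 0"
  shows "\<exists>R0 C1 C. 1 / 2 \<le> R0 \<and> R0 < 1 \<and> 1 \<le> C1 \<and> 0 \<le> C \<and> (\<forall>R V (u :: 'a::euclidean_space \<Rightarrow> real) Du.
    R0 \<le> R \<and> R < 1 \<and> C1_on (cball 0 R) u Du \<and> 0 < V \<and> C1 * wenergy \<beta> R Du \<le> V \<longrightarrow>
      (\<integral>\<^sup>+x\<in>cball 0 R. ennreal (Phi (max ((ball_average R0 u)\<^sup>2) V) (u x) * gauss_weight \<beta> x) \<partial>lborel) \<le> ennreal (C * V))"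
proof -
  obtain R0 C1 where R0: "1 / 2 \<le> R0" "R0 < 1" "1 \<le> C1"
    and P: "\<And>R (u :: 'a \<Rightarrow> real) Du. R0 \<le> R \<Longrightarrow> R < 1 \<Longrightarrow> C1_on (cball 0 R) u Du \<Longrightarrow>
      wmass \<beta> R (\<lambda>x. u x - ball_average R0 u) \<le> C1 * wenergy \<beta> R Du"
    using weighted_Poincare[OF assms, where 'a='a] by blast
  obtain C2 where C2: "C2 \<ge> 0"
    and L: "\<And>R (w :: 'a \<Rightarrow> real) Dw. 1 / 2 \<le> R \<Longrightarrow> R < 1 \<Longrightarrow> C1_on (cball 0 R) w Dw \<Longrightarrow> wmass \<beta> R w \<le> 1 \<Longrightarrow>
      (\<integral>\<^sup>+x\<in>cball 0 R. ennreal ((w x)\<^sup>2 * max 0 (ln ((w x)\<^sup>2)) * gauss_weight \<beta> x) \<partial>lborel) \<le> ennreal (C2 * (wenergy \<beta> R Dw + 1))"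
    using defective_log_Sobolev[OF assms, where 'a='a] by blast
  define Fm where "Fm = exp ((real DIM('a))\<^sup>2 / (4 * \<beta>))"
  define m where "m = Fm * measure lborel (cball (0::'a) 1)"
  have m: "m \<ge> 0" by (simp add: m_def Fm_def)
  have mass1: "(\<integral>\<^sup>+x\<in>cball (0::'a) R. ennreal (gauss_weight \<beta> x) \<partial>lborel) \<le> ennreal m" if "R < 1" for R
  proof -
    have "(\<integral>\<^sup>+x\<in>cball (0::'a) R. ennreal (gauss_weight \<beta> x) \<partial>lborel) \<le> (\<integral>\<^sup>+x. ennreal Fm * indicator (cball (0::'a) 1) x \<partial>lborel)"
      using gauss_weight_le[OF assms] that unfolding Fm_def
      by (intro nn_integral_mono) (auto split: split_indicator intro!: ennreal_leI)
    also have "\<dots> = ennreal Fm * emeasure lborel (cball (0::'a) 1)"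
      by (rule nn_integral_cmult_indicator) simp
    also have "\<dots> = ennreal m"
      using emeasure_compact_finite[of "cball (0::'a) 1"]
      by (subst emeasure_eq_ennreal_measure) (auto simp: m_def Fm_def ennreal_mult)
    finally show ?thesis .
  qed
  have "(\<integral>\<^sup>+x\<in>cball 0 R. ennreal (Phi (max ((ball_average R0 u)\<^sup>2) V) (u x) * gauss_weight \<beta> x) \<partial>lborel) \<le> ennreal (9 * (1 + 2 * C2 + m) * V)"
    if R: "R0 \<le> R" "R < 1" and u: "C1_on (cball 0 R) u Du" and V: "0 < V" "C1 * wenergy \<beta> R Du \<le> V"
    for R V and u :: "'a \<Rightarrow> real" and Du
  proof -
    let ?S = "cball (0::'a) R"
    define c where "c = ball_average R0 u"
    define w where "w x = (u x - c) / sqrt V" for x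
    define Dw where "Dw x = (1 / sqrt V) *\<^sub>R Du x" for x
    note [measurable] = C1_onD(4,5)[OF u]
    have [measurable]: "?S \<in> sets borel" by simp
    have "C1_on ?S (\<lambda>x. u x - c) Du"
      using u unfolding C1_on_def by (auto intro!: derivative_eq_intros)
    moreover have "C1_on ?S (\<lambda>x. 1 / sqrt V) (\<lambda>x. 0)"
      unfolding C1_on_def by (auto intro!: derivative_eq_intros)
    ultimately have w: "C1_on ?S w Dw"
      using C1_on_mult[of ?S "\<lambda>x. u x - c" Du "\<lambda>x. 1 / sqrt V" "\<lambda>x. 0"] by (simp add: w_def[abs_def] Dw_def[abs_def])
    note [measurable] = C1_onD(4,5)[OF w]
    have w2: "(w x)\<^sup>2 = (1 / V) * (u x - c)\<^sup>2" for x
      using V by (simp add: w_def power_divide)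
    have "wmass \<beta> R w = (1 / V) * wmass \<beta> R (\<lambda>x. u x - c)"
      unfolding wmass_def w2 by (simp only: mult.assoc set_integral_mult_right)
    also have "\<dots> \<le> (1 / V) * V"
      using P[OF R u] V by (intro mult_left_mono) (auto simp: c_def)
    finally have mass: "wmass \<beta> R w \<le> 1" using V by simp
    have "wenergy \<beta> R Dw = (1 / V) * wenergy \<beta> R Du"
    proof -
      have "((1 - (norm x)\<^sup>2) / 2)\<^sup>2 * (norm (Dw x))\<^sup>2 * gauss_weight \<beta> x = (1 / V) * (((1 - (norm x)\<^sup>2) / 2)\<^sup>2 * (norm (Du x))\<^sup>2 * gauss_weight \<beta> x)" for x
        using V by (simp add: Dw_def power_divide)
      then show ?thesis unfolding wenergy_def by (simp only: set_integral_mult_right)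
    qed
    also have "\<dots> \<le> (1 / V) * V"
    proof (intro mult_left_mono)
      \<comment> \<open>\<open>1 \<le> C1\<close> makes \<open>V\<close> a bound for the energy
        itself, in addition to the mass of \<open>u - c\<close>.\<close>
      have "1 * wenergy \<beta> R Du \<le> C1 * wenergy \<beta> R Du"
        using R0 by (intro mult_right_mono wenergy_nonneg) auto
      then show "wenergy \<beta> R Du \<le> V" using V by simp
    qed (use V in auto)
    finally have en: "wenergy \<beta> R Dw \<le> 1" using V by simp
    have "(\<integral>\<^sup>+x\<in>?S. ennreal ((w x)\<^sup>2 * max 0 (ln ((w x)\<^sup>2)) * gauss_weight \<beta> x) \<partial>lborel) \<le> ennreal (C2 * (wenergy \<beta> R Dw + 1))"
      using R0 R by (intro L w mass) auto
    also have "\<dots> \<le> ennreal (2 * C2)"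
      using mult_left_mono[of "wenergy \<beta> R Dw + 1" 2 C2] en C2 by (intro ennreal_leI) auto
    finally have 1: "(\<integral>\<^sup>+x\<in>?S. ennreal ((w x)\<^sup>2 * max 0 (ln ((w x)\<^sup>2)) * gauss_weight \<beta> x) \<partial>lborel) \<le> ennreal (2 * C2)" .
    have Ssub: "?S \<subseteq> ball 0 1" using R by auto
    have 2: "(\<integral>\<^sup>+x\<in>?S. ennreal ((w x)\<^sup>2 * gauss_weight \<beta> x) \<partial>lborel) \<le> ennreal 1"
    proof -
      have "(\<integral>\<^sup>+x\<in>?S. ennreal ((w x)\<^sup>2 * gauss_weight \<beta> x) \<partial>lborel) = ennreal (wmass \<beta> R w)"
        unfolding wmass_def using C1_onD[OF w] continuous_on_subset[OF continuous_on_gauss_weight Ssub]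
        by (intro set_nn_integral_compact_eq continuous_intros) (auto simp: less_imp_le[OF gauss_weight_pos])
      then show ?thesis using mass by (simp add: ennreal_leI del: ennreal_1)
    qed
    have pw: "ennreal (Phi (max (c\<^sup>2) V) (u x) * gauss_weight \<beta> x)
        \<le> ennreal (9 * V) * (ennreal ((w x)\<^sup>2 * gauss_weight \<beta> x) + ennreal ((w x)\<^sup>2 * max 0 (ln ((w x)\<^sup>2)) * gauss_weight \<beta> x) + ennreal (gauss_weight \<beta> x))" for x
    proof -
      have "(u x - c)\<^sup>2 = V * (w x)\<^sup>2" "(u x - c)\<^sup>2 / V = (w x)\<^sup>2" using V by (auto simp: w2)
      then have "Phi (max (c\<^sup>2) V) (u x) \<le> 9 * (V * (w x)\<^sup>2 + V * (w x)\<^sup>2 * max 0 (ln ((w x)\<^sup>2)) + V)"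
        using Phi_le[OF V(1), of c "u x - c"] by simp
      from mult_right_mono[OF this less_imp_le[OF gauss_weight_pos]]
      have "Phi (max (c\<^sup>2) V) (u x) * gauss_weight \<beta> x \<le> 9 * (V * (w x)\<^sup>2 + V * (w x)\<^sup>2 * max 0 (ln ((w x)\<^sup>2)) + V) * gauss_weight \<beta> x" .
      also have "\<dots> = 9 * V * ((w x)\<^sup>2 * gauss_weight \<beta> x + (w x)\<^sup>2 * max 0 (ln ((w x)\<^sup>2)) * gauss_weight \<beta> x + gauss_weight \<beta> x)"
        by (simp add: algebra_simps)
      finally have "ennreal (Phi (max (c\<^sup>2) V) (u x) * gauss_weight \<beta> x)
        \<le> ennreal (9 * V * ((w x)\<^sup>2 * gauss_weight \<beta> x + (w x)\<^sup>2 * max 0 (ln ((w x)\<^sup>2)) * gauss_weight \<beta> x + gauss_weight \<beta> x))"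
        by (rule ennreal_leI)
      also have "\<dots> = ennreal (9 * V) * (ennreal ((w x)\<^sup>2 * gauss_weight \<beta> x) + ennreal ((w x)\<^sup>2 * max 0 (ln ((w x)\<^sup>2)) * gauss_weight \<beta> x) + ennreal (gauss_weight \<beta> x))"
        using V less_imp_le[OF gauss_weight_pos, of \<beta> x]
        by (subst ennreal_mult) (auto simp: ennreal_plus intro!: add_nonneg_nonneg mult_nonneg_nonneg)
      finally show ?thesis .
    qed
    have "(\<integral>\<^sup>+x\<in>?S. ennreal (Phi (max (c\<^sup>2) V) (u x) * gauss_weight \<beta> x) \<partial>lborel)
       \<le> (\<integral>\<^sup>+x. ennreal (9 * V) * (ennreal ((w x)\<^sup>2 * gauss_weight \<beta> x) * indicator ?S x
          + ennreal ((w x)\<^sup>2 * max 0 (ln ((w x)\<^sup>2)) * gauss_weight \<beta> x) * indicator ?S x + ennreal (gauss_weight \<beta> x) * indicator ?S x) \<partial>lborel)"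
      using pw by (intro nn_integral_mono) (auto split: split_indicator)
    also have "\<dots> = ennreal (9 * V) * ((\<integral>\<^sup>+x\<in>?S. ennreal ((w x)\<^sup>2 * gauss_weight \<beta> x) \<partial>lborel)
        + (\<integral>\<^sup>+x\<in>?S. ennreal ((w x)\<^sup>2 * max 0 (ln ((w x)\<^sup>2)) * gauss_weight \<beta> x) \<partial>lborel) + (\<integral>\<^sup>+x\<in>?S. ennreal (gauss_weight \<beta> x) \<partial>lborel))"
      by (simp add: nn_integral_cmult nn_integral_add)
    also have "\<dots> \<le> ennreal (9 * V) * (ennreal 1 + ennreal (2 * C2) + ennreal m)"
      using R by (intro mult_left_mono add_mono 1 2 mass1) auto
    also have "\<dots> = ennreal (9 * (1 + 2 * C2 + m) * V)"
      using V C2 m by (simp add: ennreal_plus[symmetric] ennreal_mult[symmetric] mult_ac del: ennreal_plus ennreal_1)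
    finally show ?thesis by (simp add: c_def)
  qed
  moreover have "0 \<le> 9 * (1 + 2 * C2 + m)" using C2 m by simp
  ultimately show ?thesis using R0 by blast
qed

section \<open>Mollification\<close>

text \<open>A compact \<open>K\<close> inside \<open>A\<close> and an open \<open>U\<close> around
  \<open>A\<close> leave a gap \<open>U - K\<close> of measure at most \<open>e / 2\<close>. A
  translation so short that it moves \<open>K\<close> within \<open>U\<close> changes the indicator
  only where the point or its translate lies in the gap.\<close>

lemma L1_translation_indicator:
  fixes A :: "'a::euclidean_space set"
  assumes A: "A \<in> sets borel" "emeasure lborel A < \<infinity>" and "e > 0"
  shows "\<exists>d>0. \<forall>v. norm v < d \<longrightarrow> (\<integral>\<^sup>+x. ennreal \<bar>indicator A (v + x) - indicator A x\<bar> \<partial>lborel) \<le> ennreal e"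
proof -
  have e4: "0 < e / 4" using \<open>e > 0\<close> by simp
  have fin: "emeasure lborel A \<noteq> \<infinity>" using A by simp
  obtain K where K: "K \<subseteq> A" "compact K" "emeasure lborel A < emeasure lborel K + ennreal (e / 4)"
  proof (cases "emeasure lborel A = 0")
    case True
    then show ?thesis using that[of "{}"] e4 by simp
  next
    case False
    \<comment> \<open>Restriction to \<open>A\<close> makes the measure finite, as
      \<open>inner_regular\<close> demands.\<close>
    let ?M = "density lborel (indicator A)"
    have M: "emeasure ?M B = emeasure lborel (A \<inter> B)" if "B \<in> sets borel" for B
      using A that by (subst emeasure_density) (auto simp: indicator_inter_arith[symmetric])
    have "emeasure ?M A = (SUP K \<in> {K. K \<subseteq> A \<and> compact K}. emeasure ?M K)"
      using A by (intro inner_regular) (auto simp: M)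
    then have "emeasure lborel A = (SUP K \<in> {K. K \<subseteq> A \<and> compact K}. emeasure ?M K)"
      using A by (simp add: M)
    moreover have "emeasure lborel A - ennreal (e / 4) < emeasure lborel A"
      using e4 False fin by (cases "emeasure lborel A") (auto simp: ennreal_minus intro!: ennreal_lessI)
    ultimately obtain K where K: "K \<subseteq> A" "compact K" "emeasure lborel A - ennreal (e / 4) < emeasure ?M K"
      by (auto simp: less_SUP_iff)
    have "emeasure ?M K = emeasure lborel K"
      using K by (subst M) (auto simp: borel_compact Int_absorb1)
    then have less: "emeasure lborel A - ennreal (e / 4) < emeasure lborel K" using K(3) by simp
    obtain a where a: "emeasure lborel A = ennreal a" "0 \<le> a" using fin by (cases "emeasure lborel A") auto
    obtain k where k: "emeasure lborel K = ennreal k" "0 \<le> k"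
      using emeasure_compact_finite[OF K(2)] by (cases "emeasure lborel K") auto
    have "a - e / 4 < k"
      using less e4 unfolding a k by (simp add: ennreal_minus ennreal_less_iff) (smt (verit) k(2) ennreal_less_iff)
    then have "ennreal a < ennreal (k + e / 4)" using a by (subst ennreal_less_iff) auto
    then have "emeasure lborel A < emeasure lborel K + ennreal (e / 4)"
      unfolding a k using k e4 by simp
    then show ?thesis using that K by blast
  qed
  obtain U where U: "open U" "A \<subseteq> U" "emeasure lebesgue (U - A) < ennreal (e / 4)"
    using sets_lebesgue_outer_open[of A, OF _ e4] A by auto
  have [measurable]: "A \<in> sets borel" "K \<in> sets borel" "U \<in> sets borel"
    using A K U by (auto simp: borel_compact)
  obtain d where d: "d > 0" "(\<Union>x\<in>K. ball x d) \<subseteq> U"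
    using compact_subset_open_imp_ball_epsilon_subset[OF K(2) U(1)] K U by blast
  have AK: "emeasure lborel (A - K) \<le> ennreal (e / 4)"
  proof -
    have "emeasure lborel K \<noteq> \<infinity>" using emeasure_compact_finite[OF K(2)] by simp
    then show ?thesis
      using K fin by (subst emeasure_Diff) (auto simp: ennreal_minus_le_iff add.commute)
  qed
  have UA: "emeasure lborel (U - A) \<le> ennreal (e / 4)"
    using U(3) by simp
  have UK: "(\<integral>\<^sup>+x. indicator (U - K) x \<partial>lborel) \<le> ennreal (e / 2)"
  proof -
    have "U - K = (U - A) \<union> (A - K)" using K U by auto
    then have "emeasure lborel (U - K) \<le> emeasure lborel (U - A) + emeasure lborel (A - K)"
      by (metis emeasure_subadditive measurable_lborel2 sets.Diff \<open>A \<in> sets borel\<close> \<open>K \<in> sets borel\<close> \<open>U \<in> sets borel\<close> sets_lborel)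
    also have "\<dots> \<le> ennreal (e / 4) + ennreal (e / 4)" by (intro add_mono AK UA)
    also have "\<dots> = ennreal (e / 2)" using e4 by (simp add: ennreal_plus[symmetric] del: ennreal_plus)
    finally show ?thesis by simp
  qed
  have "(\<integral>\<^sup>+x. ennreal \<bar>indicator A (v + x) - indicator A x\<bar> \<partial>lborel) \<le> ennreal e" if v: "norm v < d" for v
  proof -
    have in_U: "x + w \<in> U" if "x \<in> K" "norm w < d" for x w
      using d(2) that by (force simp: dist_norm)
    have "(\<integral>\<^sup>+x. ennreal \<bar>indicator A (v + x) - indicator A x\<bar> \<partial>lborel)
        \<le> (\<integral>\<^sup>+x. indicator (U - K) (v + 1 *\<^sub>R x) + indicator (U - K) x \<partial>lborel)"
    proof (intro nn_integral_mono)
      fix x :: 'a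
      have "x \<in> K \<Longrightarrow> v + x \<in> U" using in_U[of x v] v by (simp add: add.commute)
      moreover have "v + x \<in> K \<Longrightarrow> x \<in> U" using in_U[of "v + x" "- v"] v by simp
      ultimately show "ennreal \<bar>indicator A (v + x) - indicator A x\<bar> \<le> indicator (U - K) (v + 1 *\<^sub>R x) + indicator (U - K) x"
        using K U by (auto split: split_indicator)
    qed
    also have "\<dots> = (\<integral>\<^sup>+x. indicator (U - K) (v + 1 *\<^sub>R x) \<partial>lborel) + (\<integral>\<^sup>+x. indicator (U - K) x \<partial>lborel)"
      by (rule nn_integral_add) measurable
    also have "(\<integral>\<^sup>+x. indicator (U - K) (v + 1 *\<^sub>R x) \<partial>lborel) = (\<integral>\<^sup>+x. indicator (U - K) x \<partial>lborel)"
      by (subst nn_integral_lborel_affine) auto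
    also have "\<dots> + \<dots> \<le> ennreal (e / 2) + ennreal (e / 2)"
      by (intro add_mono UK)
    also have "\<dots> = ennreal e" using \<open>e > 0\<close> by (simp add: ennreal_plus[symmetric] del: ennreal_plus)
    finally show ?thesis .
  qed
  then show ?thesis using d(1) by blast
qed

text \<open>Indicators and sums give the simple functions. The limit case passes through an
  approximant \<open>s n\<close>, whose L1 error enters twice, by translation invariance of the
  integral.\<close>

lemma L1_translation_continuous:
  fixes f :: "'a::euclidean_space \<Rightarrow> real"
  assumes "integrable lborel f"
  shows "\<forall>e>0. \<exists>d>0. \<forall>v. norm v < d \<longrightarrow> (\<integral>\<^sup>+x. ennreal \<bar>f (v + x) - f x\<bar> \<partial>lborel) \<le> ennreal e"
  using assms
proof (induction rule: integrable_induct)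
  case (base A c)
  show ?case
  proof (intro allI impI)
    fix e :: real assume "e > 0"
    then have "e / (\<bar>c\<bar> + 1) > 0" by simp
    from L1_translation_indicator[OF _ _ this, of A] base
    obtain d where d: "d > 0" "\<And>v. norm v < d \<Longrightarrow> (\<integral>\<^sup>+x. ennreal \<bar>indicator A (v + x) - indicator A x\<bar> \<partial>lborel) \<le> ennreal (e / (\<bar>c\<bar> + 1))"
      by auto
    note [measurable] = base(1)[simplified]
    have "(\<integral>\<^sup>+x. ennreal \<bar>indicator A (v + x) *\<^sub>R c - indicator A x *\<^sub>R c\<bar> \<partial>lborel) \<le> ennreal e" if "norm v < d" for v
    proof -
      have "(\<integral>\<^sup>+x. ennreal \<bar>indicator A (v + x) *\<^sub>R c - indicator A x *\<^sub>R c\<bar> \<partial>lborel)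
          = (\<integral>\<^sup>+x. ennreal \<bar>c\<bar> * ennreal \<bar>indicator A (v + x) - indicator A x\<bar> \<partial>lborel)"
        by (intro nn_integral_cong) (auto simp: ennreal_mult[symmetric] abs_mult[symmetric] algebra_simps)
      also have "\<dots> = ennreal \<bar>c\<bar> * (\<integral>\<^sup>+x. ennreal \<bar>indicator A (v + x) - indicator A x\<bar> \<partial>lborel)"
        by (rule nn_integral_cmult) measurable
      also have "\<dots> \<le> ennreal \<bar>c\<bar> * ennreal (e / (\<bar>c\<bar> + 1))"
        by (intro mult_left_mono d that) auto
      also have "\<dots> \<le> ennreal e"
        using \<open>e > 0\<close> by (subst ennreal_mult[symmetric]) (auto intro!: ennreal_leI simp: field_simps)
      finally show ?thesis .
    qed
    then show "\<exists>d>0. \<forall>v. norm v < d \<longrightarrow> (\<integral>\<^sup>+x. ennreal \<bar>indicator A (v + x) *\<^sub>R c - indicator A x *\<^sub>R c\<bar> \<partial>lborel) \<le> ennreal e"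
      using d(1) by blast
  qed
next
  case (add f g)
  have [measurable]: "g \<in> borel_measurable borel" "f \<in> borel_measurable borel"
    using add.hyps by (auto dest: borel_measurable_integrable)
  show ?case
  proof (intro allI impI)
    fix e :: real assume e: "e > 0"
    from add.IH(1)[rule_format, of "e / 2"] e obtain d1 where d1: "d1 > 0"
      "\<And>v. norm v < d1 \<Longrightarrow> (\<integral>\<^sup>+x. ennreal \<bar>f (v + x) - f x\<bar> \<partial>lborel) \<le> ennreal (e / 2)" by auto
    from add.IH(2)[rule_format, of "e / 2"] e obtain d2 where d2: "d2 > 0"
      "\<And>v. norm v < d2 \<Longrightarrow> (\<integral>\<^sup>+x. ennreal \<bar>g (v + x) - g x\<bar> \<partial>lborel) \<le> ennreal (e / 2)" by auto
    have "(\<integral>\<^sup>+x. ennreal \<bar>(f (v + x) + g (v + x)) - (f x + g x)\<bar> \<partial>lborel) \<le> ennreal e" if "norm v < min d1 d2" for v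
    proof -
      have "(\<integral>\<^sup>+x. ennreal \<bar>(f (v + x) + g (v + x)) - (f x + g x)\<bar> \<partial>lborel)
          \<le> (\<integral>\<^sup>+x. ennreal \<bar>f (v + x) - f x\<bar> + ennreal \<bar>g (v + x) - g x\<bar> \<partial>lborel)"
        by (intro nn_integral_mono) (auto simp: ennreal_plus[symmetric] simp del: ennreal_plus intro!: ennreal_leI)
      also have "\<dots> = (\<integral>\<^sup>+x. ennreal \<bar>f (v + x) - f x\<bar> \<partial>lborel) + (\<integral>\<^sup>+x. ennreal \<bar>g (v + x) - g x\<bar> \<partial>lborel)"
        by (rule nn_integral_add) measurable
      also have "\<dots> \<le> ennreal (e / 2) + ennreal (e / 2)"
        using that by (intro add_mono d1 d2) auto
      also have "\<dots> = ennreal e" using e by (simp add: ennreal_plus[symmetric] del: ennreal_plus)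
      finally show ?thesis .
    qed
    then show "\<exists>d>0. \<forall>v. norm v < d \<longrightarrow> (\<integral>\<^sup>+x. ennreal \<bar>(f (v + x) + g (v + x)) - (f x + g x)\<bar> \<partial>lborel) \<le> ennreal e"
      using d1(1) d2(1) by (intro exI[of _ "min d1 d2"]) auto
  qed
next
  case (lim f s)
  have [measurable]: "f \<in> borel_measurable borel" "s i \<in> borel_measurable borel" for i
    using lim.hyps by (auto dest: borel_measurable_integrable)
  show ?case
  proof (intro allI impI)
    fix e :: real assume e: "e > 0"
    have "(\<lambda>n. \<integral>\<^sup>+x. norm (f x - s n x) \<partial>lborel) \<longlonglongrightarrow> 0"
    proof (rule nn_integral_dominated_convergence_norm[where w="\<lambda>x. 2 * norm (f x)"])
      show "(\<integral>\<^sup>+x. ennreal (2 * norm (f x)) \<partial>lborel) < \<infinity>"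
        using lim.hyps(4) by (simp add: integrable_iff_bounded ennreal_mult nn_integral_cmult ennreal_mult_less_top)
    qed (use lim.hyps in auto)
    then have "eventually (\<lambda>n. (\<integral>\<^sup>+x. norm (f x - s n x) \<partial>lborel) < ennreal (e / 3)) sequentially"
      using e by (intro order_tendstoD) auto
    then obtain n where n: "(\<integral>\<^sup>+x. ennreal \<bar>s n x - f x\<bar> \<partial>lborel) < ennreal (e / 3)"
      by (auto simp: eventually_sequentially abs_minus_commute)
    from lim.IH[rule_format, of "e / 3" n] e obtain d where d: "d > 0"
      "\<And>v. norm v < d \<Longrightarrow> (\<integral>\<^sup>+x. ennreal \<bar>s n (v + x) - s n x\<bar> \<partial>lborel) \<le> ennreal (e / 3)" by auto
    have "(\<integral>\<^sup>+x. ennreal \<bar>f (v + x) - f x\<bar> \<partial>lborel) \<le> ennreal e" if v: "norm v < d" for v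
    proof -
      have "(\<integral>\<^sup>+x. ennreal \<bar>f (v + x) - f x\<bar> \<partial>lborel)
        \<le> (\<integral>\<^sup>+x. ennreal \<bar>s n (v + 1 *\<^sub>R x) - f (v + 1 *\<^sub>R x)\<bar> + (ennreal \<bar>s n (v + x) - s n x\<bar> + ennreal \<bar>s n x - f x\<bar>) \<partial>lborel)"
        by (intro nn_integral_mono) (auto simp: ennreal_plus[symmetric] simp del: ennreal_plus intro!: ennreal_leI)
      also have "\<dots> = (\<integral>\<^sup>+x. ennreal \<bar>s n (v + 1 *\<^sub>R x) - f (v + 1 *\<^sub>R x)\<bar> \<partial>lborel)
          + ((\<integral>\<^sup>+x. ennreal \<bar>s n (v + x) - s n x\<bar> \<partial>lborel) + (\<integral>\<^sup>+x. ennreal \<bar>s n x - f x\<bar> \<partial>lborel))"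
        by (subst nn_integral_add, simp, simp, subst nn_integral_add, simp_all)
      also have "(\<integral>\<^sup>+x. ennreal \<bar>s n (v + 1 *\<^sub>R x) - f (v + 1 *\<^sub>R x)\<bar> \<partial>lborel) = (\<integral>\<^sup>+x. ennreal \<bar>s n x - f x\<bar> \<partial>lborel)"
        by (subst nn_integral_lborel_affine[where f="\<lambda>x. ennreal \<bar>s n x - f x\<bar>"]) auto
      also have "\<dots> + ((\<integral>\<^sup>+x. ennreal \<bar>s n (v + x) - s n x\<bar> \<partial>lborel) + \<dots>) \<le> ennreal (e / 3) + (ennreal (e / 3) + ennreal (e / 3))"
        by (intro add_mono less_imp_le[OF n] d v)
      also have "\<dots> = ennreal e" using e by (simp add: ennreal_plus[symmetric] del: ennreal_plus)
      finally show ?thesis .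
    qed
    then show "\<exists>d>0. \<forall>v. norm v < d \<longrightarrow> (\<integral>\<^sup>+x. ennreal \<bar>f (v + x) - f x\<bar> \<partial>lborel) \<le> ennreal e"
      using d(1) by blast
  qed
qed

section \<open>Smooth bump functions\<close>

text \<open>\<open>m = 0\<close> is the classical flat function. The power of \<open>t\<close> in
  the denominator makes the linear span of the family closed under differentiation.\<close>

definition theta :: "nat \<Rightarrow> real \<Rightarrow> real" where
  "theta m t = (if t \<le> 0 then 0 else exp (- 1 / t) / t ^ m)"

lemma theta_nonneg: "0 \<le> theta m t"
  by (simp add: theta_def)

text \<open>\<open>exp (1 / t)\<close> dominates the term of degree \<open>Suc m\<close> of its
  series. The resulting linear bound expresses flatness at 0 for every \<open>m\<close> at
  once.\<close>

lemma theta_le: "theta m t \<le> fact (Suc m) * \<bar>t\<bar>"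
proof (cases "t \<le> 0")
  case False
  have power_over_fact_le_exp: "x ^ n / fact n \<le> exp x" if "0 \<le> x" for x :: real and n
    using that sum_le_suminf[of "\<lambda>n. x ^ n /\<^sub>R fact n" "{n}"] summable_exp_generic[of x]
    by (simp add: exp_def divide_inverse mult.commute)
  have "(1 / t) ^ Suc m / fact (Suc m) \<le> exp (1 / t)"
    using False by (intro power_over_fact_le_exp) auto
  moreover have "(1 / t) ^ Suc m / fact (Suc m) = 1 / (fact (Suc m) * t ^ Suc m)"
    by (simp only: power_one_over divide_divide_eq_left mult.commute)
  ultimately have "1 \<le> exp (1 / t) * (fact (Suc m) * t ^ Suc m)"
    using False mult_pos_pos[of "fact (Suc m)" "t ^ Suc m"] by (simp only: pos_divide_le_eq fact_gt_zero zero_less_power not_le)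
  then have "1 \<le> exp (1 / t) * fact (Suc m) * t ^ Suc m"
    by (simp only: mult.assoc)
  then have "exp (- (1 / t)) * 1 \<le> exp (- (1 / t)) * (exp (1 / t) * fact (Suc m) * t ^ Suc m)"
    by (intro mult_left_mono) auto
  also have "\<dots> = fact (Suc m) * t * t ^ m"
    by (simp add: exp_minus mult.assoc[symmetric])
  finally show ?thesis
    using False by (simp add: theta_def pos_divide_le_eq)
qed (auto simp: theta_def mult_nonneg_nonpos simp del: fact_Suc)

lemma theta_has_derivative:
  "(theta m has_real_derivative (theta (m + 2) t - m * theta (Suc m) t)) (at t)"
proof -
  consider "t < 0" | "t = 0" | "t > 0" by linarith
  then show ?thesis
  proof cases
    case 1
    have "((\<lambda>_. 0) has_real_derivative 0) (at t)" by simp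
    moreover have "eventually (\<lambda>s. theta m s = 0) (nhds t)"
      using 1 by (intro eventually_nhds[THEN iffD2] exI[of _ "{..<0}"]) (auto simp: theta_def)
    ultimately have "(theta m has_real_derivative 0) (at t)"
      by (subst DERIV_cong_ev[OF refl _ refl]) auto
    then show ?thesis using 1 by (simp add: theta_def)
  next
    case 2
    \<comment> \<open>The difference quotient of \<open>theta m\<close> at 0 is
      \<open>theta (Suc m)\<close>, which tends to 0 by \<open>theta_le\<close>.\<close>
    have "((\<lambda>h. (theta m (0 + h) - theta m 0) / h) \<longlongrightarrow> 0) (at 0)"
    proof (rule Lim_null_comparison)
      show "((\<lambda>h::real. fact (Suc (Suc m)) * \<bar>h\<bar>) \<longlongrightarrow> 0) (at 0)"
        by (intro tendsto_eq_intros) auto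
      have "norm ((theta m (0 + h) - theta m 0) / h) \<le> fact (Suc (Suc m)) * \<bar>h\<bar>" if "h \<noteq> 0" for h
      proof -
        have "norm ((theta m (0 + h) - theta m 0) / h) = theta (Suc m) h"
          using that by (auto simp: theta_def)
        then show ?thesis using theta_le[of "Suc m" h] by simp
      qed
      then show "eventually (\<lambda>h. norm ((theta m (0 + h) - theta m 0) / h) \<le> fact (Suc (Suc m)) * \<bar>h\<bar>) (at 0)"
        by (auto simp: eventually_at_filter)
    qed
    then have "(theta m has_real_derivative 0) (at 0)" by (simp add: DERIV_def)
    then show ?thesis using 2 by (simp add: theta_def)
  next
    case 3
    have "((\<lambda>s. exp (- 1 / s) / s ^ m) has_real_derivative (theta (m + 2) t - m * theta (Suc m) t)) (at t)"
    proof (cases m)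
      case 0
      then show ?thesis using 3 by (auto intro!: derivative_eq_intros simp: theta_def power2_eq_square field_simps)
    next
      case (Suc n)
      then show ?thesis
      proof -
        have "n = 0 \<or> t ^ n = t * t ^ (n - Suc 0)" by (cases n) auto
        then show ?thesis
          using 3 Suc by (auto intro!: derivative_eq_intros simp: theta_def power2_eq_square field_simps)
      qed
    qed
    moreover have "eventually (\<lambda>s. theta m s = exp (- 1 / s) / s ^ m) (nhds t)"
      using 3 by (intro eventually_nhds[THEN iffD2] exI[of _ "{0<..}"]) (auto simp: theta_def)
    ultimately show ?thesis
      by (subst DERIV_cong_ev[OF refl _ refl]) auto
  qed
qed

text \<open>An algebra of smooth functions that contains the bumps and is closed under partial derivatives;
  the latter makes \<open>C_k\<close> an easy induction on \<open>k\<close>.\<close>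
inductive smooth_gen :: "('a::euclidean_space \<Rightarrow> real) \<Rightarrow> bool" where
  const: "smooth_gen (\<lambda>x. c)"
| inner: "smooth_gen (\<lambda>x. x \<bullet> b)"
| bump: "smooth_gen (\<lambda>x. theta m (r - (norm (x - a))\<^sup>2))"
| add: "smooth_gen f \<Longrightarrow> smooth_gen g \<Longrightarrow> smooth_gen (\<lambda>x. f x + g x)"
| mult: "smooth_gen f \<Longrightarrow> smooth_gen g \<Longrightarrow> smooth_gen (\<lambda>x. f x * g x)"

lemma bump_has_derivative:
  "((\<lambda>x. theta m (r - (norm (x - a))\<^sup>2)) has_derivative
    (\<lambda>v. (theta (m + 2) (r - (norm (x - a))\<^sup>2) - m * theta (Suc m) (r - (norm (x - a))\<^sup>2)) * (- 2 * ((x - a) \<bullet> v)))) (at x)"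
  for x a :: "'a::euclidean_space"
proof -
  have "((\<lambda>x. r - (norm (x - a))\<^sup>2) has_derivative (\<lambda>v. - 2 * ((x - a) \<bullet> v))) (at x)"
    unfolding power2_norm_eq_inner by (auto intro!: derivative_eq_intros simp: inner_commute)
  from has_derivative_compose[OF this theta_has_derivative[unfolded has_field_derivative_def]]
  show ?thesis by simp
qed

lemma smooth_gen_derivative:
  fixes f :: "'a::euclidean_space \<Rightarrow> real"
  assumes "smooth_gen f"
  shows "\<exists>Df. (\<forall>x. (f has_derivative Df x) (at x)) \<and> (\<forall>i. smooth_gen (\<lambda>x. Df x i))"
  using assms
proof induction
  case (const c)
  show ?case by (intro exI[of _ "\<lambda>x v. 0"]) (auto intro: smooth_gen.const)
next
  case (inner b)
  show ?case
    by (intro exI[of _ "\<lambda>x v. v \<bullet> b"]) (auto intro: smooth_gen.const intro!: derivative_eq_intros)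
next
  case (bump m r a)
  have "smooth_gen (\<lambda>x. (theta (m + 2) (r - (norm (x - a))\<^sup>2) + (- real m) * theta (Suc m) (r - (norm (x - a))\<^sup>2)) * ((- 2) * (x \<bullet> i + (- (a \<bullet> i)))))" for i
    by (intro smooth_gen.intros)
  then have "smooth_gen (\<lambda>x. (theta (m + 2) (r - (norm (x - a))\<^sup>2) - m * theta (Suc m) (r - (norm (x - a))\<^sup>2)) * (- 2 * ((x - a) \<bullet> i)))" for i
    by (simp add: inner_diff_left)
  then show ?case
    by (intro exI[of _ "\<lambda>x v. (theta (m + 2) (r - (norm (x - a))\<^sup>2) - m * theta (Suc m) (r - (norm (x - a))\<^sup>2)) * (- 2 * ((x - a) \<bullet> v))"]
      conjI allI bump_has_derivative)
next
  case (add f g)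
  then obtain Df Dg where "\<And>x. (f has_derivative Df x) (at x)" "\<And>i. smooth_gen (\<lambda>x. Df x i)"
    "\<And>x. (g has_derivative Dg x) (at x)" "\<And>i. smooth_gen (\<lambda>x. Dg x i)" by blast
  then show ?case
    by (intro exI[of _ "\<lambda>x v. Df x v + Dg x v"]) (auto intro: smooth_gen.add has_derivative_add)
next
  case (mult f g)
  then obtain Df Dg where D: "\<And>x. (f has_derivative Df x) (at x)" "\<And>i. smooth_gen (\<lambda>x. Df x i)"
    "\<And>x. (g has_derivative Dg x) (at x)" "\<And>i. smooth_gen (\<lambda>x. Dg x i)" by blast
  show ?case
    by (intro exI[of _ "\<lambda>x v. f x * Dg x v + Df x v * g x"] conjI allI has_derivative_mult
      smooth_gen.add smooth_gen.mult mult.hyps D)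
qed

lemma smooth_gen_C_k: "smooth_gen f \<Longrightarrow> C_k k f"
proof (induction k arbitrary: f)
  case 0
  then obtain Df where "\<And>x. (f has_derivative Df x) (at x)" using smooth_gen_derivative by blast
  then show ?case by (auto intro!: continuous_at_imp_continuous_on has_derivative_continuous)
next
  case (Suc k)
  then obtain Df where D: "\<And>x. (f has_derivative Df x) (at x)" "\<And>i. smooth_gen (\<lambda>x. Df x i)"
    using smooth_gen_derivative by blast
  have "frechet_derivative f (at x) = Df x" for x
    using frechet_derivative_at[OF D(1)] by simp
  then show ?case
    using Suc.IH[OF D(2)] D(1) by (auto simp: differentiable_on_def differentiable_def intro: has_derivative_at_withinI)
qed

section \<open>Convolution with a mollifier\<close>

text \<open>Convolution is developed for a C1 kernel; that the translates of \<open>\<phi>\<close>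
  are test functions is a separate premise at the point where the weak gradient is tested. Symmetry
  lets \<open>\<phi> (x - y)\<close> be treated as a shifted kernel in either variable.\<close>

locale mollifier =
  fixes \<phi> :: "'a::euclidean_space \<Rightarrow> real" and D\<phi> :: "'a \<Rightarrow> 'a" and e :: real
  assumes nonneg: "\<phi> y \<ge> 0" and supp: "norm y \<ge> e \<Longrightarrow> \<phi> y = 0" and Dsupp: "norm y \<ge> e \<Longrightarrow> D\<phi> y = 0"
    and sym: "\<phi> (- y) = \<phi> y" and der: "(\<phi> has_derivative (\<lambda>v. D\<phi> y \<bullet> v)) (at y)"
    and cD: "continuous_on UNIV D\<phi>" and mass: "(\<integral>\<^sup>+y. ennreal (\<phi> y) \<partial>lborel) = 1"

lemma mollifier_exists:
  fixes e :: real
  assumes "e > 0"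
  obtains \<phi> :: "'a::euclidean_space \<Rightarrow> real" and D\<phi> :: "'a \<Rightarrow> 'a"
  where "mollifier \<phi> D\<phi> e" "\<And>x S. cball x e \<subseteq> S \<Longrightarrow> test_function S (\<lambda>y. \<phi> (x - y))"
proof -
  define b where "b y = theta 0 (e\<^sup>2 - (norm y)\<^sup>2)" for y :: 'a
  define Db where "Db y = (theta 2 (e\<^sup>2 - (norm y)\<^sup>2) * (- 2)) *\<^sub>R y" for y :: 'a
  have der: "(b has_derivative (\<lambda>v. Db y \<bullet> v)) (at y)" for y
    using bump_has_derivative[of 0 "e\<^sup>2" 0 y] by (simp add: b_def[abs_def] Db_def mult.assoc numeral_2_eq_2)
  have sub: "e\<^sup>2 - (norm y)\<^sup>2 \<le> 0" if "norm y \<ge> e" for y :: 'a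
    using power_mono[OF that, of 2] \<open>e > 0\<close> by simp
  have b0: "b y = 0" "Db y = 0" if "norm y \<ge> e" for y
    using sub[OF that] by (auto simp: b_def Db_def theta_def)
  have bn: "b y \<ge> 0" for y by (simp add: b_def theta_nonneg)
  have cb: "continuous_on UNIV b"
    using der by (auto intro!: continuous_at_imp_continuous_on has_derivative_continuous)
  have cth: "continuous_on UNIV (theta m)" for m
    using theta_has_derivative by (auto intro!: continuous_at_imp_continuous_on DERIV_isCont)
  have cDb: "continuous_on UNIV Db"
    unfolding Db_def by (intro continuous_intros continuous_on_compose2[OF cth]) auto
  have bi: "integrable lborel b"
  proof -
    have "integrable lborel (\<lambda>y. indicator (cball 0 e) y *\<^sub>R b y)"
      by (intro borel_integrable_compact continuous_on_subset[OF cb]) auto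
    moreover have "(\<lambda>y. indicator (cball 0 e) y *\<^sub>R b y) = b"
      using b0 by (auto simp: fun_eq_iff split: split_indicator)
    ultimately show ?thesis by simp
  qed
  define Z where "Z = (LINT y|lborel. b y)"
  have Z: "Z > 0"
  proof -
    have "Z \<ge> 0" unfolding Z_def using bn by (intro integral_nonneg_AE) auto
    moreover have "Z \<noteq> 0"
    proof
      assume "Z = 0"
      then have "AE y in lborel. b y = 0"
        unfolding Z_def using integral_nonneg_eq_0_iff_AE[OF bi] bn by auto
      then have "AE y in lborel. y \<notin> ball (0::'a) e"
      proof eventually_elim
        case (elim y)
        show ?case
        proof
          assume "y \<in> ball 0 e"
          then have "(norm y)\<^sup>2 < e\<^sup>2" by (intro power_strict_mono) auto
          then show False using elim by (simp add: b_def theta_def)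
        qed
      qed
      then have "emeasure lborel (ball (0::'a) e) = 0"
        by (subst (asm) AE_iff_measurable[OF _ refl]) (auto simp: ball_def)
      then have "measure lborel (ball (0::'a) e) = 0" by (simp add: measure_def)
      then show False using \<open>e > 0\<close> by simp
    qed
    ultimately show ?thesis by simp
  qed
  have M: "mollifier (\<lambda>y. b y / Z) (\<lambda>y. (1 / Z) *\<^sub>R Db y) e"
  proof
    show "((\<lambda>y. b y / Z) has_derivative (\<lambda>v. ((1 / Z) *\<^sub>R Db y) \<bullet> v)) (at y)" for y
      using has_derivative_mult_left[OF der, of "1 / Z"] by (simp add: mult.commute)
    show "b (- y) / Z = b y / Z" for y by (simp add: b_def)
    show "continuous_on UNIV (\<lambda>y. (1 / Z) *\<^sub>R Db y)"
      by (intro continuous_intros cDb)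
    have "(\<integral>\<^sup>+y. ennreal (b y / Z) \<partial>lborel) = ennreal (LINT y|lborel. b y / Z)"
      using bi bn Z by (intro nn_integral_eq_integral) auto
    also have "(LINT y|lborel. b y / Z) = 1" using Z by (simp add: Z_def)
    finally show "(\<integral>\<^sup>+y. ennreal (b y / Z) \<partial>lborel) = 1" by simp
  qed (use bn b0 Z in auto)
  have T: "test_function S (\<lambda>y. b (x - y) / Z)" if S: "cball x e \<subseteq> S" for x S
    unfolding test_function_def
  proof (intro conjI allI)
    have "smooth_gen (\<lambda>y. theta 0 (e\<^sup>2 - (norm (y - x))\<^sup>2) * (1 / Z))"
      by (intro smooth_gen.intros)
    then show "C_k k (\<lambda>y. b (x - y) / Z)" for k
      using smooth_gen_C_k by (simp add: b_def norm_minus_commute)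
    have supp: "{y. b (x - y) / Z \<noteq> 0} \<subseteq> cball x e"
      using b0 by (force simp: dist_norm)
    then have "closure {y. b (x - y) / Z \<noteq> 0} \<subseteq> cball x e"
      by (intro closure_minimal) auto
    then show "closure {y. b (x - y) / Z \<noteq> 0} \<subseteq> S" using S by auto
    show "compact (closure {y. b (x - y) / Z \<noteq> 0})"
      using supp by (auto simp: compact_closure intro: bounded_subset)
  qed
  show ?thesis by (rule that[OF M T])
qed

lemma compact_support_uniformly_continuous:
  fixes f :: "'a::euclidean_space \<Rightarrow> 'b::real_normed_vector"
  assumes f: "continuous_on UNIV f" "\<And>y. norm y \<ge> e \<Longrightarrow> f y = 0" and "\<eta> > 0"
  shows "\<exists>d>0. \<forall>a b. norm (a - b) < d \<longrightarrow> norm (f a - f b) \<le> \<eta>"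
proof -
  have "uniformly_continuous_on (cball 0 (e + 1)) f"
    by (intro compact_uniformly_continuous continuous_on_subset[OF f(1)]) auto
  then obtain d where d: "d > 0" "\<And>a b. a \<in> cball 0 (e + 1) \<Longrightarrow> b \<in> cball 0 (e + 1) \<Longrightarrow> dist a b < d \<Longrightarrow> dist (f a) (f b) < \<eta>"
    unfolding uniformly_continuous_on_def using \<open>\<eta> > 0\<close> by meson
  have "norm (f a - f b) \<le> \<eta>" if ab: "norm (a - b) < min d 1" for a b
  proof (cases "norm a \<ge> e \<and> norm b \<ge> e")
    case True
    then show ?thesis using f(2) \<open>\<eta> > 0\<close> by simp
  next
    case False
    have "norm a \<le> norm b + norm (a - b)" "norm b \<le> norm a + norm (a - b)"
      using norm_triangle_sub[of a b] norm_triangle_sub[of b a] by (auto simp: norm_minus_commute)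
    then have "norm a \<le> e + 1" "norm b \<le> e + 1" using False ab by linarith+
    then show ?thesis using d(2)[of a b] ab by (simp add: dist_norm less_imp_le)
  qed
  then show ?thesis using d(1) by (intro exI[of _ "min d 1"]) auto
qed

lemma compact_support_bounded:
  fixes f :: "'a::euclidean_space \<Rightarrow> 'b::real_normed_vector"
  assumes f: "continuous_on UNIV f" "\<And>y. norm y \<ge> e \<Longrightarrow> f y = 0"
  obtains B where "B \<ge> 0" "\<And>y. norm (f y) \<le> B"
proof -
  have "bounded (f ` cball 0 e)"
    by (intro compact_imp_bounded compact_continuous_image continuous_on_subset[OF f(1)]) auto
  then obtain B where B: "\<And>y. y \<in> cball 0 e \<Longrightarrow> norm (f y) \<le> B"
    by (metis bounded_iff imageI)
  have "norm (f y) \<le> max B 0" for y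
    using B[of y] f(2)[of y] by (cases "norm y \<ge> e") (auto simp: le_max_iff_disj)
  then show ?thesis using that[of "max B 0"] by auto
qed

context mollifier
begin

lemma cont: "continuous_on UNIV \<phi>"
  using der by (auto intro!: continuous_at_imp_continuous_on has_derivative_continuous)

lemma meas[measurable]: "\<phi> \<in> borel_measurable borel" "D\<phi> \<in> borel_measurable borel"
  by (auto intro!: borel_measurable_continuous_onI cont cD)

lemma sym_diff: "\<phi> (x - y) = \<phi> (y - x)"
  using sym[of "x - y"] by simp

text \<open>The estimate is uniform in \<open>a\<close> because \<open>D\<phi>\<close> is uniformly
  continuous. This uniformity is what permits differentiation under the integral against a function
  that is merely integrable.\<close>

lemma linearization:
  assumes "\<eta> > 0"
  shows "\<exists>d>0. \<forall>a v. norm v < d \<longrightarrow> \<bar>\<phi> (a + v) - \<phi> a - D\<phi> a \<bullet> v\<bar> \<le> norm v * \<eta>"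
proof -
  obtain d where d: "d > 0" "\<And>a b. norm (a - b) < d \<Longrightarrow> norm (D\<phi> a - D\<phi> b) \<le> \<eta>"
    using compact_support_uniformly_continuous[OF cD Dsupp assms] by blast
  have "\<bar>\<phi> (a + v) - \<phi> a - D\<phi> a \<bullet> v\<bar> \<le> norm v * \<eta>" if v: "norm v < d" for a v
  proof -
    have "norm (\<phi> (a + v) - \<phi> a - D\<phi> a \<bullet> (a + v - a)) \<le> norm (a + v - a) * \<eta>"
    proof (rule differentiable_bound_linearization[where S="ball a d" and f'="\<lambda>x v. D\<phi> x \<bullet> v"])
      fix t :: real assume t: "t \<in> {0..1}"
      have "norm (t *\<^sub>R v) \<le> 1 * norm v" unfolding norm_scaleR using t by (intro mult_right_mono) auto
      then show "a + t *\<^sub>R (a + v - a) \<in> ball a d" using v by (simp add: dist_norm)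
    next
      fix x assume x: "x \<in> ball a d"
      then have le: "norm (D\<phi> x - D\<phi> a) \<le> \<eta>" by (intro d) (simp add: dist_norm norm_minus_commute)
      show "onorm ((\<bullet>) (D\<phi> x) - (\<bullet>) (D\<phi> a)) \<le> \<eta>"
      proof (rule onorm_le)
        fix w
        have "norm (((\<bullet>) (D\<phi> x) - (\<bullet>) (D\<phi> a)) w) = \<bar>(D\<phi> x - D\<phi> a) \<bullet> w\<bar>"
          by (simp add: inner_diff_left)
        also have "\<dots> \<le> norm (D\<phi> x - D\<phi> a) * norm w" by (rule Cauchy_Schwarz_ineq2)
        also have "\<dots> \<le> \<eta> * norm w" by (intro mult_right_mono le) auto
        finally show "norm (((\<bullet>) (D\<phi> x) - (\<bullet>) (D\<phi> a)) w) \<le> \<eta> * norm w" .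
      qed
    qed (use d(1) der in \<open>auto intro: has_derivative_at_withinI\<close>)
    then show ?thesis by simp
  qed
  then show ?thesis using d(1) by blast
qed

lemma integrable_conv:
  assumes "integrable lborel f"
  shows "integrable lborel (\<lambda>y. f y * \<phi> (x - y))" "integrable lborel (\<lambda>y. f y *\<^sub>R D\<phi> (x - y))"
proof -
  note [measurable] = borel_measurable_integrable[OF assms, simplified]
  obtain B where B: "B \<ge> 0" "\<And>y. norm (\<phi> y) \<le> B" using compact_support_bounded[OF cont supp] by blast
  obtain B' where B': "B' \<ge> 0" "\<And>y. norm (D\<phi> y) \<le> B'" using compact_support_bounded[OF cD Dsupp] by blast
  show "integrable lborel (\<lambda>y. f y * \<phi> (x - y))"
  proof (rule Bochner_Integration.integrable_bound[of _ "\<lambda>y. B * f y"])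
    show "AE y in lborel. norm (f y * \<phi> (x - y)) \<le> norm (B * f y)"
      using B by (intro AE_I2) (simp add: abs_mult mult.commute[of _ "\<bar>f _\<bar>"] mult_left_mono)
  qed (use assms in auto)
  show "integrable lborel (\<lambda>y. f y *\<^sub>R D\<phi> (x - y))"
  proof (rule Bochner_Integration.integrable_bound[of _ "\<lambda>y. B' * f y"])
    show "AE y in lborel. norm (f y *\<^sub>R D\<phi> (x - y)) \<le> norm (B' * f y)"
      using B' by (intro AE_I2) (simp add: abs_mult mult.commute[of _ "\<bar>f _\<bar>"] mult_left_mono)
  qed (use assms in auto)
qed

lemma C1_on_conv:
  assumes f: "integrable lborel f"
  shows "C1_on UNIV (\<lambda>x. LINT y|lborel. f y * \<phi> (x - y)) (\<lambda>x. LINT y|lborel. f y *\<^sub>R D\<phi> (x - y))"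
    (is "C1_on UNIV ?U ?D")
proof -
  \<comment> \<open>The added 1 keeps \<open>M\<close> positive when \<open>f\<close> vanishes
    almost everywhere and leaves room for a strict inequality.\<close>
  define M where "M = (LINT y|lborel. \<bar>f y\<bar>) + 1"
  have M: "M > 0" unfolding M_def by (intro add_nonneg_pos integral_nonneg_AE) auto
  note [measurable] = borel_measurable_integrable[OF f, simplified]
  have Dv: "?D x \<bullet> v = (LINT y|lborel. f y * (D\<phi> (x - y) \<bullet> v))" for x v
    using integral_inner_left[OF integrable_conv(2)[OF f, of x], of v] by simp
  have iDv: "integrable lborel (\<lambda>y. f y * (D\<phi> (x - y) \<bullet> v))" for x v
    using integrable_inner_left[OF integrable_conv(2)[OF f, of x], of v] by simp
  have "(?U has_derivative (\<lambda>v. ?D x \<bullet> v)) (at x)" for x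
    unfolding has_derivative_at_alt
  proof (intro conjI allI impI)
    show "bounded_linear (\<lambda>v. ?D x \<bullet> v)" by (rule bounded_linear_inner_right)
    fix \<epsilon> :: real assume "\<epsilon> > 0"
    with M obtain d where d: "d > 0" "\<And>a v. norm v < d \<Longrightarrow> \<bar>\<phi> (a + v) - \<phi> a - D\<phi> a \<bullet> v\<bar> \<le> norm v * (\<epsilon> / M)"
      using linearization[of "\<epsilon> / M"] by auto
    have "norm (?U z - ?U x - ?D x \<bullet> (z - x)) \<le> \<epsilon> * norm (z - x)" if z: "norm (z - x) < d" for z
    proof -
      have i: "integrable lborel (\<lambda>y. f y * (\<phi> (z - y) - \<phi> (x - y) - D\<phi> (x - y) \<bullet> (z - x)))"
        unfolding right_diff_distrib by (intro Bochner_Integration.integrable_diff integrable_conv f iDv)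
      have "?U z - ?U x - ?D x \<bullet> (z - x) = (LINT y|lborel. f y * (\<phi> (z - y) - \<phi> (x - y) - D\<phi> (x - y) \<bullet> (z - x)))"
        unfolding Dv right_diff_distrib
        by (simp add: integrable_conv f iDv Bochner_Integration.integral_diff Bochner_Integration.integrable_diff)
      also have "norm \<dots> \<le> (LINT y|lborel. norm (f y * (\<phi> (z - y) - \<phi> (x - y) - D\<phi> (x - y) \<bullet> (z - x))))"
        by (rule integral_norm_bound)
      also have "\<dots> \<le> (LINT y|lborel. \<bar>f y\<bar> * (norm (z - x) * (\<epsilon> / M)))"
      proof (intro integral_mono integrable_norm i integrable_mult_left integrable_abs f)
        fix y
        have "z - y = (x - y) + (z - x)" by simp
        then show "norm (f y * (\<phi> (z - y) - \<phi> (x - y) - D\<phi> (x - y) \<bullet> (z - x))) \<le> \<bar>f y\<bar> * (norm (z - x) * (\<epsilon> / M))"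
          unfolding real_norm_def abs_mult using d(2)[OF z, of "x - y"] by (intro mult_left_mono) auto
      qed
      also have "\<dots> = (M - 1) * (norm (z - x) * (\<epsilon> / M))" by (simp add: M_def)
      also have "\<dots> \<le> M * (norm (z - x) * (\<epsilon> / M))" using M \<open>\<epsilon> > 0\<close> by (intro mult_right_mono) auto
      also have "\<dots> = \<epsilon> * norm (z - x)" using M by simp
      finally show ?thesis .
    qed
    then show "\<exists>d>0. \<forall>z. norm (z - x) < d \<longrightarrow> norm (?U z - ?U x - ?D x \<bullet> (z - x)) \<le> \<epsilon> * norm (z - x)"
      using d(1) by blast
  qed
  moreover have cont_D: "continuous_on UNIV ?D"
    unfolding continuous_on_iff
  proof (intro ballI allI impI)
    fix x and \<epsilon> :: real assume "\<epsilon> > 0"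
    with M have "\<epsilon> / M > 0" by simp
    then obtain d where d: "d > 0" "\<And>a b. norm (a - b) < d \<Longrightarrow> norm (D\<phi> a - D\<phi> b) \<le> \<epsilon> / M"
      using compact_support_uniformly_continuous[OF cD Dsupp] by blast
    have "dist (?D z) (?D x) < \<epsilon>" if z: "dist z x < d" for z
    proof -
      have "dist (?D z) (?D x) = norm (LINT y|lborel. f y *\<^sub>R (D\<phi> (z - y) - D\<phi> (x - y)))"
        unfolding dist_norm scaleR_diff_right
        by (subst Bochner_Integration.integral_diff) (auto intro: integrable_conv f)
      also have "\<dots> \<le> (LINT y|lborel. norm (f y *\<^sub>R (D\<phi> (z - y) - D\<phi> (x - y))))"
        by (rule integral_norm_bound)
      also have "\<dots> \<le> (LINT y|lborel. \<bar>f y\<bar> * (\<epsilon> / M))"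
      proof (intro integral_mono integrable_norm integrable_mult_left integrable_abs f)
        show "integrable lborel (\<lambda>y. f y *\<^sub>R (D\<phi> (z - y) - D\<phi> (x - y)))"
          unfolding scaleR_diff_right by (intro Bochner_Integration.integrable_diff integrable_conv f)
        show "norm (f y *\<^sub>R (D\<phi> (z - y) - D\<phi> (x - y))) \<le> \<bar>f y\<bar> * (\<epsilon> / M)" for y
          unfolding norm_scaleR using z by (intro mult_left_mono d) (auto simp: dist_norm)
      qed
      also have "\<dots> = (M - 1) * (\<epsilon> / M)" by (simp add: M_def)
      also have "\<dots> < M * (\<epsilon> / M)" using M \<open>\<epsilon> > 0\<close> by (intro mult_strict_right_mono) auto
      finally show ?thesis using M by simp
    qed
    then show "\<exists>d>0. \<forall>z\<in>UNIV. dist z x < d \<longrightarrow> dist (?D z) (?D x) < \<epsilon>" using d(1) by blast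
  qed
  ultimately show ?thesis
    unfolding C1_on_def
    by (auto intro!: borel_measurable_continuous_onI continuous_at_imp_continuous_on has_derivative_continuous)
qed

lemma mass_shift: "(\<integral>\<^sup>+y. ennreal (\<phi> (x - y)) \<partial>lborel) = 1" "(\<integral>\<^sup>+x. ennreal (\<phi> (x - y)) \<partial>lborel) = 1"
proof -
  have 1: "(\<integral>\<^sup>+x. ennreal (\<phi> (x - y)) \<partial>lborel) = 1" for y
    using nn_integral_lborel_affine[of "\<lambda>y. ennreal (\<phi> y)" 1 "- y"] mass by (simp add: add.commute)
  then show "(\<integral>\<^sup>+x. ennreal (\<phi> (x - y)) \<partial>lborel) = 1" .
  show "(\<integral>\<^sup>+y. ennreal (\<phi> (x - y)) \<partial>lborel) = 1"
    using 1[of x] by (simp add: sym_diff[of x])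
qed

text \<open>The error of mollification is bounded by an average of translation errors, in which the
  shift \<open>v\<close> has weight \<open>\<phi> v\<close> and only shifts shorter than
  \<open>e\<close> occur.\<close>

lemma conv_L1_le:
  assumes f: "integrable lborel f"
    and le: "\<And>v. norm v < e \<Longrightarrow> (\<integral>\<^sup>+x. ennreal \<bar>f (v + x) - f x\<bar> \<partial>lborel) \<le> ennreal \<eta>"
  shows "(\<integral>\<^sup>+x. ennreal \<bar>(LINT y|lborel. f y * \<phi> (x - y)) - f x\<bar> \<partial>lborel) \<le> ennreal \<eta>"
proof -
  note [measurable] = borel_measurable_integrable[OF f, simplified]
  have int1: "integrable lborel (\<lambda>y. \<phi> (x - y))" "(LINT y|lborel. \<phi> (x - y)) = 1" for x
    using integral_eq_nn_integral[of "\<lambda>y. \<phi> (x - y)" lborel] mass_shift(1)[of x] nonneg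
    by (auto intro!: integrableI_nn_integral_finite[where x=1])
  have "ennreal \<bar>(LINT y|lborel. f y * \<phi> (x - y)) - f x\<bar> \<le> (\<integral>\<^sup>+v. ennreal \<bar>f (v + x) - f x\<bar> * ennreal (\<phi> v) \<partial>lborel)" for x
  proof -
    have "(LINT y|lborel. f y * \<phi> (x - y)) - f x = (LINT y|lborel. f y * \<phi> (x - y) - f x * \<phi> (x - y))"
      using int1[of x] integrable_conv(1)[OF f, of x] by (subst Bochner_Integration.integral_diff) auto
    moreover have "ennreal (norm (LINT y|lborel. f y * \<phi> (x - y) - f x * \<phi> (x - y)))
        \<le> (\<integral>\<^sup>+y. ennreal (norm (f y * \<phi> (x - y) - f x * \<phi> (x - y))) \<partial>lborel)"
      using int1[of x] integrable_conv(1)[OF f, of x] by (intro integral_norm_bound_ennreal) auto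
    moreover have "(\<integral>\<^sup>+y. ennreal (norm (f y * \<phi> (x - y) - f x * \<phi> (x - y))) \<partial>lborel)
        = (\<integral>\<^sup>+y. ennreal \<bar>f y - f x\<bar> * ennreal (\<phi> (y - x)) \<partial>lborel)"
      using nonneg by (intro nn_integral_cong)
        (simp add: left_diff_distrib[symmetric] abs_mult ennreal_mult sym_diff[of x])
    moreover have "(\<integral>\<^sup>+y. ennreal \<bar>f y - f x\<bar> * ennreal (\<phi> (y - x)) \<partial>lborel)
        = (\<integral>\<^sup>+v. ennreal \<bar>f (v + x) - f x\<bar> * ennreal (\<phi> v) \<partial>lborel)"
      using nn_integral_lborel_affine[of "\<lambda>y. ennreal \<bar>f y - f x\<bar> * ennreal (\<phi> (y - x))" 1 x]
      by (simp add: add.commute)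
    ultimately show ?thesis by simp
  qed
  then have "(\<integral>\<^sup>+x. ennreal \<bar>(LINT y|lborel. f y * \<phi> (x - y)) - f x\<bar> \<partial>lborel)
      \<le> (\<integral>\<^sup>+x. (\<integral>\<^sup>+v. ennreal \<bar>f (v + x) - f x\<bar> * ennreal (\<phi> v) \<partial>lborel) \<partial>lborel)"
    by (intro nn_integral_mono)
  also have "\<dots> = (\<integral>\<^sup>+v. (\<integral>\<^sup>+x. ennreal \<bar>f (v + x) - f x\<bar> * ennreal (\<phi> v) \<partial>lborel) \<partial>lborel)"
    by (rule lborel_pair.Fubini') measurable
  also have "\<dots> = (\<integral>\<^sup>+v. (\<integral>\<^sup>+x. ennreal \<bar>f (v + x) - f x\<bar> \<partial>lborel) * ennreal (\<phi> v) \<partial>lborel)"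
    by (simp add: nn_integral_multc)
  also have "\<dots> \<le> (\<integral>\<^sup>+v. ennreal \<eta> * ennreal (\<phi> v) \<partial>lborel)"
  proof (intro nn_integral_mono)
    show "(\<integral>\<^sup>+x. ennreal \<bar>f (v + x) - f x\<bar> \<partial>lborel) * ennreal (\<phi> v) \<le> ennreal \<eta> * ennreal (\<phi> v)" for v
      using le[of v] supp[of v] by (cases "norm v < e") (auto intro: mult_right_mono)
  qed
  also have "\<dots> = ennreal \<eta>" using mass by (simp add: nn_integral_cmult)
  finally show ?thesis .
qed

text \<open>Jensen's inequality for the square, obtained from Cauchy-Schwarz by splitting
  \<open>\<phi>\<close> into two square roots. The kernel links only points at distance below
  \<open>e\<close>, where moving the weight from \<open>x\<close> to \<open>y\<close> costs the
  factor 2.\<close>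

lemma conv_energy_le:
  fixes G :: "'a \<Rightarrow> 'a" and W :: "'a \<Rightarrow> real"
  assumes [measurable]: "G \<in> borel_measurable borel" "W \<in> borel_measurable borel" "S \<in> sets borel"
    and D: "\<And>x. x \<in> S \<Longrightarrow> ennreal (norm (D x)) \<le> (\<integral>\<^sup>+y. ennreal (norm (G y)) * ennreal (\<phi> (x - y)) \<partial>lborel)"
    and W: "\<And>x y. x \<in> S \<Longrightarrow> norm (x - y) < e \<Longrightarrow> 0 \<le> W x \<and> W x \<le> 2 * W y"
  shows "(\<integral>\<^sup>+x\<in>S. ennreal (W x * (norm (D x))\<^sup>2) \<partial>lborel) \<le> 2 * (\<integral>\<^sup>+y. ennreal (W y * (norm (G y))\<^sup>2) \<partial>lborel)"
proof -
  have "ennreal ((norm (D x))\<^sup>2) \<le> (\<integral>\<^sup>+y. ennreal ((norm (G y))\<^sup>2) * ennreal (\<phi> (x - y)) \<partial>lborel)" if "x \<in> S" for x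
  proof -
    have r: "ennreal (\<phi> z) = ennreal (sqrt (\<phi> z)) * ennreal (sqrt (\<phi> z))" for z
      using nonneg by (simp add: ennreal_mult[symmetric])
    have r2: "(ennreal (sqrt (\<phi> z)))\<^sup>2 = ennreal (\<phi> z)" for z
      using nonneg by (simp add: ennreal_power)
    have "(ennreal (norm (D x)))\<^sup>2 \<le> (\<integral>\<^sup>+y. ennreal (norm (G y)) * ennreal (\<phi> (x - y)) \<partial>lborel)\<^sup>2"
      by (intro power_mono D that) auto
    also have "\<dots> = (\<integral>\<^sup>+y. (ennreal (norm (G y)) * ennreal (sqrt (\<phi> (x - y)))) * ennreal (sqrt (\<phi> (x - y))) \<partial>lborel)\<^sup>2"
      by (subst r) (simp only: mult.assoc)
    also have "\<dots> \<le> (\<integral>\<^sup>+y. (ennreal (norm (G y)) * ennreal (sqrt (\<phi> (x - y))))\<^sup>2 \<partial>lborel) * (\<integral>\<^sup>+y. (ennreal (sqrt (\<phi> (x - y))))\<^sup>2 \<partial>lborel)"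
      by (rule Cauchy_Schwarz_nn_integral) measurable
    also have "\<dots> = (\<integral>\<^sup>+y. ennreal ((norm (G y))\<^sup>2) * ennreal (\<phi> (x - y)) \<partial>lborel)"
      unfolding power_mult_distrib r2 mass_shift(1) by (simp add: ennreal_power)
    finally show ?thesis by (simp add: ennreal_power)
  qed
  note DD = this
  have "(\<integral>\<^sup>+x\<in>S. ennreal (W x * (norm (D x))\<^sup>2) \<partial>lborel)
      \<le> (\<integral>\<^sup>+x. (\<integral>\<^sup>+y. (2 * ennreal (W y * (norm (G y))\<^sup>2)) * ennreal (\<phi> (x - y)) \<partial>lborel) \<partial>lborel)"
  proof (intro nn_integral_mono)
    fix x
    show "ennreal (W x * (norm (D x))\<^sup>2) * indicator S x
        \<le> (\<integral>\<^sup>+y. (2 * ennreal (W y * (norm (G y))\<^sup>2)) * ennreal (\<phi> (x - y)) \<partial>lborel)"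
    proof (cases "x \<in> S \<and> e > 0")
      case True
      have W0: "0 \<le> W x" using W[of x x] True by simp
      have "ennreal (W x * (norm (D x))\<^sup>2) = ennreal (W x) * ennreal ((norm (D x))\<^sup>2)"
        using W0 by (simp add: ennreal_mult)
      also have "\<dots> \<le> ennreal (W x) * (\<integral>\<^sup>+y. ennreal ((norm (G y))\<^sup>2) * ennreal (\<phi> (x - y)) \<partial>lborel)"
        using True by (intro mult_left_mono DD) auto
      also have "\<dots> = (\<integral>\<^sup>+y. ennreal (W x) * (ennreal ((norm (G y))\<^sup>2) * ennreal (\<phi> (x - y))) \<partial>lborel)"
        by (rule nn_integral_cmult[symmetric]) measurable
      also have "\<dots> \<le> (\<integral>\<^sup>+y. (2 * ennreal (W y * (norm (G y))\<^sup>2)) * ennreal (\<phi> (x - y)) \<partial>lborel)"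
      proof (intro nn_integral_mono)
        fix y
        show "ennreal (W x) * (ennreal ((norm (G y))\<^sup>2) * ennreal (\<phi> (x - y))) \<le> (2 * ennreal (W y * (norm (G y))\<^sup>2)) * ennreal (\<phi> (x - y))"
        proof (cases "norm (x - y) < e")
          case near: True
          have Wxy: "0 \<le> W x" "W x \<le> 2 * W y" using W near True by auto
          then have "W x * (norm (G y))\<^sup>2 \<le> 2 * (W y * (norm (G y))\<^sup>2)"
            using mult_right_mono[of "W x" "2 * W y" "(norm (G y))\<^sup>2"] by simp
          then have "ennreal (W x) * ennreal ((norm (G y))\<^sup>2) \<le> 2 * ennreal (W y * (norm (G y))\<^sup>2)"
            using Wxy ennreal_leI[of "W x * (norm (G y))\<^sup>2" "2 * (W y * (norm (G y))\<^sup>2)"] by (simp add: ennreal_mult)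
          then show ?thesis by (simp only: mult.assoc[symmetric]) (rule mult_right_mono, auto)
        next
          case False
          then show ?thesis using supp[of "x - y"] by simp
        qed
      qed
      finally show ?thesis using True by simp
    next
      case False
      \<comment> \<open>A kernel of mass 1 does not vanish identically, so \<open>e\<close> is
        positive, and what remains is the trivial case of \<open>x\<close> outside
        \<open>S\<close>.\<close>
      have "e > 0"
      proof (rule ccontr)
        assume "\<not> e > 0"
        then have "\<phi> y = 0" for y using supp[of y] by (simp add: order_trans[of e 0])
        then show False using mass by simp
      qed
      then show ?thesis using False by simp
    qed
  qed
  also have "\<dots> = (\<integral>\<^sup>+y. (\<integral>\<^sup>+x. (2 * ennreal (W y * (norm (G y))\<^sup>2)) * ennreal (\<phi> (x - y)) \<partial>lborel) \<partial>lborel)"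
    by (rule lborel_pair.Fubini') measurable
  also have "\<dots> = (\<integral>\<^sup>+y. 2 * ennreal (W y * (norm (G y))\<^sup>2) \<partial>lborel)"
    by (subst nn_integral_cmult) (auto simp: mass_shift(2))
  also have "\<dots> = 2 * (\<integral>\<^sup>+y. ennreal (W y * (norm (G y))\<^sup>2) \<partial>lborel)"
    by (rule nn_integral_cmult) measurable
  finally show ?thesis .
qed

end

section \<open>Borel representatives and mollified weak gradients\<close>

text \<open>\<open>has_weak_gradient\<close> speaks about the completed measure, whereas the Fubini
  arguments for convolutions take place over \<open>lborel\<close>; this is the bridge.\<close>

lemma borel_representative:
  fixes f :: "'a::euclidean_space \<Rightarrow> 'b::euclidean_space"
  assumes "f \<in> borel_measurable lebesgue"
  shows "\<exists>f'\<in>borel_measurable borel. AE x in lborel. f x = f' x"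
proof -
  have "\<exists>h. h \<in> borel_measurable lborel \<and> (AE x in lborel. f x \<bullet> i = h x)" for i
    using completion_ex_borel_measurable_real[OF borel_measurable_inner[OF assms borel_measurable_const[of i]]]
    unfolding Bex_def .
  then have "\<forall>i. \<exists>h. h \<in> borel_measurable lborel \<and> (AE x in lborel. f x \<bullet> i = h x)" ..
  from choice[OF this] obtain h where h: "\<And>i. h i \<in> borel_measurable lborel" "\<And>i. AE x in lborel. f x \<bullet> i = h i x"
    by blast
  have "AE x in lborel. \<forall>i\<in>Basis. f x \<bullet> i = h i x"
    by (rule AE_finite_allI[OF finite_Basis h(2)])
  then have "AE x in lborel. f x = (\<Sum>i\<in>Basis. h i x *\<^sub>R i)"
  proof eventually_elim
    case (elim x)
    have "f x = (\<Sum>i\<in>Basis. (f x \<bullet> i) *\<^sub>R i)" by (rule euclidean_representation[symmetric])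
    also have "\<dots> = (\<Sum>i\<in>Basis. h i x *\<^sub>R i)" using elim by (intro sum.cong) auto
    finally show ?case .
  qed
  moreover have "(\<lambda>x. \<Sum>i\<in>Basis. h i x *\<^sub>R i) \<in> borel_measurable borel"
    using h(1) by (intro borel_measurable_sum borel_measurable_scaleR) auto
  ultimately show ?thesis by (rule bexI)
qed

text \<open>Local integrability yields measurability on compact subsets only; closed balls with
  radii tending to 1 exhaust the open ball.\<close>

lemma locally_integrable_measurable:
  fixes f :: "'a::euclidean_space \<Rightarrow> 'b::euclidean_space"
  assumes "\<And>K. compact K \<Longrightarrow> K \<subseteq> ball 0 1 \<Longrightarrow> f absolutely_integrable_on K"
  shows "(\<lambda>x. indicator (ball 0 1) x *\<^sub>R f x) \<in> borel_measurable lebesgue"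
proof (rule borel_measurable_LIMSEQ_metric)
  define r :: "nat \<Rightarrow> real" where "r n = 1 - 1 / (real n + 2)" for n
  have r: "r n < 1" for n by (simp add: r_def)
  have rlim: "r \<longlonglongrightarrow> 1" unfolding r_def by real_asymp
  show "(\<lambda>x. indicator (cball 0 (r n)) x *\<^sub>R f x) \<in> borel_measurable lebesgue" for n
  proof -
    have "f absolutely_integrable_on cball 0 (r n)" using r[of n] by (intro assms) auto
    then show ?thesis by (auto simp: set_integrable_def dest: borel_measurable_integrable)
  qed
  show "(\<lambda>n. indicator (cball 0 (r n)) x *\<^sub>R f x) \<longlonglongrightarrow> indicator (ball 0 1) x *\<^sub>R f x" for x
  proof (cases "norm x < 1")
    case True
    have "eventually (\<lambda>n. norm x < r n) sequentially" using order_tendstoD(1)[OF rlim True] .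
    then have "eventually (\<lambda>n. indicator (cball 0 (r n)) x *\<^sub>R f x = indicator (ball 0 1) x *\<^sub>R f x) sequentially"
      by eventually_elim (use True in auto)
    then show ?thesis by (rule tendsto_eventually)
  next
    case False
    then have "x \<notin> cball 0 (r n)" for n using r[of n] by auto
    then show ?thesis using False by simp
  qed
qed

context mollifier
begin

text \<open>Testing the weak gradient with the translated kernel shows that the gradient of the
  mollified function is the mollified gradient. The kernel around \<open>x\<close> lives inside
  \<open>K\<close>, so truncating to \<open>K\<close> changes nothing there. The result is a bound
  on norms because this is the form that \<open>conv_energy_le\<close> takes.\<close>

lemma weak_gradient_conv:
  fixes u u' :: "'a \<Rightarrow> real" and g g' :: "'a \<Rightarrow> 'a"
  assumes wg: "has_weak_gradient u g (ball 0 1)"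
    and test: "\<And>x S. cball x e \<subseteq> S \<Longrightarrow> test_function S (\<lambda>y. \<phi> (x - y))"
    and [measurable]: "u' \<in> borel_measurable borel" "g' \<in> borel_measurable borel"
    and ae: "AE x in lborel. x \<in> ball 0 1 \<longrightarrow> u x = u' x \<and> g x = g' x"
    and K: "compact K" "K \<subseteq> ball 0 1" "cball x e \<subseteq> K"
    and iu: "integrable lborel (\<lambda>y. indicator K y *\<^sub>R u' y)" and ig: "integrable lborel (\<lambda>y. indicator K y *\<^sub>R g' y)"
  shows "ennreal (norm (LINT y|lborel. (indicator K y *\<^sub>R u' y) *\<^sub>R D\<phi> (x - y)))
    \<le> (\<integral>\<^sup>+y. ennreal (norm (indicator K y *\<^sub>R g' y)) * ennreal (\<phi> (x - y)) \<partial>lborel)"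
proof -
  have [measurable]: "K \<in> sets borel" using K by (simp add: borel_compact)
  let ?u = "\<lambda>y. indicator K y *\<^sub>R u' y" and ?g = "\<lambda>y. indicator K y *\<^sub>R g' y"
  have inK: "y \<in> K" if "norm (x - y) < e" for y using K(3) that by (auto simp: dist_norm)
  have fd: "frechet_derivative (\<lambda>y. \<phi> (x - y)) (at y) i = - (D\<phi> (x - y) \<bullet> i)" for y i
  proof -
    have "((\<lambda>y. x - y) has_derivative (\<lambda>v. - v)) (at y)" by (auto intro!: derivative_eq_intros)
    from fun_cong[OF frechet_derivative_at[OF has_derivative_compose[OF this der]], of i] show ?thesis by simp
  qed
  \<comment> \<open>\<open>\<psi>\<close> vanishes outside \<open>K\<close>, so the integral over
    the ball may be truncated to \<open>K\<close>, where \<open>f\<close> is measurable, and then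
    passed to the Borel representative.\<close>
  have transfer: "(LINT y:ball 0 1|lebesgue. f y * \<psi> y) = (LINT y|lborel. (indicator K y * f' y) * \<psi> y)"
    if f: "(\<lambda>y. indicator K y *\<^sub>R f y) \<in> borel_measurable lebesgue" and [measurable]: "f' \<in> borel_measurable borel" "\<psi> \<in> borel_measurable borel"
      and eq: "AE y in lborel. y \<in> ball 0 1 \<longrightarrow> f y = f' y" and \<psi>: "\<And>y. norm (x - y) \<ge> e \<Longrightarrow> \<psi> y = 0"
    for f f' \<psi> :: "'a \<Rightarrow> real"
  proof -
    have "indicator (ball 0 1) y *\<^sub>R (f y * \<psi> y) = (indicator K y *\<^sub>R f y) * \<psi> y" for y
      using \<psi>[of y] inK[of y] K(2) by (cases "norm (x - y) < e") (auto split: split_indicator)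
    note eqi = this
    have "(LINT y:ball 0 1|lebesgue. f y * \<psi> y) = (LINT y|lebesgue. (indicator K y *\<^sub>R f y) * \<psi> y)"
      unfolding set_lebesgue_integral_def eqi ..
    also have "\<dots> = (LINT y|lebesgue. (indicator K y * f' y) * \<psi> y)"
    proof (rule integral_cong_AE)
      have [measurable]: "\<psi> \<in> borel_measurable lebesgue" by (rule measurable_completion) simp
      show "(\<lambda>y. (indicator K y *\<^sub>R f y) * \<psi> y) \<in> borel_measurable lebesgue"
        using f by (intro borel_measurable_times) auto
      show "(\<lambda>y. (indicator K y * f' y) * \<psi> y) \<in> borel_measurable lebesgue"
        by (rule measurable_completion) simp
      show "AE y in lebesgue. (indicator K y *\<^sub>R f y) * \<psi> y = (indicator K y * f' y) * \<psi> y"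
        using AE_completion[OF eq] by eventually_elim (use K(2) in \<open>auto split: split_indicator\<close>)
    qed
    also have "\<dots> = (LINT y|lborel. (indicator K y * f' y) * \<psi> y)"
      by (rule integral_completion) simp
    finally show ?thesis .
  qed
  have fK: "(\<lambda>y. indicator K y *\<^sub>R u y) \<in> borel_measurable lebesgue" "(\<lambda>y. indicator K y *\<^sub>R g y) \<in> borel_measurable lebesgue"
    using wg K unfolding has_weak_gradient_def by (auto simp: set_integrable_def dest!: borel_measurable_integrable)
  have comp: "(LINT y|lborel. ?u y * (D\<phi> (x - y) \<bullet> i)) = (LINT y|lborel. (?g y \<bullet> i) * \<phi> (x - y))" if i: "i \<in> Basis" for i
  proof -
    have gKi: "(\<lambda>y. indicator K y *\<^sub>R (g y \<bullet> i)) \<in> borel_measurable lebesgue"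
      using borel_measurable_inner[OF fK(2) borel_measurable_const[of i]] by simp
    have "test_function (ball 0 1) (\<lambda>y. \<phi> (x - y))" using K by (intro test) auto
    then have "(LINT y:ball 0 1|lebesgue. u y * - (D\<phi> (x - y) \<bullet> i)) = - (LINT y:ball 0 1|lebesgue. (g y \<bullet> i) * \<phi> (x - y))"
      using wg i unfolding has_weak_gradient_def by (auto simp: fd)
    moreover have "(LINT y:ball 0 1|lebesgue. u y * - (D\<phi> (x - y) \<bullet> i)) = (LINT y|lborel. (indicator K y * u' y) * - (D\<phi> (x - y) \<bullet> i))"
      using ae Dsupp by (intro transfer fK) (auto elim: eventually_mono)
    moreover have "(LINT y:ball 0 1|lebesgue. (g y \<bullet> i) * \<phi> (x - y)) = (LINT y|lborel. (indicator K y * (g' y \<bullet> i)) * \<phi> (x - y))"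
      using ae supp by (intro transfer gKi) (auto elim: eventually_mono)
    ultimately show ?thesis by simp
  qed
  have ig2: "integrable lborel (\<lambda>y. \<phi> (x - y) *\<^sub>R ?g y)"
  proof -
    obtain B where B: "B \<ge> 0" "\<And>y. norm (\<phi> y) \<le> B" using compact_support_bounded[OF cont supp] by blast
    show ?thesis
    proof (rule Bochner_Integration.integrable_bound[OF integrable_scaleR_right[OF ig, of B]])
      show "AE y in lborel. norm (\<phi> (x - y) *\<^sub>R ?g y) \<le> norm (B *\<^sub>R ?g y)"
        unfolding norm_scaleR[of "\<phi> _"] norm_scaleR[of B] using B by (intro AE_I2 mult_right_mono) auto
    qed auto
  qed
  have "(LINT y|lborel. ?u y *\<^sub>R D\<phi> (x - y)) = (LINT y|lborel. \<phi> (x - y) *\<^sub>R ?g y)"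
  proof (rule euclidean_eqI)
    fix i :: 'a assume i: "i \<in> Basis"
    have "(LINT y|lborel. ?u y *\<^sub>R D\<phi> (x - y)) \<bullet> i = (LINT y|lborel. ?u y * (D\<phi> (x - y) \<bullet> i))"
      using integral_inner_left[OF integrable_conv(2)[OF iu, of x], of i] by simp
    also have "\<dots> = (LINT y|lborel. (?g y \<bullet> i) * \<phi> (x - y))" by (rule comp[OF i])
    also have "\<dots> = (LINT y|lborel. \<phi> (x - y) *\<^sub>R ?g y) \<bullet> i"
      using integral_inner_left[OF ig2, of i] by (simp add: mult_ac)
    finally show "(LINT y|lborel. ?u y *\<^sub>R D\<phi> (x - y)) \<bullet> i = (LINT y|lborel. \<phi> (x - y) *\<^sub>R ?g y) \<bullet> i" .
  qed
  also have "ennreal (norm \<dots>) \<le> (\<integral>\<^sup>+y. ennreal (norm (\<phi> (x - y) *\<^sub>R ?g y)) \<partial>lborel)"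
    by (rule integral_norm_bound_ennreal[OF ig2])
  also have "\<dots> = (\<integral>\<^sup>+y. ennreal (norm (?g y)) * ennreal (\<phi> (x - y)) \<partial>lborel)"
    using nonneg by (intro nn_integral_cong) (simp add: ennreal_mult mult_ac)
  finally show ?thesis .
qed

end

section \<open>Smooth approximation with bounded energy\<close>

text \<open>The minimum of \<open>W\<close> on the ball serves as the tolerance in its uniform
  continuity.\<close>

lemma weight_comparison:
  fixes W :: "'a::euclidean_space \<Rightarrow> real"
  assumes W: "continuous_on (cball 0 R) W" "\<And>x. x \<in> cball 0 R \<Longrightarrow> W x > 0" and "0 \<le> R"
  shows "\<exists>d>0. \<forall>x\<in>cball 0 R. \<forall>y\<in>cball 0 R. norm (x - y) < d \<longrightarrow> W x \<le> 2 * W y"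
proof -
  have "cball (0::'a) R \<noteq> {}" using \<open>0 \<le> R\<close> by auto
  with continuous_attains_inf[OF compact_cball this W(1)]
  obtain z where z: "z \<in> cball 0 R" "\<And>y. y \<in> cball 0 R \<Longrightarrow> W z \<le> W y" by auto
  have "uniformly_continuous_on (cball 0 R) W" by (intro compact_uniformly_continuous W) auto
  then obtain d where d: "d > 0" "\<And>x y. x \<in> cball 0 R \<Longrightarrow> y \<in> cball 0 R \<Longrightarrow> dist x y < d \<Longrightarrow> dist (W x) (W y) < W z"
    unfolding uniformly_continuous_on_def using W(2)[OF z(1)] by metis
  have "W x \<le> 2 * W y" if "x \<in> cball 0 R" "y \<in> cball 0 R" "norm (x - y) < d" for x y
    using d(2)[OF that(1,2)] z(2)[OF that(2)] that(3) by (auto simp: dist_norm)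
  then show ?thesis using d(1) by blast
qed

text \<open>Only L1 closeness and a bound on the energy are sought, not convergence of the energies;
  hence the factor 2 from comparing the weight at nearby points does no harm.\<close>

lemma smooth_approximation:
  fixes u u' :: "'a::euclidean_space \<Rightarrow> real" and g g' :: "'a \<Rightarrow> 'a"
  assumes wg: "has_weak_gradient u g (ball 0 1)"
    and [measurable]: "u' \<in> borel_measurable borel" "g' \<in> borel_measurable borel"
    and ae: "AE x in lborel. x \<in> ball 0 1 \<longrightarrow> u x = u' x \<and> g x = g' x"
    and d: "0 \<le> d" "(\<integral>\<^sup>+x\<in>ball 0 1. ennreal (((1 - (norm x)\<^sup>2) / 2)\<^sup>2 * (norm (g' x))\<^sup>2 * gauss_weight \<beta> x) \<partial>lborel) \<le> ennreal d"
    and R: "0 \<le> R" "R < 1" and "\<eta> > 0"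
  shows "\<exists>U DU. C1_on UNIV U DU \<and> (\<integral>\<^sup>+x\<in>cball 0 R. ennreal \<bar>U x - u' x\<bar> \<partial>lborel) \<le> ennreal \<eta> \<and> wenergy \<beta> R DU \<le> 2 * d"
proof -
  \<comment> \<open>Leaves room for kernels centred in \<open>cball 0 R\<close> to be supported in a
    compact part of the open ball.\<close>
  define R1 where "R1 = (1 + R) / 2"
  have R1: "R < R1" "R1 < 1" "0 \<le> R1" using R by (auto simp: R1_def)
  let ?K = "cball (0::'a) R1"
  have K: "compact ?K" "?K \<subseteq> ball 0 1" using R1 by auto
  have [measurable]: "?K \<in> sets borel" "cball (0::'a) R \<in> sets borel" "ball (0::'a) 1 \<in> sets borel" by auto
  define W where "W x = ((1 - (norm x)\<^sup>2) / 2)\<^sup>2 * gauss_weight \<beta> x" for x :: 'a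
  have W0: "W x \<ge> 0" for x by (simp add: W_def less_imp_le[OF gauss_weight_pos])
  have [measurable]: "W \<in> borel_measurable borel" unfolding W_def[abs_def] by measurable
  have int: "integrable lborel (\<lambda>y. indicator ?K y *\<^sub>R f' y)"
    if "f absolutely_integrable_on ?K" and [measurable]: "f' \<in> borel_measurable borel"
      and eq: "AE x in lborel. x \<in> ball 0 1 \<longrightarrow> f x = f' x" for f f' :: "'a \<Rightarrow> 'b::euclidean_space"
  proof -
    have "integrable lebesgue (\<lambda>y. indicator ?K y *\<^sub>R f y)" using that(1) by (simp add: set_integrable_def)
    then have "integrable lebesgue (\<lambda>y. indicator ?K y *\<^sub>R f' y)"
    proof (rule integrable_cong_AE_imp)
      show "AE y in lebesgue. indicator ?K y *\<^sub>R f y = indicator ?K y *\<^sub>R f' y"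
        using AE_completion[OF eq] by eventually_elim (use K(2) in \<open>auto split: split_indicator\<close>)
      show "(\<lambda>y. indicator ?K y *\<^sub>R f' y) \<in> borel_measurable lebesgue"
        by (rule measurable_completion) measurable
    qed
    then show ?thesis by (subst (asm) integrable_completion) auto
  qed
  have abs: "u absolutely_integrable_on ?K" "g absolutely_integrable_on ?K"
    using wg K unfolding has_weak_gradient_def by auto
  have iu: "integrable lborel (\<lambda>y. indicator ?K y *\<^sub>R u' y)"
    using ae by (intro int[OF abs(1)]) (auto elim: eventually_mono)
  have ig: "integrable lborel (\<lambda>y. indicator ?K y *\<^sub>R g' y)"
    using ae by (intro int[OF abs(2)]) (auto elim: eventually_mono)
  obtain d1 where d1: "d1 > 0" "\<And>v. norm v < d1 \<Longrightarrow>
      (\<integral>\<^sup>+x. ennreal \<bar>indicator ?K (v + x) *\<^sub>R u' (v + x) - indicator ?K x *\<^sub>R u' x\<bar> \<partial>lborel) \<le> ennreal \<eta>"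
    using L1_translation_continuous[OF iu] \<open>\<eta> > 0\<close> by blast
  have "\<exists>d>0. \<forall>x\<in>?K. \<forall>y\<in>?K. norm (x - y) < d \<longrightarrow> W x \<le> 2 * W y"
  proof (rule weight_comparison)
    show "continuous_on ?K W"
      unfolding W_def using continuous_on_subset[OF continuous_on_gauss_weight K(2)] by (intro continuous_intros) auto
    show "W x > 0" if "x \<in> ?K" for x
    proof -
      have "norm x < 1" using that R1 by simp
      then show ?thesis using norm_square_less_1[of x] gauss_weight_pos[of \<beta> x] by (simp add: W_def)
    qed
  qed fact
  then obtain d2 where d2: "d2 > 0" "\<And>x y. x \<in> ?K \<Longrightarrow> y \<in> ?K \<Longrightarrow> norm (x - y) < d2 \<Longrightarrow> W x \<le> 2 * W y"
    by blast
  \<comment> \<open>The three bounds ensure closeness in L1, comparability of the weight, and kernel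
    supports inside \<open>?K\<close>.\<close>
  define e where "e = min (min d1 d2) (R1 - R)"
  have e: "e > 0" "e \<le> d1" "e \<le> d2" "e \<le> R1 - R" using d1 d2 R1 by (auto simp: e_def)
  obtain \<phi> :: "'a \<Rightarrow> real" and D\<phi> where "mollifier \<phi> D\<phi> e"
    and test: "\<And>x S. cball x e \<subseteq> S \<Longrightarrow> test_function S (\<lambda>y. \<phi> (x - y))"
  proof (rule mollifier_exists[OF e(1), where 'a='a])
    fix \<phi> :: "'a \<Rightarrow> real" and D\<phi>
    assume "mollifier \<phi> D\<phi> e" "\<And>x S. cball x e \<subseteq> S \<Longrightarrow> test_function S (\<lambda>y. \<phi> (x - y))"
    then show thesis by (rule that)
  qed
  then interpret mollifier \<phi> D\<phi> e by simp
  define U where "U x = (LINT y|lborel. (indicator ?K y *\<^sub>R u' y) * \<phi> (x - y))" for x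
  define DU where "DU x = (LINT y|lborel. (indicator ?K y *\<^sub>R u' y) *\<^sub>R D\<phi> (x - y))" for x
  have C1: "C1_on UNIV U DU"
    unfolding U_def[abs_def] DU_def[abs_def] by (rule C1_on_conv[OF iu])
  have "(\<integral>\<^sup>+x\<in>cball 0 R. ennreal \<bar>U x - u' x\<bar> \<partial>lborel) \<le> (\<integral>\<^sup>+x. ennreal \<bar>U x - indicator ?K x *\<^sub>R u' x\<bar> \<partial>lborel)"
    using R1 by (intro nn_integral_mono) (auto split: split_indicator)
  also have "\<dots> \<le> ennreal \<eta>"
    unfolding U_def by (rule conv_L1_le[OF iu]) (use d1 e in auto)
  finally have L1: "(\<integral>\<^sup>+x\<in>cball 0 R. ennreal \<bar>U x - u' x\<bar> \<partial>lborel) \<le> ennreal \<eta>" .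
  have near: "x \<in> ?K \<and> y \<in> ?K" if "x \<in> cball 0 R" "norm (x - y) \<le> e" for x y
  proof -
    have "norm y \<le> norm x + norm (x - y)" using norm_triangle_sub[of y x] by (simp add: norm_minus_commute)
    then show ?thesis using that e R1 by auto
  qed
  have "(\<integral>\<^sup>+x\<in>cball 0 R. ennreal (W x * (norm (DU x))\<^sup>2) \<partial>lborel)
      \<le> 2 * (\<integral>\<^sup>+y. ennreal (W y * (norm (indicator ?K y *\<^sub>R g' y))\<^sup>2) \<partial>lborel)"
  proof (rule conv_energy_le)
    fix x assume x: "x \<in> cball (0::'a) R"
    have sub: "cball x e \<subseteq> ?K" using near[OF x] by (auto simp: dist_norm)
    show "ennreal (norm (DU x)) \<le> (\<integral>\<^sup>+y. ennreal (norm (indicator ?K y *\<^sub>R g' y)) * ennreal (\<phi> (x - y)) \<partial>lborel)"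
      unfolding DU_def by (rule weak_gradient_conv[OF wg test assms(2,3) ae K sub iu ig])
    fix y assume "norm (x - y) < e"
    then show "0 \<le> W x \<and> W x \<le> 2 * W y"
      using near[OF x, of y] d2(2)[of x y] e W0 by auto
  qed auto
  also have "\<dots> \<le> 2 * (\<integral>\<^sup>+x\<in>ball 0 1. ennreal (((1 - (norm x)\<^sup>2) / 2)\<^sup>2 * (norm (g' x))\<^sup>2 * gauss_weight \<beta> x) \<partial>lborel)"
  proof (intro mult_left_mono nn_integral_mono)
    fix y :: 'a
    show "ennreal (W y * (norm (indicator ?K y *\<^sub>R g' y))\<^sup>2)
      \<le> ennreal (((1 - (norm y)\<^sup>2) / 2)\<^sup>2 * (norm (g' y))\<^sup>2 * gauss_weight \<beta> y) * indicator (ball 0 1) y"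
      using R1 by (cases "y \<in> ?K") (simp_all add: W_def mult_ac)
  qed simp
  also have "\<dots> \<le> 2 * ennreal d" by (intro mult_left_mono d(2)) simp
  also have "\<dots> = ennreal (2 * d)" using d(1) by (simp add: ennreal_mult)
  finally have en: "(\<integral>\<^sup>+x\<in>cball 0 R. ennreal (W x * (norm (DU x))\<^sup>2) \<partial>lborel) \<le> ennreal (2 * d)" .
  have "(\<integral>\<^sup>+x\<in>cball 0 R. ennreal (W x * (norm (DU x))\<^sup>2) \<partial>lborel) = ennreal (LINT x:cball 0 R|lborel. W x * (norm (DU x))\<^sup>2)"
  proof (rule set_nn_integral_compact_eq)
    have "cball (0::'a) R \<subseteq> ball 0 1" using R by auto
    then show "continuous_on (cball 0 R) (\<lambda>x. W x * (norm (DU x))\<^sup>2)"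
      unfolding W_def using continuous_on_subset[OF continuous_on_gauss_weight] continuous_on_subset[OF C1_onD(2)[OF C1], of "cball 0 R"]
      by (intro continuous_intros) auto
  qed (auto simp: W0)
  with en have "(LINT x:cball 0 R|lborel. W x * (norm (DU x))\<^sup>2) \<le> 2 * d"
    using d(1) by simp
  moreover have "W x * (norm (DU x))\<^sup>2 = ((1 - (norm x)\<^sup>2) / 2)\<^sup>2 * (norm (DU x))\<^sup>2 * gauss_weight \<beta> x" for x
    by (simp add: W_def mult_ac)
  ultimately have "wenergy \<beta> R DU \<le> 2 * d"
    by (simp only: wenergy_def)
  then show ?thesis using C1 L1 by blast
qed

section \<open>Passage to weakly differentiable functions\<close>

lemma continuous_square_ln: "continuous_on UNIV (\<lambda>y::real. y\<^sup>2 * ln (y\<^sup>2))"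
proof -
  have "isCont (\<lambda>y::real. y\<^sup>2 * ln (y\<^sup>2)) y" for y
  proof (cases "y = 0")
    case False
    then show ?thesis by (auto intro!: continuous_intros)
  next
    case True
    have "((\<lambda>y::real. y\<^sup>2 * ln (y\<^sup>2)) \<longlongrightarrow> 0) (at 0)"
    proof (rule Lim_null_comparison)
      show "((\<lambda>y::real. 2 * \<bar>y\<bar>) \<longlongrightarrow> 0) (at 0)" by (intro tendsto_eq_intros) auto
      have "norm (y\<^sup>2 * ln (y\<^sup>2)) \<le> 2 * \<bar>y\<bar>" if "y \<noteq> 0" "\<bar>y\<bar> < 1" for y :: real
      proof -
        have "ln (1 / \<bar>y\<bar>) \<le> 1 / \<bar>y\<bar>" using that by (intro ln_bound) auto
        moreover have "ln (1 / \<bar>y\<bar>) = - ln \<bar>y\<bar>" using that by (simp add: ln_div)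
        moreover have "ln \<bar>y\<bar> \<le> 0" using that by simp
        ultimately have "\<bar>y\<bar> * \<bar>ln \<bar>y\<bar>\<bar> \<le> \<bar>y\<bar> * (1 / \<bar>y\<bar>)" by (intro mult_left_mono) auto
        then have 1: "\<bar>y\<bar> * \<bar>ln \<bar>y\<bar>\<bar> \<le> 1" using that by simp
        have "ln (\<bar>y\<bar>\<^sup>2) = 2 * ln \<bar>y\<bar>" using that by (subst ln_realpow) auto
        then have "norm (y\<^sup>2 * ln (y\<^sup>2)) = 2 * \<bar>y\<bar> * (\<bar>y\<bar> * \<bar>ln \<bar>y\<bar>\<bar>)"
          by (simp add: abs_mult power2_eq_square)
        also have "\<dots> \<le> 2 * \<bar>y\<bar> * 1" by (intro mult_left_mono 1) auto
        finally show ?thesis by simp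
      qed
      then show "eventually (\<lambda>y::real. norm (y\<^sup>2 * ln (y\<^sup>2)) \<le> 2 * \<bar>y\<bar>) (at 0)"
        unfolding eventually_at by (intro exI[of _ 1]) auto
    qed
    then show ?thesis using True by (simp add: isCont_def)
  qed
  then show ?thesis by (simp add: continuous_at_imp_continuous_on)
qed

text \<open>Splitting off \<open>ln k\<close> isolates \<open>y\<^sup>2 * ln (y\<^sup>2)\<close>,
  which is continuous at 0 as well, so that a limit \<open>z = 0\<close> is covered.\<close>

lemma Phi_tendsto:
  assumes k: "(k \<longlongrightarrow> l) F" "l > 0" and y: "(y \<longlongrightarrow> z) F"
  shows "((\<lambda>n. Phi (k n) (y n)) \<longlongrightarrow> Phi l z) F"
proof -
  have eq: "Phi k y = y\<^sup>2 * ln (y\<^sup>2) - y\<^sup>2 * ln k - y\<^sup>2 + k" if "k > 0" for k y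
    using that by (cases "y = 0") (auto simp: Phi_def ln_div algebra_simps)
  have "((\<lambda>n. (y n)\<^sup>2 * ln ((y n)\<^sup>2)) \<longlongrightarrow> z\<^sup>2 * ln (z\<^sup>2)) F"
    using continuous_on_tendsto_compose[OF continuous_square_ln y] by auto
  moreover have "((\<lambda>n. (y n)\<^sup>2 * ln (k n)) \<longlongrightarrow> z\<^sup>2 * ln l) F"
    using k(2) by (intro tendsto_intros k(1) y) auto
  moreover have "((\<lambda>n. (y n)\<^sup>2) \<longlongrightarrow> z\<^sup>2) F"
    by (intro tendsto_intros y)
  ultimately have "((\<lambda>n. (y n)\<^sup>2 * ln ((y n)\<^sup>2) - (y n)\<^sup>2 * ln (k n) - (y n)\<^sup>2 + k n) \<longlongrightarrow> z\<^sup>2 * ln (z\<^sup>2) - z\<^sup>2 * ln l - z\<^sup>2 + l) F"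
    by (intro tendsto_add tendsto_diff k(1))
  moreover have "eventually (\<lambda>n. k n > 0) F" using order_tendstoD(1)[OF k] .
  then have "eventually (\<lambda>n. (y n)\<^sup>2 * ln ((y n)\<^sup>2) - (y n)\<^sup>2 * ln (k n) - (y n)\<^sup>2 + k n = Phi (k n) (y n)) F"
    by eventually_elim (simp add: eq)
  ultimately show ?thesis
    unfolding eq[OF k(2)] by (rule Lim_transform_eventually)
qed

text \<open>Fatou's lemma suffices, since the claim is an upper bound for a nonnegative integrand.
  Closeness in L1 gives almost everywhere convergence along a subsequence; and as every radius is at
  least \<open>R0\<close>, it also gives convergence of the averages over the fixed ball, hence of
  the parameter of \<open>Phi\<close>.\<close>

lemma weak_log_Sobolev:
  assumes "\<beta> > 0"
  shows "\<exists>R0 C1 C. 0 \<le> C1 \<and> 0 \<le> C \<and> (\<forall>(u :: 'a::euclidean_space \<Rightarrow> real) g u' g' d V.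
    has_weak_gradient u g (ball 0 1) \<and> u' \<in> borel_measurable borel \<and> g' \<in> borel_measurable borel \<and>
    (AE x in lborel. x \<in> ball 0 1 \<longrightarrow> u x = u' x \<and> g x = g' x) \<and> 0 \<le> d \<and>
    (\<integral>\<^sup>+x\<in>ball 0 1. ennreal (((1 - (norm x)\<^sup>2) / 2)\<^sup>2 * (norm (g' x))\<^sup>2 * gauss_weight \<beta> x) \<partial>lborel) \<le> ennreal d \<and>
    0 < V \<and> C1 * d \<le> V \<longrightarrow>
    (\<integral>\<^sup>+x\<in>ball 0 1. ennreal (Phi (max ((ball_average R0 u')\<^sup>2) V) (u' x) * gauss_weight \<beta> x) \<partial>lborel) \<le> ennreal (C * V))"
proof -
  obtain R0 C1 C where R0: "1 / 2 \<le> R0" "R0 < 1" "1 \<le> C1" "0 \<le> C"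
    and S: "\<And>R V (u :: 'a \<Rightarrow> real) Du. R0 \<le> R \<Longrightarrow> R < 1 \<Longrightarrow> C1_on (cball 0 R) u Du \<Longrightarrow> 0 < V \<Longrightarrow> C1 * wenergy \<beta> R Du \<le> V \<Longrightarrow>
      (\<integral>\<^sup>+x\<in>cball 0 R. ennreal (Phi (max ((ball_average R0 u)\<^sup>2) V) (u x) * gauss_weight \<beta> x) \<partial>lborel) \<le> ennreal (C * V)"
    using smooth_log_Sobolev[OF assms, where 'a='a] by blast
  have "(\<integral>\<^sup>+x\<in>ball 0 1. ennreal (Phi (max ((ball_average R0 u')\<^sup>2) V) (u' x) * gauss_weight \<beta> x) \<partial>lborel) \<le> ennreal (C * V)"
    if wg: "has_weak_gradient u g (ball 0 1)" and meas[measurable]: "u' \<in> borel_measurable borel" "g' \<in> borel_measurable borel"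
      and ae: "AE x in lborel. x \<in> ball 0 1 \<longrightarrow> u x = u' x \<and> g x = g' x"
      and d: "0 \<le> d" "(\<integral>\<^sup>+x\<in>ball 0 1. ennreal (((1 - (norm x)\<^sup>2) / 2)\<^sup>2 * (norm (g' x))\<^sup>2 * gauss_weight \<beta> x) \<partial>lborel) \<le> ennreal d"
      \<comment> \<open>The factor 2 pays for the doubled energy of the approximations.\<close>
      and V: "0 < V" "2 * C1 * d \<le> V"
    for u u' :: "'a \<Rightarrow> real" and g g' d V
  proof -
    define R where "R n = 1 - (1 - R0) / (real n + 2)" for n
    have R: "R0 \<le> R n" "R n < 1" for n
    proof -
      have "(1 - R0) / (real n + 2) \<le> (1 - R0) / 1" using R0 by (intro divide_left_mono) auto
      then show "R0 \<le> R n" by (simp add: R_def)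
      show "R n < 1" using R0 by (simp add: R_def)
    qed
    have Rlim: "R \<longlonglongrightarrow> 1" unfolding R_def by real_asymp
    have "\<exists>P. C1_on UNIV (fst P) (snd P) \<and> (\<integral>\<^sup>+x\<in>cball 0 (R n). ennreal \<bar>fst P x - u' x\<bar> \<partial>lborel) \<le> ennreal (1 / Suc n)
        \<and> wenergy \<beta> (R n) (snd P) \<le> 2 * d" for n
      using smooth_approximation[OF wg meas ae d, of "R n" "1 / Suc n"] R[of n] R0 by auto
    then have "\<forall>n. \<exists>P. C1_on UNIV (fst P) (snd P) \<and> (\<integral>\<^sup>+x\<in>cball 0 (R n). ennreal \<bar>fst P x - u' x\<bar> \<partial>lborel) \<le> ennreal (1 / Suc n)
        \<and> wenergy \<beta> (R n) (snd P) \<le> 2 * d" ..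
    from choice[OF this] obtain P where P: "\<And>n. C1_on UNIV (fst (P n)) (snd (P n))"
      "\<And>n. (\<integral>\<^sup>+x\<in>cball 0 (R n). ennreal \<bar>fst (P n) x - u' x\<bar> \<partial>lborel) \<le> ennreal (1 / Suc n)"
      "\<And>n. wenergy \<beta> (R n) (snd (P n)) \<le> 2 * d" by blast
    define U where "U n = fst (P n)" for n
    have C1: "C1_on UNIV (U n) (snd (P n))" for n using P(1) by (simp add: U_def)
    have [measurable]: "U n \<in> borel_measurable borel" for n using C1_onD(4)[OF C1] .
    have cU: "continuous_on S (U n)" for n S using C1_onD(3)[OF C1] continuous_on_subset by blast
    define f where "f n x = indicator (cball 0 (R n)) x *\<^sub>R (U n x - u' x)" for n x
    have [measurable]: "cball (0::'a) r \<in> sets borel" "ball (0::'a) r \<in> sets borel" for r by auto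
    have [measurable]: "f n \<in> borel_measurable borel" for n unfolding f_def[abs_def] by measurable
    have fn: "(\<integral>\<^sup>+x. ennreal (norm (f n x)) \<partial>lborel) \<le> ennreal (1 / Suc n)" for n
    proof -
      have "(\<integral>\<^sup>+x. ennreal (norm (f n x)) \<partial>lborel) = (\<integral>\<^sup>+x\<in>cball 0 (R n). ennreal \<bar>U n x - u' x\<bar> \<partial>lborel)"
        by (intro nn_integral_cong) (auto simp: f_def split: split_indicator)
      then show ?thesis using P(2)[of n] by (simp add: U_def)
    qed
    have fi: "integrable lborel (f n)" for n
      using fn[of n] by (auto simp: integrable_iff_bounded intro: le_less_trans)
    have fint: "(LINT x|lborel. norm (f n x)) \<le> 1 / Suc n" for n
    proof -
      have "ennreal (LINT x|lborel. norm (f n x)) \<le> ennreal (1 / Suc n)"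
        using fn[of n] integrable_norm[OF fi[of n]] by (subst nn_integral_eq_integral[symmetric]) auto
      then show ?thesis by (subst (asm) ennreal_le_iff) auto
    qed
    have inv: "(\<lambda>n. 1 / real (Suc n)) \<longlonglongrightarrow> 0" by real_asymp
    have f0: "(\<lambda>n. LINT x|lborel. norm (f n x)) \<longlonglongrightarrow> 0"
      using fint by (intro tendsto_sandwich[OF _ _ tendsto_const inv] always_eventually allI) (auto intro!: integral_nonneg_AE)
    obtain r where r: "strict_mono r" "AE x in lborel. (\<lambda>n. f (r n) x) \<longlonglongrightarrow> 0"
      using tendsto_L1_AE_subseq[OF fi f0] by blast
    have Rr: "(\<lambda>n. R (r n)) \<longlonglongrightarrow> 1" using LIMSEQ_subseq_LIMSEQ[OF Rlim r(1)] by (simp add: o_def)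
    have evR: "eventually (\<lambda>n. x \<in> cball 0 (R (r n))) sequentially" if "x \<in> ball 0 1" for x :: 'a
    proof -
      have "eventually (\<lambda>n. norm x < R (r n)) sequentially" using order_tendstoD(1)[OF Rr, of "norm x"] that by simp
      then show ?thesis by eventually_elim auto
    qed
    have Ulim: "(\<lambda>n. U (r n) x) \<longlonglongrightarrow> u' x" if "(\<lambda>n. f (r n) x) \<longlonglongrightarrow> 0" "x \<in> ball 0 1" for x
    proof -
      have "eventually (\<lambda>n. f (r n) x + u' x = U (r n) x) sequentially"
        using evR[OF that(2)] by eventually_elim (simp add: f_def)
      moreover have "(\<lambda>n. f (r n) x + u' x) \<longlonglongrightarrow> 0 + u' x" using that by (intro tendsto_intros)
      ultimately show ?thesis using Lim_transform_eventually by fastforce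
    qed
    have avg_lim: "(\<lambda>n. ball_average R0 (U n)) \<longlonglongrightarrow> ball_average R0 u'"
    proof -
      let ?T = "cball (0::'a) R0"
      have fT: "indicator ?T x *\<^sub>R f n x = indicator ?T x *\<^sub>R U n x - indicator ?T x *\<^sub>R u' x" for n x
        using R(1)[of n] by (auto simp: f_def split: split_indicator)
      have iT: "integrable lborel (\<lambda>x. indicator ?T x *\<^sub>R f n x)" for n
        by (intro integrable_mult_indicator fi) auto
      have iU: "integrable lborel (\<lambda>x. indicator ?T x *\<^sub>R U n x)" for n
        by (intro borel_integrable_compact cU) auto
      have iu: "integrable lborel (\<lambda>x. indicator ?T x *\<^sub>R u' x)"
        using Bochner_Integration.integrable_diff[OF iU[of 0] iT[of 0]] unfolding fT by simp
      have "(\<lambda>n. (LINT x:?T|lborel. U n x) - (LINT x:?T|lborel. u' x)) \<longlonglongrightarrow> 0"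
      proof (rule Lim_null_comparison[OF always_eventually f0], rule allI)
        fix n
        have "(LINT x:?T|lborel. U n x) - (LINT x:?T|lborel. u' x) = (LINT x|lborel. indicator ?T x *\<^sub>R f n x)"
          unfolding fT set_lebesgue_integral_def using iU[of n] iu by (simp only: Bochner_Integration.integral_diff)
        also have "norm \<dots> \<le> (LINT x|lborel. norm (indicator ?T x *\<^sub>R f n x))" by (rule integral_norm_bound)
        also have "\<dots> \<le> (LINT x|lborel. norm (f n x))"
          using iT fi by (intro integral_mono) (auto split: split_indicator)
        finally show "norm ((LINT x:?T|lborel. U n x) - (LINT x:?T|lborel. u' x)) \<le> (LINT x|lborel. norm (f n x))" .
      qed
      then have "(\<lambda>n. LINT x:?T|lborel. U n x) \<longlonglongrightarrow> (LINT x:?T|lborel. u' x)" by (rule LIM_zero_cancel)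
      then show ?thesis unfolding ball_average_def by (rule tendsto_divide) (use R0 in auto)
    qed
    define \<kappa> where "\<kappa> n = max ((ball_average R0 (U n))\<^sup>2) V" for n
    define k where "k = max ((ball_average R0 u')\<^sup>2) V"
    have k: "k > 0" using V by (simp add: k_def less_max_iff_disj)
    have "\<kappa> \<longlonglongrightarrow> k" unfolding \<kappa>_def k_def by (intro tendsto_intros avg_lim)
    then have \<kappa>lim: "(\<lambda>n. \<kappa> (r n)) \<longlonglongrightarrow> k" using LIMSEQ_subseq_LIMSEQ[OF _ r(1)] by (auto simp: o_def)
    define H where "H n x = ennreal (Phi (\<kappa> (r n)) (U (r n) x) * gauss_weight \<beta> x) * indicator (cball 0 (R (r n))) x" for n x
    have [measurable]: "H n \<in> borel_measurable borel" for n unfolding H_def[abs_def] by measurable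
    have H_le: "(\<integral>\<^sup>+x. H n x \<partial>lborel) \<le> ennreal (C * V)" for n
      unfolding H_def \<kappa>_def
    proof (rule S[OF R])
      show "C1_on (cball 0 (R (r n))) (U (r n)) (snd (P (r n)))" by (rule C1_on_subset[OF C1]) simp
      have "C1 * wenergy \<beta> (R (r n)) (snd (P (r n))) \<le> C1 * (2 * d)" using P(3) R0 by (intro mult_left_mono) auto
      then show "C1 * wenergy \<beta> (R (r n)) (snd (P (r n))) \<le> V" using V by simp
    qed fact
    have "(\<integral>\<^sup>+x\<in>ball 0 1. ennreal (Phi k (u' x) * gauss_weight \<beta> x) \<partial>lborel) \<le> (\<integral>\<^sup>+x. liminf (\<lambda>n. H n x) \<partial>lborel)"
    proof (rule nn_integral_mono_AE)
      show "AE x in lborel. ennreal (Phi k (u' x) * gauss_weight \<beta> x) * indicator (ball 0 1) x \<le> liminf (\<lambda>n. H n x)"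
        using r(2)
      proof eventually_elim
        case (elim x)
        show ?case
        proof (cases "x \<in> ball 0 1")
          case True
          have "(\<lambda>n. ennreal (Phi (\<kappa> (r n)) (U (r n) x) * gauss_weight \<beta> x)) \<longlonglongrightarrow> ennreal (Phi k (u' x) * gauss_weight \<beta> x)"
            by (intro tendsto_ennrealI tendsto_mult Phi_tendsto \<kappa>lim k Ulim elim True tendsto_const)
          moreover have "eventually (\<lambda>n. ennreal (Phi (\<kappa> (r n)) (U (r n) x) * gauss_weight \<beta> x) = H n x) sequentially"
            using evR[OF True] by eventually_elim (simp add: H_def)
          ultimately have "(\<lambda>n. H n x) \<longlonglongrightarrow> ennreal (Phi k (u' x) * gauss_weight \<beta> x)"
            by (rule Lim_transform_eventually)
          then have "liminf (\<lambda>n. H n x) = ennreal (Phi k (u' x) * gauss_weight \<beta> x)"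
            by (intro lim_imp_Liminf) auto
          then show ?thesis using True by simp
        qed simp
      qed
    qed
    also have "\<dots> \<le> liminf (\<lambda>n. \<integral>\<^sup>+x. H n x \<partial>lborel)" by (rule nn_integral_liminf) measurable
    also have "\<dots> \<le> liminf (\<lambda>n. ennreal (C * V))" by (intro Liminf_mono always_eventually allI H_le)
    also have "\<dots> = ennreal (C * V)" by (simp add: Liminf_const)
    finally show ?thesis by (simp add: k_def)
  qed
  moreover have "0 \<le> 2 * C1" using R0 by simp
  ultimately show ?thesis using R0 by blast
qed

section \<open>Comparison of the hyperbolic measure with the smooth weight\<close>

definition hyp_density :: "real \<Rightarrow> 'a::euclidean_space \<Rightarrow> real" where
  "hyp_density \<beta> x = (2 / (1 - (norm x)\<^sup>2)) ^ DIM('a) * exp (- \<beta> * (hyp_dist0 x)\<^sup>2)"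

lemma hyp_dist0_measurable[measurable]: "hyp_dist0 \<in> borel_measurable borel"
  unfolding hyp_dist0_def[abs_def] by measurable

lemma hyp_density_measurable[measurable]: "hyp_density \<beta> \<in> borel_measurable borel"
  unfolding hyp_density_def[abs_def] by measurable

text \<open>With \<open>r = norm x\<close> the difference of the two functions is
  \<open>2 * (ln 2 - ln (1 + r))\<close>, at most \<open>2 * (1 - r)\<close>. It vanishes at the
  sphere fast enough to compensate the growth of their sum, because
  \<open>(1 - r) * hyp_log x\<close> is at most 4; this produces the constant 16.\<close>

lemma hyp_dist0_hyp_log:
  assumes "norm x < 1"
  shows "(hyp_dist0 x)\<^sup>2 \<le> (hyp_log x)\<^sup>2" "(hyp_log x)\<^sup>2 \<le> (hyp_dist0 x)\<^sup>2 + 16"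
proof -
  define r where "r = norm x"
  have r: "0 \<le> r" "r < 1" using assms by (auto simp: r_def)
  note q = norm_square_less_1[OF assms, folded r_def]
  have fac: "1 - r\<^sup>2 = (1 + r) * (1 - r)" by (simp add: power2_eq_square algebra_simps)
  have rho: "hyp_dist0 x = ln (1 + r) - ln (1 - r)" unfolding hyp_dist0_def r_def[symmetric] using r by (subst ln_div) auto
  have "ln (1 - r\<^sup>2) = ln (1 + r) + ln (1 - r)" unfolding fac using r by (intro ln_mult_pos) auto
  then have hyp_log: "hyp_log x = ln 4 - (ln (1 + r) + ln (1 - r))"
    unfolding hyp_log_def r_def[symmetric] using q by (subst ln_div) auto
  have l4: "ln (4::real) = 2 * ln 2" using ln_realpow[of 2 2] by simp
  have rho0: "0 \<le> hyp_dist0 x" unfolding rho using r by simp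
  have "ln (1 + r) \<le> ln 2" using r by simp
  then have le: "hyp_dist0 x \<le> hyp_log x" unfolding rho hyp_log l4 by simp
  then show "(hyp_dist0 x)\<^sup>2 \<le> (hyp_log x)\<^sup>2" using rho0 by (intro power_mono) auto
  have "ln (2 / (1 + r)) \<le> 2 / (1 + r) - 1" using r by (intro ln_le_minus_one) auto
  also have "\<dots> = (1 - r) / (1 + r)" using r by (simp add: field_simps)
  also have "\<dots> \<le> (1 - r) / 1" using r by (intro divide_left_mono) auto
  finally have "ln 2 - ln (1 + r) \<le> 1 - r" using r by (simp add: ln_div)
  then have diff: "hyp_log x - hyp_dist0 x \<le> 2 * (1 - r)" unfolding rho hyp_log l4 by simp
  have "(hyp_log x)\<^sup>2 - (hyp_dist0 x)\<^sup>2 = (hyp_log x - hyp_dist0 x) * (hyp_log x + hyp_dist0 x)"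
    by (simp add: power2_eq_square algebra_simps)
  also have "\<dots> \<le> (2 * (1 - r)) * (2 * hyp_log x)"
    using le diff rho0 r by (intro mult_mono) auto
  also have "\<dots> = 4 * ((1 - r) * hyp_log x)" by simp
  also have "\<dots> \<le> 4 * ((1 - r\<^sup>2) * hyp_log x)"
    using r hyp_log_bounds(1)[OF assms] power2_le_imp_le[of "r" 1] mult_left_mono[of r 1 r]
    by (intro mult_left_mono mult_right_mono) (auto simp: power2_eq_square)
  also have "\<dots> \<le> 4 * 4" using hyp_log_bounds(3)[OF assms] by (intro mult_left_mono) (auto simp: r_def)
  finally show "(hyp_log x)\<^sup>2 \<le> (hyp_dist0 x)\<^sup>2 + 16" by simp
qed

text \<open>\<open>2 ^ DIM('a)\<close> reflects that \<open>exp (hyp_log x)\<close> is twice the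
  conformal factor, and \<open>exp (16 * \<beta>)\<close> is the cost of exchanging the two squared
  radial functions.\<close>

lemma hyp_density_bounds:
  fixes x :: "'a::euclidean_space"
  assumes "norm x < 1" "\<beta> > 0"
  shows "gauss_weight \<beta> x \<le> 2 ^ DIM('a) * hyp_density \<beta> x" "hyp_density \<beta> x \<le> exp (16 * \<beta>) * gauss_weight \<beta> x" "0 < hyp_density \<beta> x"
proof -
  note q = norm_square_less_1[OF assms(1)]
  show pos: "0 < hyp_density \<beta> x" using q by (simp add: hyp_density_def)
  have "exp (hyp_log x) = 4 / (1 - (norm x)\<^sup>2)" unfolding hyp_log_def using q by (subst exp_ln) auto
  then have "exp (DIM('a) * hyp_log x) = (2 * (2 / (1 - (norm x)\<^sup>2))) ^ DIM('a)"
    by (simp add: exp_of_nat_mult)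
  then have gauss_weight: "gauss_weight \<beta> x = 2 ^ DIM('a) * ((2 / (1 - (norm x)\<^sup>2)) ^ DIM('a) * exp (- \<beta> * (hyp_log x)\<^sup>2))"
    unfolding gauss_weight_def power_mult_distrib by (simp add: exp_diff exp_minus divide_inverse)
  have "exp (- \<beta> * (hyp_log x)\<^sup>2) \<le> exp (- \<beta> * (hyp_dist0 x)\<^sup>2)"
    using hyp_dist0_hyp_log(1)[OF assms(1)] assms(2) by simp
  then show "gauss_weight \<beta> x \<le> 2 ^ DIM('a) * hyp_density \<beta> x"
    unfolding gauss_weight hyp_density_def using q by (intro mult_left_mono) auto
  have "\<beta> * (hyp_log x)\<^sup>2 \<le> \<beta> * ((hyp_dist0 x)\<^sup>2 + 16)"
    using hyp_dist0_hyp_log(2)[OF assms(1)] assms(2) by (intro mult_left_mono) auto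
  then have "exp (- \<beta> * (hyp_dist0 x)\<^sup>2) \<le> exp (16 * \<beta> + - \<beta> * (hyp_log x)\<^sup>2)"
    by (simp add: algebra_simps)
  also have "\<dots> = exp (16 * \<beta>) * exp (- \<beta> * (hyp_log x)\<^sup>2)" by (rule exp_add)
  finally have "hyp_density \<beta> x \<le> (2 / (1 - (norm x)\<^sup>2)) ^ DIM('a) * (exp (16 * \<beta>) * exp (- \<beta> * (hyp_log x)\<^sup>2))"
    unfolding hyp_density_def using q by (intro mult_left_mono) auto
  also have "\<dots> = 1 * (exp (16 * \<beta>) * ((2 / (1 - (norm x)\<^sup>2)) ^ DIM('a) * exp (- \<beta> * (hyp_log x)\<^sup>2)))" by simp
  also have "\<dots> \<le> 2 ^ DIM('a) * (exp (16 * \<beta>) * ((2 / (1 - (norm x)\<^sup>2)) ^ DIM('a) * exp (- \<beta> * (hyp_log x)\<^sup>2)))"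
    using q by (intro mult_right_mono) auto
  also have "\<dots> = exp (16 * \<beta>) * gauss_weight \<beta> x" unfolding gauss_weight by simp
  finally show "hyp_density \<beta> x \<le> exp (16 * \<beta>) * gauss_weight \<beta> x" .
qed

lemma borel_measurable_lebesgue_on_ball:
  "f \<in> borel_measurable borel \<Longrightarrow> f \<in> borel_measurable (lebesgue_on (ball (0::'a::euclidean_space) 1))"
  by (intro measurable_restrict_space1 measurable_completion) simp

lemma nn_integral_lebesgue_on_ball:
  fixes f :: "'a::euclidean_space \<Rightarrow> ennreal"
  shows "(\<integral>\<^sup>+x. f x \<partial>lebesgue_on (ball 0 1)) = (\<integral>\<^sup>+x\<in>ball 0 1. f x \<partial>lborel)"
  by (subst nn_integral_restrict_space) (auto simp: nn_integral_completion)

text \<open>A Bochner integral is 0 by default for a function that is not integrable, so positivity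
  of the constant requires integrability. This follows from boundedness of the density on a ball of
  finite measure.\<close>

lemma hyp_gauss_const_pos:
  assumes "\<beta> > 0"
  shows "0 < hyp_gauss_const TYPE('a::euclidean_space) \<beta>"
    "(\<integral>\<^sup>+x. ennreal (hyp_density \<beta> x) \<partial>lebesgue_on (ball (0::'a) 1)) = ennreal (hyp_gauss_const TYPE('a) \<beta>)"
proof -
  let ?B = "ball (0::'a) 1" and ?L = "lebesgue_on (ball (0::'a) 1)"
  have sp: "space ?L = ?B" by (simp add: space_restrict_space)
  have bounds: "0 < hyp_density \<beta> x" "hyp_density \<beta> x \<le> exp (16 * \<beta>) * exp ((real DIM('a))\<^sup>2 / (4 * \<beta>))" if "x \<in> ?B" for x
  proof -
    have "hyp_density \<beta> x \<le> exp (16 * \<beta>) * gauss_weight \<beta> x" using that assms by (intro hyp_density_bounds) auto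
    also have "\<dots> \<le> exp (16 * \<beta>) * exp ((real DIM('a))\<^sup>2 / (4 * \<beta>))"
      by (intro mult_left_mono gauss_weight_le assms) auto
    finally show "hyp_density \<beta> x \<le> exp (16 * \<beta>) * exp ((real DIM('a))\<^sup>2 / (4 * \<beta>))" .
    show "0 < hyp_density \<beta> x" using that assms by (intro hyp_density_bounds) auto
  qed
  have emL: "emeasure ?L ?B = emeasure lborel ?B" by (subst emeasure_restrict_space) auto
  have fin: "finite_measure ?L"
    using emeasure_bounded_finite[of ?B] by (intro finite_measureI) (simp add: sp emL)
  have meas: "hyp_density \<beta> \<in> borel_measurable ?L" by (rule borel_measurable_lebesgue_on_ball) simp
  have int: "integrable ?L (hyp_density \<beta>)"
    using bounds
    by (intro finite_measure.integrable_const_bound[OF fin _ meas, where B="exp (16 * \<beta>) * exp ((real DIM('a))\<^sup>2 / (4 * \<beta>))"] AE_I2)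
      (auto simp: sp less_imp_le)
  have "hyp_gauss_const TYPE('a) \<beta> = (LINT x|?L. (2 / (1 - (norm x)\<^sup>2)) ^ DIM('a) *\<^sub>R exp (- \<beta> * (hyp_dist0 x)\<^sup>2))"
    unfolding hyp_gauss_const_def hyp_volume_def
  proof (rule integral_density)
    show "AE x in ?L. 0 \<le> (2 / (1 - (norm x)\<^sup>2)) ^ DIM('a)"
    proof (rule AE_I2)
      fix x assume "x \<in> space ?L"
      then have "1 - (norm x)\<^sup>2 > 0" by (intro norm_square_less_1) (simp add: sp)
      then show "0 \<le> (2 / (1 - (norm x)\<^sup>2)) ^ DIM('a)" by simp
    qed
  qed (auto intro!: borel_measurable_lebesgue_on_ball)
  then have G: "hyp_gauss_const TYPE('a) \<beta> = (LINT x|?L. hyp_density \<beta> x)"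
    by (simp add: hyp_density_def)
  show "(\<integral>\<^sup>+x. ennreal (hyp_density \<beta> x) \<partial>?L) = ennreal (hyp_gauss_const TYPE('a) \<beta>)"
    unfolding G using bounds by (intro nn_integral_eq_integral int AE_I2) (auto simp: sp less_imp_le)
  have "0 \<le> hyp_gauss_const TYPE('a) \<beta>"
    unfolding G using bounds by (intro integral_nonneg_AE AE_I2) (auto simp: sp less_imp_le)
  moreover have "hyp_gauss_const TYPE('a) \<beta> \<noteq> 0"
  proof
    assume "hyp_gauss_const TYPE('a) \<beta> = 0"
    then have "AE x in ?L. hyp_density \<beta> x = 0"
      unfolding G using bounds by (subst (asm) integral_nonneg_eq_0_iff_AE[OF int]) (auto simp: sp less_imp_le)
    then have "AE x in ?L. False"
    proof (rule AE_mp[OF _ AE_I2])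
      fix x assume "x \<in> space ?L"
      then show "hyp_density \<beta> x = 0 \<longrightarrow> False" using bounds(1)[of x] by (simp add: sp)
    qed
    moreover have "?B \<in> sets ?L" using sets.top[of ?L] by (simp only: sp)
    moreover have "{x \<in> space ?L. \<not> False} = ?B" by (simp only: sp simp_thms Collect_mem_eq)
    ultimately have "emeasure ?L ?B = 0" using AE_iff_measurable[of ?B ?L "\<lambda>_. False"] by (simp only:)
    then have "measure lborel ?B = 0" unfolding emL by (simp add: measure_def)
    then show False by simp
  qed
  ultimately show "0 < hyp_gauss_const TYPE('a) \<beta>" by simp
qed

lemma hyp_gauss_eq:
  assumes "\<beta> > 0"
  shows "hyp_gauss \<beta> = density (lebesgue_on (ball (0::'a::euclidean_space) 1))
    (\<lambda>x. ennreal (hyp_density \<beta> x / hyp_gauss_const TYPE('a) \<beta>))"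
proof -
  let ?L = "lebesgue_on (ball (0::'a) 1)"
  have "hyp_gauss \<beta> = density ?L (\<lambda>x. ennreal ((2 / (1 - (norm x)\<^sup>2)) ^ DIM('a))
      * ennreal (exp (- \<beta> * (hyp_dist0 x)\<^sup>2) / hyp_gauss_const TYPE('a) \<beta>))"
    unfolding hyp_gauss_def hyp_volume_def
    by (rule density_density_eq) (auto intro!: borel_measurable_lebesgue_on_ball)
  also have "\<dots> = density ?L (\<lambda>x. ennreal (hyp_density \<beta> x / hyp_gauss_const TYPE('a) \<beta>))"
  proof (rule density_cong)
    show "AE x in ?L. ennreal ((2 / (1 - (norm x)\<^sup>2)) ^ DIM('a)) * ennreal (exp (- \<beta> * (hyp_dist0 x)\<^sup>2) / hyp_gauss_const TYPE('a) \<beta>)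
        = ennreal (hyp_density \<beta> x / hyp_gauss_const TYPE('a) \<beta>)"
    proof (rule AE_I2)
      fix x assume "x \<in> space ?L"
      then have "1 - (norm x)\<^sup>2 > 0" by (intro norm_square_less_1) (auto simp: space_restrict_space)
      then show "ennreal ((2 / (1 - (norm x)\<^sup>2)) ^ DIM('a)) * ennreal (exp (- \<beta> * (hyp_dist0 x)\<^sup>2) / hyp_gauss_const TYPE('a) \<beta>)
        = ennreal (hyp_density \<beta> x / hyp_gauss_const TYPE('a) \<beta>)"
        using hyp_gauss_const_pos(1)[OF assms, where 'a='a]
        by (subst ennreal_mult[symmetric]) (auto simp: hyp_density_def)
    qed
  qed (auto intro!: borel_measurable_lebesgue_on_ball)
  finally show ?thesis .
qed

lemma nn_integral_hyp_gauss:
  fixes f :: "'a::euclidean_space \<Rightarrow> ennreal"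
  assumes "\<beta> > 0" "f \<in> borel_measurable borel"
  shows "(\<integral>\<^sup>+x. f x \<partial>hyp_gauss \<beta>)
    = (\<integral>\<^sup>+x\<in>ball 0 1. ennreal (hyp_density \<beta> x / hyp_gauss_const TYPE('a) \<beta>) * f x \<partial>lborel)"
  unfolding hyp_gauss_eq[OF assms(1)]
  using borel_measurable_lebesgue_on_ball[OF assms(2)]
  by (subst nn_integral_density) (auto intro!: borel_measurable_lebesgue_on_ball simp: nn_integral_lebesgue_on_ball)

lemma prob_hyp_gauss:
  assumes "\<beta> > 0"
  shows "emeasure (hyp_gauss \<beta>) (space (hyp_gauss \<beta> :: 'a::euclidean_space measure)) = 1"
proof -
  let ?G = "hyp_gauss_const TYPE('a) \<beta>"
  note G = hyp_gauss_const_pos[OF assms, where 'a='a]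
  have "emeasure (hyp_gauss \<beta>) (space (hyp_gauss \<beta> :: 'a measure)) = (\<integral>\<^sup>+x. 1 \<partial>(hyp_gauss \<beta> :: 'a measure))"
    by simp
  also have "\<dots> = (\<integral>\<^sup>+x. ennreal (hyp_density \<beta> x / ?G) \<partial>lebesgue_on (ball (0::'a) 1))"
    by (simp add: nn_integral_hyp_gauss[OF assms, of "\<lambda>_. 1"] nn_integral_lebesgue_on_ball del: nn_integral_const)
  also have "\<dots> = (\<integral>\<^sup>+x. ennreal (1 / ?G) * ennreal (hyp_density \<beta> x) \<partial>lebesgue_on (ball (0::'a) 1))"
    using G(1) by (intro nn_integral_cong) (simp add: ennreal_mult'[symmetric])
  also have "\<dots> = ennreal (1 / ?G) * ennreal ?G"
    by (subst nn_integral_cmult) (auto intro!: borel_measurable_lebesgue_on_ball simp: G(2))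
  also have "\<dots> = 1" using G(1) by (simp add: ennreal_mult[symmetric])
  finally show ?thesis .
qed

lemma hyp_norm_hyp_grad:
  assumes "norm x < 1"
  shows "(hyp_norm x (hyp_grad g x))\<^sup>2 = ((1 - (norm x)\<^sup>2) / 2)\<^sup>2 * (norm (g x))\<^sup>2"
proof -
  have "hyp_norm x (hyp_grad g x) = q / 2 * norm (g x)" if "q = 1 - (norm x)\<^sup>2" "q > 0" for q
    using that(2) unfolding hyp_norm_def hyp_grad_def that(1)[symmetric] by (simp add: power2_eq_square)
  from this[OF refl norm_square_less_1[OF assms]] show ?thesis
    by (simp only: power_mult_distrib)
qed

section \<open>The entropy and the theorem\<close>

text \<open>With \<open>A\<close> the mean square of \<open>v\<close>, the entropy differs from the
  integral of \<open>Phi k\<close> by \<open>A * ln (k / A) + A - k\<close>, which is at most 0 and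
  vanishes for \<open>k = A\<close>. The total mass 1 enters through the integral of the constant
  \<open>k\<close>. Integrability of the entropy density is read off from the same identity.\<close>

lemma entropy_le_Phi:
  fixes v :: "'b \<Rightarrow> real"
  assumes mass: "emeasure M (space M) = 1" and [measurable]: "v \<in> borel_measurable M"
    and v2: "integrable M (\<lambda>x. (v x)\<^sup>2)" and A: "0 < (LINT x|M. (v x)\<^sup>2)"
    and k: "0 < k" and B: "0 \<le> B" "(\<integral>\<^sup>+x. ennreal (Phi k (v x)) \<partial>M) \<le> ennreal B"
  shows "integrable M (\<lambda>x. (v x)\<^sup>2 * ln ((v x)\<^sup>2 / (LINT y|M. (v y)\<^sup>2)))"
    and "(LINT x|M. (v x)\<^sup>2 * ln ((v x)\<^sup>2 / (LINT y|M. (v y)\<^sup>2))) \<le> B"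
proof -
  define A where "A = (LINT y|M. (v y)\<^sup>2)"
  have A0: "A > 0" using A by (simp add: A_def)
  have fin: "finite_measure M" using mass by (intro finite_measureI) simp
  have meas1: "measure M (space M) = 1" using mass by (simp add: measure_def)
  have iPhi: "integrable M (\<lambda>x. Phi k (v x))"
    using B Phi_nonneg[OF k] by (intro integrableI_bounded) (auto intro: le_less_trans)
  \<comment> \<open>At a zero of \<open>v\<close> the logarithm is multiplied by 0, which realises
    the convention for \<open>0 log 0\<close>; both sides are then 0.\<close>
  have eq: "(v x)\<^sup>2 * ln ((v x)\<^sup>2 / A) = Phi k (v x) + (v x)\<^sup>2 * (1 + ln (k / A)) - k" for x
    using A0 k by (cases "v x = 0") (auto simp: Phi_def ln_div algebra_simps)
  have ik: "integrable M (\<lambda>x. k)" using finite_measure.integrable_const[OF fin] .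
  show "integrable M (\<lambda>x. (v x)\<^sup>2 * ln ((v x)\<^sup>2 / (LINT y|M. (v y)\<^sup>2)))"
    unfolding A_def[symmetric] eq
    by (intro Bochner_Integration.integrable_diff Bochner_Integration.integrable_add integrable_mult_left iPhi v2 ik)
  have "(LINT x|M. (v x)\<^sup>2 * ln ((v x)\<^sup>2 / A)) = (LINT x|M. Phi k (v x)) + A * (1 + ln (k / A)) - k"
    unfolding eq using iPhi v2 ik by (simp add: A_def meas1)
  also have "\<dots> \<le> (LINT x|M. Phi k (v x))"
  proof -
    have "A * ln (k / A) \<le> A * (k / A - 1)"
      using A0 k by (intro mult_left_mono ln_le_minus_one) auto
    also have "\<dots> = k - A" using A0 by (simp add: field_simps)
    finally show ?thesis by (simp add: distrib_left)
  qed
  also have "\<dots> \<le> B"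
  proof -
    have "ennreal (LINT x|M. Phi k (v x)) \<le> ennreal B"
      using B(2) Phi_nonneg[OF k] by (subst nn_integral_eq_integral[OF iPhi, symmetric]) auto
    then show ?thesis using B(1) by simp
  qed
  finally show "(LINT x|M. (v x)\<^sup>2 * ln ((v x)\<^sup>2 / (LINT y|M. (v y)\<^sup>2))) \<le> B"
    by (simp only: A_def)
qed

theorem theorem1p10:
  fixes \<beta> :: real
  assumes "DIM('a::euclidean_space) \<ge> 2" and "\<beta> > 0"
  shows "\<exists>LS>0. \<forall>(u :: 'a \<Rightarrow> real) g.
    has_weak_gradient u g (ball 0 1) \<and>
    \<not> (AE x in hyp_gauss \<beta>. u x = 0) \<and>
    (\<integral>\<^sup>+x. ennreal ((hyp_norm x (hyp_grad g x))\<^sup>2) \<partial>hyp_gauss \<beta>)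
      + (\<integral>\<^sup>+x. ennreal (\<bar>u x\<bar>\<^sup>2) \<partial>hyp_gauss \<beta>) < \<infinity> \<longrightarrow>
    integrable (hyp_gauss \<beta>)
      (\<lambda>x. \<bar>u x\<bar>\<^sup>2 * ln (\<bar>u x\<bar>\<^sup>2 / (LINT y|hyp_gauss \<beta>. \<bar>u y\<bar>\<^sup>2))) \<and>
    (LINT x|hyp_gauss \<beta>. \<bar>u x\<bar>\<^sup>2 * ln (\<bar>u x\<bar>\<^sup>2 / (LINT y|hyp_gauss \<beta>. \<bar>u y\<bar>\<^sup>2)))
      \<le> LS * (LINT x|hyp_gauss \<beta>. (hyp_norm x (hyp_grad g x))\<^sup>2)"
proof -
  let ?M = "hyp_gauss \<beta> :: 'a measure" and ?B = "ball (0::'a) 1"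
  have [measurable]: "?B \<in> sets borel" by simp
  define G where "G = hyp_gauss_const TYPE('a) \<beta>"
  have G: "G > 0" unfolding G_def by (rule hyp_gauss_const_pos(1)[OF assms(2)])
  obtain R0 C1 C where C: "0 \<le> C1" "0 \<le> C"
    and W: "\<And>(u :: 'a \<Rightarrow> real) g u' g' d V. has_weak_gradient u g ?B \<Longrightarrow> u' \<in> borel_measurable borel \<Longrightarrow> g' \<in> borel_measurable borel \<Longrightarrow>
      (AE x in lborel. x \<in> ?B \<longrightarrow> u x = u' x \<and> g x = g' x) \<Longrightarrow> 0 \<le> d \<Longrightarrow>
      (\<integral>\<^sup>+x\<in>?B. ennreal (((1 - (norm x)\<^sup>2) / 2)\<^sup>2 * (norm (g' x))\<^sup>2 * gauss_weight \<beta> x) \<partial>lborel) \<le> ennreal d \<Longrightarrow>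
      0 < V \<Longrightarrow> C1 * d \<le> V \<Longrightarrow>
      (\<integral>\<^sup>+x\<in>?B. ennreal (Phi (max ((ball_average R0 u')\<^sup>2) V) (u' x) * gauss_weight \<beta> x) \<partial>lborel) \<le> ennreal (C * V)"
    using weak_log_Sobolev[OF assms(2), where 'a='a] by blast
  define K where "K = exp (16 * \<beta>) / G * C"
  have K: "K \<ge> 0" using G C by (simp add: K_def)
  \<comment> \<open>\<open>2 ^ DIM('a) * G\<close> converts the energy for the probability measure
    into the one for \<open>gauss_weight\<close>, and \<open>K\<close> converts the bound back. The
    added 1 makes \<open>LS\<close> positive.\<close>
  define LS where "LS = K * C1 * (2 ^ DIM('a) * G) + 1"
  have LS: "LS > 0" using K C G by (simp add: LS_def add_nonneg_pos)
  have sp: "space ?M = ?B" by (simp add: hyp_gauss_def hyp_volume_def space_restrict_space)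
  have setsM: "sets ?M = sets (lebesgue_on ?B)" by (simp add: hyp_gauss_def hyp_volume_def)
  have "integrable ?M (\<lambda>x. \<bar>u x\<bar>\<^sup>2 * ln (\<bar>u x\<bar>\<^sup>2 / (LINT y|?M. \<bar>u y\<bar>\<^sup>2))) \<and>
    (LINT x|?M. \<bar>u x\<bar>\<^sup>2 * ln (\<bar>u x\<bar>\<^sup>2 / (LINT y|?M. \<bar>u y\<bar>\<^sup>2))) \<le> LS * (LINT x|?M. (hyp_norm x (hyp_grad g x))\<^sup>2)"
    if wg: "has_weak_gradient u g ?B" and nz: "\<not> (AE x in ?M. u x = 0)"
      and fin: "(\<integral>\<^sup>+x. ennreal ((hyp_norm x (hyp_grad g x))\<^sup>2) \<partial>?M) + (\<integral>\<^sup>+x. ennreal (\<bar>u x\<bar>\<^sup>2) \<partial>?M) < \<infinity>"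
    for u :: "'a \<Rightarrow> real" and g
  proof -
    have mu: "(\<lambda>x. indicator ?B x *\<^sub>R u x) \<in> borel_measurable lebesgue"
      "(\<lambda>x. indicator ?B x *\<^sub>R g x) \<in> borel_measurable lebesgue"
      using wg unfolding has_weak_gradient_def by (intro locally_integrable_measurable; blast)+
    obtain u' where u'[measurable]: "u' \<in> borel_measurable borel" "AE x in lborel. indicator ?B x *\<^sub>R u x = u' x"
      using borel_representative[OF mu(1)] by blast
    obtain g' where g'[measurable]: "g' \<in> borel_measurable borel" "AE x in lborel. indicator ?B x *\<^sub>R g x = g' x"
      using borel_representative[OF mu(2)] by blast
    have ae: "AE x in lborel. x \<in> ?B \<longrightarrow> u x = u' x \<and> g x = g' x"
      using u'(2) g'(2) by eventually_elim auto
    have aeM: "AE x in ?M. u x = u' x \<and> g x = g' x"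
    proof -
      have "AE x in lebesgue_on ?B. u x = u' x \<and> g x = g' x"
        using AE_completion[OF ae] by (subst AE_restrict_space_iff) auto
      then show ?thesis
        unfolding hyp_gauss_eq[OF assms(2)]
        by (subst AE_density) (auto intro!: borel_measurable_lebesgue_on_ball elim: eventually_mono)
    qed
    have "u \<in> borel_measurable (lebesgue_on ?B)" "g \<in> borel_measurable (lebesgue_on ?B)"
      using mu by (subst borel_measurable_restrict_space_iff; simp)+
    then have uM[measurable]: "u \<in> borel_measurable ?M" "g \<in> borel_measurable ?M"
      using measurable_cong_sets[OF setsM refl] by blast+
    have hg[measurable]: "(\<lambda>x. (hyp_norm x (hyp_grad g x))\<^sup>2) \<in> borel_measurable ?M"
    proof (subst measurable_cong)
      show "(hyp_norm x (hyp_grad g x))\<^sup>2 = ((1 - (norm x)\<^sup>2) / 2)\<^sup>2 * (norm (g x))\<^sup>2" if "x \<in> space ?M" for x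
        using that by (intro hyp_norm_hyp_grad) (simp add: sp)
      have "(\<lambda>x::'a. ((1 - (norm x)\<^sup>2) / 2)\<^sup>2) \<in> borel_measurable ?M"
        using measurable_cong_sets[OF setsM refl] borel_measurable_lebesgue_on_ball[of "\<lambda>x::'a. ((1 - (norm x)\<^sup>2) / 2)\<^sup>2"]
        by auto
      then show "(\<lambda>x. ((1 - (norm x)\<^sup>2) / 2)\<^sup>2 * (norm (g x))\<^sup>2) \<in> borel_measurable ?M" by measurable
    qed
    define E where "E = (LINT x|?M. (hyp_norm x (hyp_grad g x))\<^sup>2)"
    have E0: "E \<ge> 0" unfolding E_def by (intro integral_nonneg_AE) auto
    have "integrable ?M (\<lambda>x. (hyp_norm x (hyp_grad g x))\<^sup>2)"
      using fin by (intro integrableI_bounded) (auto simp: ennreal_add_less_top)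
    then have E: "(\<integral>\<^sup>+x. ennreal ((hyp_norm x (hyp_grad g x))\<^sup>2) \<partial>?M) = ennreal E"
      unfolding E_def by (intro nn_integral_eq_integral) auto
    define d where "d = 2 ^ DIM('a) * G * E"
    have d0: "d \<ge> 0" using G E0 by (simp add: d_def)
    have d: "(\<integral>\<^sup>+x\<in>?B. ennreal (((1 - (norm x)\<^sup>2) / 2)\<^sup>2 * (norm (g' x))\<^sup>2 * gauss_weight \<beta> x) \<partial>lborel) \<le> ennreal d"
    proof -
      let ?e = "\<lambda>x. ((1 - (norm x)\<^sup>2) / 2)\<^sup>2 * (norm (g' x))\<^sup>2"
      have "(\<integral>\<^sup>+x\<in>?B. ennreal (?e x * gauss_weight \<beta> x) \<partial>lborel)
        \<le> (\<integral>\<^sup>+x. ennreal (2 ^ DIM('a) * G) * (ennreal (hyp_density \<beta> x / G) * ennreal (?e x) * indicator ?B x) \<partial>lborel)"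
      proof (intro nn_integral_mono)
        fix x :: 'a
        show "ennreal (?e x * gauss_weight \<beta> x) * indicator ?B x
          \<le> ennreal (2 ^ DIM('a) * G) * (ennreal (hyp_density \<beta> x / G) * ennreal (?e x) * indicator ?B x)"
        proof (cases "x \<in> ?B")
          case True
          then have nx: "norm x < 1" by simp
          have "?e x * gauss_weight \<beta> x \<le> ?e x * (2 ^ DIM('a) * hyp_density \<beta> x)"
            by (intro mult_left_mono hyp_density_bounds nx assms) auto
          also have "\<dots> = (2 ^ DIM('a) * G) * (hyp_density \<beta> x / G * ?e x)" using G by simp
          finally have "ennreal (?e x * gauss_weight \<beta> x) \<le> ennreal ((2 ^ DIM('a) * G) * (hyp_density \<beta> x / G * ?e x))"
            by (rule ennreal_leI)
          also have "\<dots> = ennreal (2 ^ DIM('a) * G) * (ennreal (hyp_density \<beta> x / G) * ennreal (?e x))"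
            using G hyp_density_bounds(3)[OF nx assms(2)] by (simp only: ennreal_mult[symmetric] mult_nonneg_nonneg less_imp_le divide_nonneg_pos zero_le_power zero_le_power2 zero_le_numeral)
          finally show ?thesis using True by simp
        qed simp
      qed
      also have "\<dots> = ennreal (2 ^ DIM('a) * G) * (\<integral>\<^sup>+x\<in>?B. ennreal (hyp_density \<beta> x / G) * ennreal (?e x) \<partial>lborel)"
        by (rule nn_integral_cmult) measurable
      also have "(\<integral>\<^sup>+x\<in>?B. ennreal (hyp_density \<beta> x / G) * ennreal (?e x) \<partial>lborel) = (\<integral>\<^sup>+x. ennreal (?e x) \<partial>?M)"
        unfolding G_def by (rule nn_integral_hyp_gauss[OF assms(2), symmetric]) measurable
      also have "\<dots> = (\<integral>\<^sup>+x. ennreal ((hyp_norm x (hyp_grad g x))\<^sup>2) \<partial>?M)"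
      proof (rule nn_integral_cong_AE)
        show "AE x in ?M. ennreal (?e x) = ennreal ((hyp_norm x (hyp_grad g x))\<^sup>2)"
          using aeM AE_space
        proof eventually_elim
          case (elim x)
          then have "norm x < 1" by (simp add: sp)
          with elim show ?case by (simp only: hyp_norm_hyp_grad)
        qed
      qed
      also have "ennreal (2 ^ DIM('a) * G) * \<dots> = ennreal d"
        unfolding E d_def using G E0 by (intro ennreal_mult[symmetric]) auto
      finally show ?thesis .
    qed
    \<comment> \<open>\<open>V\<close> stays free here, because \<open>C1 * d\<close> itself may be
      0 and is then not admissible.\<close>
    have bound: "integrable ?M (\<lambda>x. (u x)\<^sup>2 * ln ((u x)\<^sup>2 / (LINT y|?M. (u y)\<^sup>2)))"
      "(LINT x|?M. (u x)\<^sup>2 * ln ((u x)\<^sup>2 / (LINT y|?M. (u y)\<^sup>2))) \<le> K * V"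
      if V: "0 < V" "C1 * d \<le> V" for V
    proof -
      define k where "k = max ((ball_average R0 u')\<^sup>2) V"
      have k: "k > 0" using V by (simp add: k_def less_max_iff_disj)
      have "(\<integral>\<^sup>+x. ennreal (Phi k (u x)) \<partial>?M) = (\<integral>\<^sup>+x. ennreal (Phi k (u' x)) \<partial>?M)"
        using aeM by (intro nn_integral_cong_AE) (auto elim: eventually_mono)
      also have "\<dots> = (\<integral>\<^sup>+x\<in>?B. ennreal (hyp_density \<beta> x / G) * ennreal (Phi k (u' x)) \<partial>lborel)"
        unfolding G_def by (rule nn_integral_hyp_gauss[OF assms(2)]) measurable
      also have "\<dots> \<le> (\<integral>\<^sup>+x. ennreal (exp (16 * \<beta>) / G) * (ennreal (Phi k (u' x) * gauss_weight \<beta> x) * indicator ?B x) \<partial>lborel)"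
      proof (intro nn_integral_mono)
        fix x :: 'a
        show "ennreal (hyp_density \<beta> x / G) * ennreal (Phi k (u' x)) * indicator ?B x
          \<le> ennreal (exp (16 * \<beta>) / G) * (ennreal (Phi k (u' x) * gauss_weight \<beta> x) * indicator ?B x)"
        proof (cases "x \<in> ?B")
          case True
          then have nx: "norm x < 1" by simp
          have "hyp_density \<beta> x / G \<le> exp (16 * \<beta>) * gauss_weight \<beta> x / G"
            using G by (intro divide_right_mono hyp_density_bounds nx assms) auto
          then have "hyp_density \<beta> x / G * Phi k (u' x) \<le> exp (16 * \<beta>) * gauss_weight \<beta> x / G * Phi k (u' x)"
            by (intro mult_right_mono Phi_nonneg k)
          then have "ennreal (hyp_density \<beta> x / G * Phi k (u' x)) \<le> ennreal (exp (16 * \<beta>) / G * (Phi k (u' x) * gauss_weight \<beta> x))"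
            by (intro ennreal_leI) (simp add: mult_ac)
          moreover have "ennreal (hyp_density \<beta> x / G * Phi k (u' x)) = ennreal (hyp_density \<beta> x / G) * ennreal (Phi k (u' x))"
            using G hyp_density_bounds(3)[OF nx assms(2)] Phi_nonneg[OF k] by (intro ennreal_mult) auto
          moreover have "ennreal (exp (16 * \<beta>) / G * (Phi k (u' x) * gauss_weight \<beta> x)) = ennreal (exp (16 * \<beta>) / G) * ennreal (Phi k (u' x) * gauss_weight \<beta> x)"
            using G Phi_nonneg[OF k, of "u' x"] less_imp_le[OF gauss_weight_pos, of \<beta> x] by (intro ennreal_mult mult_nonneg_nonneg) auto
          ultimately show ?thesis using True by simp
        qed simp
      qed
      also have "\<dots> = ennreal (exp (16 * \<beta>) / G) * (\<integral>\<^sup>+x\<in>?B. ennreal (Phi k (u' x) * gauss_weight \<beta> x) \<partial>lborel)"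
        by (rule nn_integral_cmult) measurable
      also have "\<dots> \<le> ennreal (exp (16 * \<beta>) / G) * ennreal (C * V)"
        unfolding k_def by (intro mult_left_mono W[OF wg u'(1) g'(1) ae d0 d V]) simp
      also have "\<dots> = ennreal (K * V)"
        using G C V by (subst ennreal_mult[symmetric]) (auto simp: K_def mult_ac)
      finally have Phi_le: "(\<integral>\<^sup>+x. ennreal (Phi k (u x)) \<partial>?M) \<le> ennreal (K * V)" .
      have u2: "integrable ?M (\<lambda>x. (u x)\<^sup>2)"
        using fin by (intro integrableI_bounded) (auto simp: ennreal_add_less_top)
      have "(LINT x|?M. (u x)\<^sup>2) \<noteq> 0"
        using nz integral_nonneg_eq_0_iff_AE[OF u2] by auto
      moreover have "0 \<le> (LINT x|?M. (u x)\<^sup>2)" by (intro integral_nonneg_AE) auto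
      ultimately have A: "0 < (LINT x|?M. (u x)\<^sup>2)" by linarith
      have KV: "0 \<le> K * V" using K V by simp
      note ent = entropy_le_Phi[OF prob_hyp_gauss[OF assms(2)] uM(1) u2 A k KV Phi_le]
      show "integrable ?M (\<lambda>x. (u x)\<^sup>2 * ln ((u x)\<^sup>2 / (LINT y|?M. (u y)\<^sup>2)))"
        "(LINT x|?M. (u x)\<^sup>2 * ln ((u x)\<^sup>2 / (LINT y|?M. (u y)\<^sup>2))) \<le> K * V"
        using ent .
    qed
    have Cd: "0 \<le> C1 * d" using C d0 by simp
    have "(LINT x|?M. (u x)\<^sup>2 * ln ((u x)\<^sup>2 / (LINT y|?M. (u y)\<^sup>2))) \<le> K * (C1 * d)"
    proof (rule field_le_epsilon)
      fix \<epsilon> :: real assume "\<epsilon> > 0"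
      \<comment> \<open>\<open>V\<close> exceeds \<open>C1 * d\<close> by this amount; the
        denominator keeps the resulting excess of \<open>K * V\<close> below \<epsilon>, also for
        \<open>K = 0\<close>.\<close>
      then have e: "0 < \<epsilon> / (K + 1)" using K by simp
      have "(LINT x|?M. (u x)\<^sup>2 * ln ((u x)\<^sup>2 / (LINT y|?M. (u y)\<^sup>2))) \<le> K * (C1 * d + \<epsilon> / (K + 1))"
        using e Cd by (intro bound) auto
      also have "\<dots> \<le> K * (C1 * d) + \<epsilon>"
        using K \<open>\<epsilon> > 0\<close> by (simp add: distrib_left field_simps)
      finally show "(LINT x|?M. (u x)\<^sup>2 * ln ((u x)\<^sup>2 / (LINT y|?M. (u y)\<^sup>2))) \<le> K * (C1 * d) + \<epsilon>" .
    qed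
    also have "\<dots> \<le> LS * E"
      using E0 by (simp add: LS_def d_def algebra_simps)
    \<comment> \<open>Integrability needs just one admissible value of \<open>V\<close>, for which
      \<open>C1 * d + 1\<close> serves.\<close>
    finally show ?thesis
      using bound(1)[of "C1 * d + 1"] Cd by (simp add: E_def)
  qed
  then show ?thesis using LS by blast
qed

end
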